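(* Let $f_1,g_1$ be given bounded spectral densities, $\varepsilon_1,\varepsilon_2>0$, and $$D_{\varepsilon_1}^1=\Big\{f:\tfrac1{2\pi}\int_{-\infty}^\infty|f(\lambda)-f_1(\lambda)|d\lambda\le\varepsilon_1\Big\},\qquad D_{\varepsilon_2}^2=\Big\{g:\tfrac1{2\pi}\int_{-\infty}^\infty|g(\lambda)-g_1(\lambda)|^2d\lambda\le\varepsilon_2\Big\}.$$ Let the spectral densities $f_0\in D_{\varepsilon_1}^1$, $g_0\in D_{\varepsilon_2}^2$ satisfy the minimality condition, let the operator $\mathbf{B}^0$ be invertible, and let the functions $$h_f(f_0,g_0)=\frac{|A(e^{i\lambda})g_0(\lambda)+C^0(e^{i\lambda})|^2}{(f_0(\lambda)+g_0(\lambda))^2},\qquad h_g(f_0,g_0)=\frac{|A(e^{i\lambda})f_0(\lambda)-C^0(e^{i\lambda})|^2}{(f_0(\lambda)+g_0(\lambda))^2}$$ be bounded. Suppose that there are constants $\alpha_1\ge0$, $\alpha_2\ge0$ and a function $\Psi$ with $|\Psi(\lambda)|\le1$ and $\Psi(\lambda)=\operatorname{sign}(f_0(\lambda)-f_1(\lambda))$ when $f_0(\lambda)\ne f_1(\lambda)$, such that $$|A(e^{i\lambda})g_0(\lambda)+C^0(e^{i\lambda})|=(f_0(\lambda)+g_0(\lambda))\Psi(\lambda)\alpha_1,$$ $$|A(e^{i\lambda})f_0(\lambda)-C^0(e^{i\lambda})|^2=(f_0(\lambda)+g_0(\lambda))^2(g_0(\lambda)-g_1(\lambda))\alpha_2,$$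 $$\frac1{2\pi}\int_{-\infty}^\infty|f_0(\lambda)-f_1(\lambda)|d\lambda=\varepsilon_1,\qquad\frac1{2\pi}\int_{-\infty}^\infty|g_0(\lambda)-g_1(\lambda)|^2d\lambda=\varepsilon_2,$$ and that $(f_0,g_0)$ determine a solution to the optimization problem $$\max_{(f,g)\in D_{\varepsilon_1}^1\times D_{\varepsilon_2}^2}\big(\langle\mathbf{R}\mathbf{a},\mathbf{B}^{-1}\mathbf{R}\mathbf{a}\rangle+\langle\mathbf{Q}\mathbf{a},\mathbf{a}\rangle\big)=\langle\mathbf{R}^0\mathbf{a},(\mathbf{B}^0)^{-1}\mathbf{R}^0\mathbf{a}\rangle+\langle\mathbf{Q}^0\mathbf{a},\mathbf{a}\rangle.$$ Then $f_0,g_0$ are the least favorable spectral densities in the class $D=D_{\varepsilon_1}^1\times D_{\varepsilon_2}^2$ for the optimal linear filtering of the functional $A\xi=\int_{R^s}a(t)\xi(-t)dt$, and the minimax-robust spectral characteristic of the optimal estimate of $A\xi$ is $$h^0(e^{i\lambda})=A(e^{i\lambda})\frac{f_0(\lambda)}{f_0(\lambda)+g_0(\lambda)}-\frac{C^0(e^{i\lambda})}{f_0(\lambda)+g_0(\lambda)}.$$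
   Context: Sets. Let $s\ge1$, $N_0=K_0=0$, $N_1,\dots,N_s,K_1,\dots,K_s>0$, $M_l=\sum_{k=0}^l(N_k+K_k)$, with the intervals $[M_l,M_l+N_l]$, $l=1,\dots,s$, pairwise disjoint. Put $S=\bigcup_{l=1}^s[-M_l-N_l,-M_l]$, $S^+=\bigcup_{l=1}^s[M_l,M_l+N_l]$, $R^s=[0,\infty)\setminus S^+$, $\mathbb{R}^-=(-\infty,0)$, $T=S\cup[0,\infty)$. In $L_2(T)$ the inner product is $\langle x,y\rangle=\int_T x(t)\overline{y(t)}\,dt$. Functional. $a:R^s\to\mathbb{C}$ satisfies $\int_{R^s}|a(t)|dt<\infty$, $\int_{R^s}t|a(t)|^2dt<\infty$; $\mathbf{a}$ is the function on $T$ equal to $a$ on $R^s$ and $0$ on $S\cup S^+$, taken to be an element of $L_2(T)$. $A(e^{i\lambda})=\int_{R^s}a(t)e^{-it\lambda}dt$ (notations such as $A(e^{i\lambda})$, $h(e^{i\lambda})$, $C^0(e^{i\lambda})$ simply denote functions of $\lambda\in\mathbb{R}$). $\xi,\eta$ are uncorrelated zero-mean stationary processes on $\mathbb{R}$ with spectral densities $f,g$ (nonnegative integrable functions on $\mathbb{R}$; covariance $\frac1{2\pi}\int e^{it\lambda}f(\lambda)d\lambda$, resp. with $g$); $A\xi$ is estimated from observations of $\xi(t)+\eta(t)$, $t\in\mathbb{R}^-\setminus S$. Minimality condition for $(f,g)$: there is a nontrivial function of exponential type $\gamma(\lambda)=\int_0^\infty\alpha(t)e^{it\lambda}dt$ with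 $\int_{-\infty}^\infty\frac{|\gamma(\lambda)|^2}{f(\lambda)+g(\lambda)}d\lambda<\infty$. Estimates. $L_2^s(f+g)$ is the closed linear subspace of $L_2((f+g)d\lambda)$ generated by $\{e^{it\lambda}:t\in\mathbb{R}^-\setminus S\}$. The estimate with spectral characteristic $h\in L_2^s(f+g)$ has mean-square error $\Delta(h;f,g)=\frac1{2\pi}\int|A-h|^2f\,d\lambda+\frac1{2\pi}\int|h|^2g\,d\lambda$. $h(f,g)$ denotes the minimizer of $\Delta(\cdot;f,g)$ over $L_2^s(f+g)$ (the spectral characteristic of the optimal estimate) and $\Delta(f,g)=\Delta(h(f,g);f,g)$. Operators in $L_2(T)$ attached to $(f,g)$, for $t\in T$: $(\mathbf{B}x)(t)=\frac1{2\pi}\int_T x(u)\int_{-\infty}^\infty e^{i\lambda(u-t)}\frac{1}{f+g}\,d\lambda\,du$, $(\mathbf{R}x)(t)=\frac1{2\pi}\int_T x(u)\int_{-\infty}^\infty e^{-i\lambda(u+t)}\frac{f}{f+g}\,d\lambda\,du$, $(\mathbf{Q}x)(t)=\frac1{2\pi}\int_T x(u)\int_{-\infty}^\infty e^{-i\lambda(u-t)}\frac{fg}{f+g}\,d\lambda\,du$. The kernels are understood in the sense of Fourier transforms. With $\hat x(\lambda)=\int_T x(u)e^{iu\lambda}du$: $\mathbf{R}x$ is the restriction to $T$ of $\frac1{2\pi}\int e^{-it\lambda}\hat x(-\lambda)\frac{f}{f+g}d\lambda$ ($L_2$-Fourier transform). $\mathbf{B}$ may be unbounded: let $\mathcal D=\{x\in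 L_2(T):\int|\hat x|^2/(f+g)\,d\lambda<\infty\}$; $\mathbf{B}x=y$ means $x\in\mathcal D$, $y\in L_2(T)$ and $\frac1{2\pi}\int\hat x\,\overline{\hat k}/(f+g)\,d\lambda=\langle y,k\rangle$ for all $k\in\mathcal D$. "Invertible" means that $\mathcal D$ is dense in $L_2(T)$ and $\mathbf{B}$ is a bijection from its domain onto $L_2(T)$. The expression $\langle\mathbf{R}\mathbf{a},\mathbf{B}^{-1}\mathbf{R}\mathbf{a}\rangle+\langle\mathbf{Q}\mathbf{a},\mathbf{a}\rangle$ is the value of the optimal error $\Delta(f,g)$; for pairs $(f,g)$ for which $\mathbf{B}$ is not invertible it is understood to mean $\Delta(f,g)$. $\mathbf{B}^0,\mathbf{R}^0,\mathbf{Q}^0$ are the operators attached to $(f_0,g_0)$, and $C^0(e^{i\lambda})=\int_T((\mathbf{B}^0)^{-1}\mathbf{R}^0\mathbf{a})(t)e^{it\lambda}dt$. Definitions. For a class $D=D_f\times D_g$ of pairs of spectral densities: $(f_0,g_0)\in D$ is least favorable in $D$ for the optimal linear filtering of $A\xi$ if $\Delta(f_0,g_0)=\max_{(f,g)\in D}\Delta(f,g)$. A spectral characteristic $h^0$ is minimax-robust if $h^0\in H_D=\bigcap_{(f,g)\in D}L_2^s(f+g)$ and $\min_{h\in H_D}\max_{(f,g)\in D}\Delta(h;f,g)=\max_{(f,g)\in D}\Delta(h^0;f,g)$ (max read as supremum where necessary). *)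

theory Defs
  imports "HOL-Analysis.Analysis"
begin

section \<open>Observation sets\<close>

definition Msum :: "(nat \<Rightarrow> real) \<Rightarrow> (nat \<Rightarrow> real) \<Rightarrow> nat \<Rightarrow> real" where
  "Msum N K l = (\<Sum>k=0..l. N k + K k)"

definition S_set :: "nat \<Rightarrow> (nat \<Rightarrow> real) \<Rightarrow> (nat \<Rightarrow> real) \<Rightarrow> real set" where
  "S_set s N K = (\<Union>l\<in>{1..s}. {- Msum N K l - N l .. - Msum N K l})"

definition S_plus :: "nat \<Rightarrow> (nat \<Rightarrow> real) \<Rightarrow> (nat \<Rightarrow> real) \<Rightarrow> real set" where
  "S_plus s N K = (\<Union>l\<in>{1..s}. {Msum N K l .. Msum N K l + N l})"

definition R_set :: "nat \<Rightarrow> (nat \<Rightarrow> real) \<Rightarrow> (nat \<Rightarrow> real) \<Rightarrow> real set" where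
  "R_set s N K = {0..} - S_plus s N K"

definition T_set :: "nat \<Rightarrow> (nat \<Rightarrow> real) \<Rightarrow> (nat \<Rightarrow> real) \<Rightarrow> real set" where
  "T_set s N K = S_set s N K \<union> {0..}"

section \<open>Square-integrable functions and the L2 Fourier transform\<close>

text \<open>Elements of L2 are represented by functions; their identity is almost-everywhere
  equality on the set \<open>X\<close>, and values off \<open>X\<close> are irrelevant.\<close>

definition L2_space :: "real set \<Rightarrow> (real \<Rightarrow> complex) set" where
  "L2_space X = {x. set_borel_measurable lborel X x \<and>
                    set_integrable lborel X (\<lambda>t. (cmod (x t))\<^sup>2)}"

definition L2_inner :: "real set \<Rightarrow> (real \<Rightarrow> complex) \<Rightarrow> (real \<Rightarrow> complex) \<Rightarrow> complex" where
  "L2_inner X x y = (LINT t:X|lborel. x t * cnj (y t))"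

text \<open>\<open>F\<close> is the L2 limit, as \<open>r\<close> tends to infinity, of the integrals of
  \<open>x u * exp (\<i> u \<omega>)\<close> over the part of \<open>X\<close> in \<open>[- r, r]\<close>. It is determined only almost
  everywhere, so \<open>L2_fourier\<close> picks a representative.\<close>

definition has_L2_fourier ::
    "real set \<Rightarrow> (real \<Rightarrow> complex) \<Rightarrow> (real \<Rightarrow> complex) \<Rightarrow> bool" where
  "has_L2_fourier X x F \<longleftrightarrow> F \<in> L2_space UNIV \<and>
     ((\<lambda>r::real. \<integral>\<^sup>+\<omega>. ennreal ((cmod ((LINT u:X \<inter> {-r..r}|lborel. x u * cis (u * \<omega>)) - F \<omega>))\<^sup>2)
        \<partial>lborel) \<longlongrightarrow> 0) at_top"

definition L2_fourier :: "real set \<Rightarrow> (real \<Rightarrow> complex) \<Rightarrow> real \<Rightarrow> complex" where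
  "L2_fourier X x = (SOME F. has_L2_fourier X x F)"

section \<open>Spectral densities and the minimality condition\<close>

definition spectral_density :: "(real \<Rightarrow> real) \<Rightarrow> bool" where
  "spectral_density f \<longleftrightarrow> (\<forall>\<omega>. 0 \<le> f \<omega>) \<and> integrable lborel f"

text \<open>\<open>G\<close> is the entire extension of the function \<open>\<gamma>\<close>. The quotient is taken in \<open>ennreal\<close>,
  where a positive number divided by 0 is infinite, so that zeros of \<open>f + g\<close> count; the
  division of \<open>real\<close> would ignore them.\<close>

definition minimality :: "(real \<Rightarrow> real) \<Rightarrow> (real \<Rightarrow> real) \<Rightarrow> bool" where
  "minimality f g \<longleftrightarrow> (\<exists>(\<alpha> :: real \<Rightarrow> complex) (\<gamma> :: real \<Rightarrow> complex) (G :: complex \<Rightarrow> complex).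
     set_integrable lborel {0..} \<alpha> \<and>
     (\<forall>\<omega>. \<gamma> \<omega> = (LINT t:{0..}|lborel. \<alpha> t * cis (t * \<omega>))) \<and>
     G holomorphic_on UNIV \<and> (\<exists>C \<sigma>. \<forall>z. cmod (G z) \<le> C * exp (\<sigma> * cmod z)) \<and>
     (\<forall>\<omega>. G (complex_of_real \<omega>) = \<gamma> \<omega>) \<and>
     (\<exists>\<omega>. \<gamma> \<omega> \<noteq> 0) \<and>
     (\<integral>\<^sup>+\<omega>. ennreal ((cmod (\<gamma> \<omega>))\<^sup>2) / ennreal (f \<omega> + g \<omega>) \<partial>lborel) < \<infinity>)"

section \<open>The operators \<open>\<^bold>B\<close>, \<open>\<^bold>R\<close>, \<open>\<^bold>Q\<close> in L2(T)\<close>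

definition B_domain ::
    "real set \<Rightarrow> (real \<Rightarrow> real) \<Rightarrow> (real \<Rightarrow> real) \<Rightarrow> (real \<Rightarrow> complex) set" where
  "B_domain T f g = {x \<in> L2_space T.
     (\<integral>\<^sup>+\<omega>. ennreal ((cmod (L2_fourier T x \<omega>))\<^sup>2) / ennreal (f \<omega> + g \<omega>) \<partial>lborel) < \<infinity>}"

text \<open>The graph of \<open>\<^bold>B\<close>. For \<open>x\<close> and \<open>k\<close> in \<open>B_domain\<close> both transforms vanish almost everywhere
  on the zero set of \<open>f + g\<close>, so the real quotient below is harmless.\<close>

definition B_op :: "real set \<Rightarrow> (real \<Rightarrow> real) \<Rightarrow> (real \<Rightarrow> real) \<Rightarrow>
    (real \<Rightarrow> complex) \<Rightarrow> (real \<Rightarrow> complex) \<Rightarrow> bool" where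
  "B_op T f g x y \<longleftrightarrow> x \<in> B_domain T f g \<and> y \<in> L2_space T \<and>
     (\<forall>k\<in>B_domain T f g.
        1 / (2 * pi) * (LINT \<omega>|lborel. L2_fourier T x \<omega> * cnj (L2_fourier T k \<omega>)
                                      / complex_of_real (f \<omega> + g \<omega>))
        = L2_inner T y k)"

definition B_invertible :: "real set \<Rightarrow> (real \<Rightarrow> real) \<Rightarrow> (real \<Rightarrow> real) \<Rightarrow> bool" where
  "B_invertible T f g \<longleftrightarrow>
     (\<forall>x\<in>L2_space T. \<forall>e>0. \<exists>k\<in>B_domain T f g. (LINT t:T|lborel. (cmod (x t - k t))\<^sup>2) < e) \<and>
     (\<forall>y\<in>L2_space T. \<exists>x. B_op T f g x y \<and>
        (\<forall>x'. B_op T f g x' y \<longrightarrow> (AE t in lborel. t \<in> T \<longrightarrow> x' t = x t)))"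

definition B_inv ::
    "real set \<Rightarrow> (real \<Rightarrow> real) \<Rightarrow> (real \<Rightarrow> real) \<Rightarrow> (real \<Rightarrow> complex) \<Rightarrow> real \<Rightarrow> complex" where
  "B_inv T f g y = (SOME x. B_op T f g x y)"

text \<open>The inner integral of \<open>x u * exp (- \<i> u \<omega>)\<close> over \<open>T\<close> is the transform of \<open>x\<close> at \<open>- \<omega>\<close>;
  the outer transform carries \<open>exp (- \<i> t \<omega>)\<close>, whence its argument \<open>- t\<close>.\<close>

definition R_op ::
    "real set \<Rightarrow> (real \<Rightarrow> real) \<Rightarrow> (real \<Rightarrow> real) \<Rightarrow> (real \<Rightarrow> complex) \<Rightarrow> real \<Rightarrow> complex" where
  "R_op T f g x t = 1 / (2 * pi) *
     L2_fourier UNIV (\<lambda>\<omega>. L2_fourier T x (-\<omega>) * complex_of_real (f \<omega> / (f \<omega> + g \<omega>))) (-t)"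

text \<open>For \<open>x\<close> in L1 and L2 (as for the coefficient function below) the integrand is integrable,
  since \<open>f g / (f + g) \<le> f\<close>.\<close>

definition Q_op ::
    "real set \<Rightarrow> (real \<Rightarrow> real) \<Rightarrow> (real \<Rightarrow> real) \<Rightarrow> (real \<Rightarrow> complex) \<Rightarrow> real \<Rightarrow> complex" where
  "Q_op T f g x t = 1 / (2 * pi) *
     (LINT \<omega>|lborel. cis (t * \<omega>) * L2_fourier T x (-\<omega>)
                     * complex_of_real (f \<omega> * g \<omega> / (f \<omega> + g \<omega>)))"

section \<open>The functional and the mean-square error\<close>

definition A_fun ::
    "nat \<Rightarrow> (nat \<Rightarrow> real) \<Rightarrow> (nat \<Rightarrow> real) \<Rightarrow> (real \<Rightarrow> complex) \<Rightarrow> real \<Rightarrow> complex" where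
  "A_fun s N K a \<omega> = (LINT t:R_set s N K|lborel. a t * cis (- t * \<omega>))"

definition a_ext ::
    "nat \<Rightarrow> (nat \<Rightarrow> real) \<Rightarrow> (nat \<Rightarrow> real) \<Rightarrow> (real \<Rightarrow> complex) \<Rightarrow> real \<Rightarrow> complex" where
  "a_ext s N K a t = (if t \<in> R_set s N K then a t else 0)"

definition C_fun :: "nat \<Rightarrow> (nat \<Rightarrow> real) \<Rightarrow> (nat \<Rightarrow> real) \<Rightarrow> (real \<Rightarrow> complex) \<Rightarrow>
    (real \<Rightarrow> real) \<Rightarrow> (real \<Rightarrow> real) \<Rightarrow> real \<Rightarrow> complex" where
  "C_fun s N K a f g =
     (let T = T_set s N K in L2_fourier T (B_inv T f g (R_op T f g (a_ext s N K a))))"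

definition L2s :: "nat \<Rightarrow> (nat \<Rightarrow> real) \<Rightarrow> (nat \<Rightarrow> real) \<Rightarrow>
    (real \<Rightarrow> real) \<Rightarrow> (real \<Rightarrow> real) \<Rightarrow> (real \<Rightarrow> complex) set" where
  "L2s s N K f g = {h \<in> borel_measurable lborel.
     integrable lborel (\<lambda>\<omega>. (cmod (h \<omega>))\<^sup>2 * (f \<omega> + g \<omega>)) \<and>
     (\<forall>e>0. \<exists>F c. finite F \<and> F \<subseteq> {..<0} - S_set s N K \<and>
        (LINT \<omega>|lborel. (cmod (h \<omega> - (\<Sum>t\<in>F. c t * cis (t * \<omega>))))\<^sup>2 * (f \<omega> + g \<omega>)) < e)}"

definition mse :: "nat \<Rightarrow> (nat \<Rightarrow> real) \<Rightarrow> (nat \<Rightarrow> real) \<Rightarrow> (real \<Rightarrow> complex) \<Rightarrow>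
    (real \<Rightarrow> complex) \<Rightarrow> (real \<Rightarrow> real) \<Rightarrow> (real \<Rightarrow> real) \<Rightarrow> real" where
  "mse s N K a h f g =
     1 / (2 * pi) * (LINT \<omega>|lborel. (cmod (A_fun s N K a \<omega> - h \<omega>))\<^sup>2 * f \<omega>)
     + 1 / (2 * pi) * (LINT \<omega>|lborel. (cmod (h \<omega>))\<^sup>2 * g \<omega>)"

definition opt_char :: "nat \<Rightarrow> (nat \<Rightarrow> real) \<Rightarrow> (nat \<Rightarrow> real) \<Rightarrow> (real \<Rightarrow> complex) \<Rightarrow>
    (real \<Rightarrow> real) \<Rightarrow> (real \<Rightarrow> real) \<Rightarrow> real \<Rightarrow> complex" where
  "opt_char s N K a f g = arg_min (\<lambda>h. mse s N K a h f g) (\<lambda>h. h \<in> L2s s N K f g)"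

definition opt_mse :: "nat \<Rightarrow> (nat \<Rightarrow> real) \<Rightarrow> (nat \<Rightarrow> real) \<Rightarrow> (real \<Rightarrow> complex) \<Rightarrow>
    (real \<Rightarrow> real) \<Rightarrow> (real \<Rightarrow> real) \<Rightarrow> real" where
  "opt_mse s N K a f g = mse s N K a (opt_char s N K a f g) f g"

text \<open>\<open>\<langle>\<^bold>R a, \<^bold>B\<^sup>-\<^sup>1 \<^bold>R a\<rangle> + \<langle>\<^bold>Q a, a\<rangle>\<close>. Both inner products are real because \<open>\<^bold>B\<close> and \<open>\<^bold>Q\<close> are
  given by nonnegative quadratic forms, so taking \<open>Re\<close> only changes the type.\<close>

definition operator_error :: "nat \<Rightarrow> (nat \<Rightarrow> real) \<Rightarrow> (nat \<Rightarrow> real) \<Rightarrow> (real \<Rightarrow> complex) \<Rightarrow>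
    (real \<Rightarrow> real) \<Rightarrow> (real \<Rightarrow> real) \<Rightarrow> real" where
  "operator_error s N K a f g =
     (let T = T_set s N K; b = a_ext s N K a; r = R_op T f g b in
        Re (L2_inner T r (B_inv T f g r) + L2_inner T (Q_op T f g b) b))"

text \<open>The objective of the optimization problem, read as the optimal error where \<open>\<^bold>B\<close> is not
  invertible.\<close>

definition objective :: "nat \<Rightarrow> (nat \<Rightarrow> real) \<Rightarrow> (nat \<Rightarrow> real) \<Rightarrow> (real \<Rightarrow> complex) \<Rightarrow>
    (real \<Rightarrow> real) \<Rightarrow> (real \<Rightarrow> real) \<Rightarrow> real" where
  "objective s N K a f g =
     (if B_invertible (T_set s N K) f g then operator_error s N K a f g else opt_mse s N K a f g)"

section \<open>Classes of densities, least favorable densities, minimax-robust characteristics\<close>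

definition D1_class :: "(real \<Rightarrow> real) \<Rightarrow> real \<Rightarrow> (real \<Rightarrow> real) set" where
  "D1_class f1 \<epsilon> = {f. spectral_density f \<and>
     1 / (2 * pi) * (LINT \<omega>|lborel. \<bar>f \<omega> - f1 \<omega>\<bar>) \<le> \<epsilon>}"

text \<open>Integrability is explicit because the Bochner integral of a non-integrable function is 0.\<close>

definition D2_class :: "(real \<Rightarrow> real) \<Rightarrow> real \<Rightarrow> (real \<Rightarrow> real) set" where
  "D2_class g1 \<epsilon> = {g. spectral_density g \<and> integrable lborel (\<lambda>\<omega>. \<bar>g \<omega> - g1 \<omega>\<bar>\<^sup>2) \<and>
     1 / (2 * pi) * (LINT \<omega>|lborel. \<bar>g \<omega> - g1 \<omega>\<bar>\<^sup>2) \<le> \<epsilon>}"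

definition least_favorable :: "nat \<Rightarrow> (nat \<Rightarrow> real) \<Rightarrow> (nat \<Rightarrow> real) \<Rightarrow> (real \<Rightarrow> complex) \<Rightarrow>
    ((real \<Rightarrow> real) \<times> (real \<Rightarrow> real)) set \<Rightarrow> (real \<Rightarrow> real) \<Rightarrow> (real \<Rightarrow> real) \<Rightarrow> bool" where
  "least_favorable s N K a D f0 g0 \<longleftrightarrow> (f0, g0) \<in> D \<and>
     (\<forall>(f, g)\<in>D. opt_mse s N K a f g \<le> opt_mse s N K a f0 g0)"

definition H_class :: "nat \<Rightarrow> (nat \<Rightarrow> real) \<Rightarrow> (nat \<Rightarrow> real) \<Rightarrow>
    ((real \<Rightarrow> real) \<times> (real \<Rightarrow> real)) set \<Rightarrow> (real \<Rightarrow> complex) set" where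
  "H_class s N K D = (\<Inter>(f, g)\<in>D. L2s s N K f g)"

text \<open>The supremum is taken in \<open>ereal\<close>, since it may be infinite for some \<open>h\<close>.\<close>

definition minimax_robust :: "nat \<Rightarrow> (nat \<Rightarrow> real) \<Rightarrow> (nat \<Rightarrow> real) \<Rightarrow> (real \<Rightarrow> complex) \<Rightarrow>
    ((real \<Rightarrow> real) \<times> (real \<Rightarrow> real)) set \<Rightarrow> (real \<Rightarrow> complex) \<Rightarrow> bool" where
  "minimax_robust s N K a D h0 \<longleftrightarrow>
     is_arg_min (\<lambda>h. SUP (f, g)\<in>D. ereal (mse s N K a h f g)) (\<lambda>h. h \<in> H_class s N K D) h0"

end

theory Submission
  imports Defs "HOL-Probability.Characteristic_Functions" "HOL-Complex_Analysis.Conformal_Mappings"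
begin

text \<open>The pair \<open>(f0, g0)\<close> and \<open>h0\<close> form a saddle point of the mean-square error. The error of a fixed
  characteristic is linear in the densities, and the two extremality equations say that
  \<open>|A - h0|\<^sup>2\<close> attains its maximum where \<open>f0 \<noteq> f1\<close> (and vanishes if \<open>f0 < f1\<close> somewhere),
  and that \<open>|h0|\<^sup>2\<close> is proportional to \<open>g0 - g1\<close>; so \<open>(f0, g0)\<close> maximises the error of \<open>h0\<close> over the class. Conversely, \<open>C0\<close> is the transform of a
  function supported in \<open>T\<close>, hence orthogonal to all observations, and \<open>A f0 - h0 (f0 + g0) = C0\<close>
  makes \<open>h0\<close> the unique minimiser at \<open>(f0, g0)\<close>, where \<open>f0 + g0 > 0\<close> almost everywhere.

  It remains to see that \<open>h0\<close> is admissible for every pair in the class. By the equation for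
  \<open>\<^bold>B\<^sup>-\<^sup>1\<close> and the density of its domain, \<open>h0\<close> is orthogonal to the transforms of all of L2(T); being
  in L2 (because \<open>|h0|\<^sup>2\<close> is proportional to \<open>g0 - g1\<close>), it is by the Plancherel theorem the
  transform of a function \<open>H\<close> vanishing on \<open>T\<close>. Damping \<open>H\<close> by Gaussians gives
  integrable functions whose transforms stay below the bound of \<open>h0\<close> and converge to it almost
  everywhere; they are limits of Riemann sums with frequencies off \<open>T\<close>. By dominated convergence
  all this happens in L2 of any finite spectral measure.\<close>

section \<open>Square-integrable functions\<close>

text \<open>The obstacle is that \<open>L2s\<close> is a closure in a norm that changes with the
  pair. An approximation of \<open>h0\<close> in the norm of (f0, g0) says nothing about another
  pair, and since the class contains unbounded densities, closeness in L2 of Lebesgue measure does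
  not carry over either. Almost everywhere convergence under one constant bound does, for all finite
  weights at once; this is what the bound on h_g, which is |h0|^2, is for. A sharp cut-off of
  \<open>H\<close> could destroy that bound, as it convolves the transform with a sinc kernel, which
  changes sign and is not integrable.

  Orthogonality is needed at each single observation time, whereas the inverse transform of C0 is
  known to vanish off \<open>T\<close> only almost everywhere. But C0 is a bounded function times f0
  + g0, hence integrable, so this transform is continuous, and the complement of \<open>T\<close> is
  open.

  \<open>L2_fourier\<close> is a choice of representative, so identities between transforms hold
  almost everywhere. A and \<open>R_op\<close> carry the exponent -it, C0 and the observations +it;
  hence the reflections.\<close>

definition L2fun :: "'a measure \<Rightarrow> ('a \<Rightarrow> complex) set" where
  "L2fun M = {f \<in> borel_measurable M. integrable M (\<lambda>x. (cmod (f x))\<^sup>2)}"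

text \<open>Kept squared, so that no roots occur; the triangle inequality then costs a factor 2,
  which limits do not feel. The measure is arbitrary because Lebesgue measure and the weights f + g
  both occur.\<close>

definition sqn :: "'a measure \<Rightarrow> ('a \<Rightarrow> complex) \<Rightarrow> real" where
  "sqn M f = (LINT x|M. (cmod (f x))\<^sup>2)"

lemma L2fun_measurable [measurable_dest]: "f \<in> L2fun M \<Longrightarrow> f \<in> borel_measurable M"
  by (simp add: L2fun_def)

lemma L2fun_integrable: "f \<in> L2fun M \<Longrightarrow> integrable M (\<lambda>x. (cmod (f x))\<^sup>2)"
  by (simp add: L2fun_def)

lemma sqn_nonneg [simp]: "0 \<le> sqn M f"
  by (simp add: sqn_def)

lemma sqn_minus_commute: "sqn M (\<lambda>x. f x - g x) = sqn M (\<lambda>x. g x - f x)"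
  by (simp add: sqn_def norm_minus_commute)

lemma cmod_add_sq_le: "(cmod (a + b))\<^sup>2 \<le> 2 * (cmod a)\<^sup>2 + 2 * (cmod b)\<^sup>2"
proof -
  have "(cmod (a + b))\<^sup>2 \<le> (cmod a + cmod b)\<^sup>2"
    by (intro power_mono norm_triangle_ineq) auto
  also have "\<dots> \<le> 2 * (cmod a)\<^sup>2 + 2 * (cmod b)\<^sup>2"
    using sum_squares_bound[of "cmod a" "cmod b"] by (simp add: power2_sum)
  finally show ?thesis .
qed

lemma L2fun_bound:
  assumes "f \<in> L2fun M" "g \<in> borel_measurable M" "AE x in M. cmod (g x) \<le> cmod (f x)"
  shows "g \<in> L2fun M"
proof -
  have "integrable M (\<lambda>x. (cmod (g x))\<^sup>2)"
    by (rule Bochner_Integration.integrable_bound[OF L2fun_integrable[OF assms(1)]])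
       (use assms in \<open>auto simp: power_mono\<close>)
  with assms show ?thesis by (simp add: L2fun_def)
qed

lemma L2fun_add:
  assumes "f \<in> L2fun M" "g \<in> L2fun M"
  shows "(\<lambda>x. f x + g x) \<in> L2fun M"
proof -
  have [measurable]: "f \<in> borel_measurable M" "g \<in> borel_measurable M"
    using assms by (auto simp: L2fun_measurable)
  have "integrable M (\<lambda>x. (cmod (f x + g x))\<^sup>2)"
  proof (rule Bochner_Integration.integrable_bound)
    show "integrable M (\<lambda>x. 2 * (cmod (f x))\<^sup>2 + 2 * (cmod (g x))\<^sup>2)"
      using assms by (auto simp: L2fun_integrable)
    show "AE x in M. norm ((cmod (f x + g x))\<^sup>2) \<le> norm (2 * (cmod (f x))\<^sup>2 + 2 * (cmod (g x))\<^sup>2)"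
      using cmod_add_sq_le by (auto simp: abs_of_nonneg)
  qed simp
  then show ?thesis by (simp add: L2fun_def)
qed

lemma L2fun_cmult: "f \<in> L2fun M \<Longrightarrow> (\<lambda>x. c * f x) \<in> L2fun M"
  by (auto simp: L2fun_def norm_mult power_mult_distrib)

lemma L2fun_uminus: "f \<in> L2fun M \<Longrightarrow> (\<lambda>x. - f x) \<in> L2fun M"
  using L2fun_cmult[of f M "-1"] by simp

lemma L2fun_diff: "f \<in> L2fun M \<Longrightarrow> g \<in> L2fun M \<Longrightarrow> (\<lambda>x. f x - g x) \<in> L2fun M"
  using L2fun_add[OF _ L2fun_uminus, of f M g] by simp

lemma borel_measurable_cnj [measurable (raw)]:
  "f \<in> borel_measurable M \<Longrightarrow> (\<lambda>x. cnj (f x)) \<in> borel_measurable M"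
  by (rule borel_measurable_continuous_on[where f = cnj]) (auto intro: continuous_intros)

lemma L2fun_cnj: "f \<in> L2fun M \<Longrightarrow> (\<lambda>x. cnj (f x)) \<in> L2fun M"
  by (auto simp: L2fun_def)

lemma L2fun_zero: "(\<lambda>x. 0) \<in> L2fun M"
  by (simp add: L2fun_def)

lemmas L2fun_intros = L2fun_add L2fun_cmult L2fun_uminus L2fun_diff L2fun_cnj L2fun_zero

lemma L2fun_cong_AE:
  assumes "f \<in> L2fun M" "AE x in M. f x = g x" "g \<in> borel_measurable M"
  shows "g \<in> L2fun M"
  by (rule L2fun_bound[OF assms(1,3)]) (use assms(2) in auto)

lemma sqn_cong_AE:
  assumes "AE x in M. f x = g x" "f \<in> borel_measurable M" "g \<in> borel_measurable M"
  shows "sqn M f = sqn M g"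
  unfolding sqn_def by (rule integral_cong_AE) (use assms in auto)

lemma sqn_add_le:
  assumes "f \<in> L2fun M" "g \<in> L2fun M"
  shows "sqn M (\<lambda>x. f x + g x) \<le> 2 * sqn M f + 2 * sqn M g"
proof -
  have "sqn M (\<lambda>x. f x + g x) \<le> (LINT x|M. 2 * (cmod (f x))\<^sup>2 + 2 * (cmod (g x))\<^sup>2)"
    unfolding sqn_def
    by (intro integral_mono L2fun_integrable L2fun_add assms Bochner_Integration.integrable_add
        integrable_mult_right cmod_add_sq_le)
  then show ?thesis
    using assms by (simp add: sqn_def L2fun_integrable)
qed

lemma sqn_diff_triangle:
  assumes "f \<in> L2fun M" "g \<in> L2fun M" "h \<in> L2fun M"
  shows "sqn M (\<lambda>x. f x - h x) \<le> 2 * sqn M (\<lambda>x. f x - g x) + 2 * sqn M (\<lambda>x. g x - h x)"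
  using sqn_add_le[of "\<lambda>x. f x - g x" M "\<lambda>x. g x - h x"] assms by (simp add: L2fun_diff)

lemma sqn_cmult: "sqn M (\<lambda>x. c * f x) = (cmod c)\<^sup>2 * sqn M f"
  by (simp add: sqn_def norm_mult power_mult_distrib)

lemma sqn_eq_0D:
  assumes "f \<in> L2fun M" "sqn M f = 0"
  shows "AE x in M. f x = 0"
  using integral_nonneg_eq_0_iff_AE[OF L2fun_integrable[OF assms(1)]] assms(2)
  by (simp add: sqn_def)

lemma L2fun_mult_integrable:
  assumes "f \<in> L2fun M" "g \<in> L2fun M"
  shows "integrable M (\<lambda>x. f x * g x)"
proof (rule Bochner_Integration.integrable_bound)
  show "integrable M (\<lambda>x. (cmod (f x))\<^sup>2 + (cmod (g x))\<^sup>2)"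
    using assms by (auto simp: L2fun_integrable)
  show "(\<lambda>x. f x * g x) \<in> borel_measurable M"
    using assms by measurable
  have "cmod (f x) * cmod (g x) \<le> (cmod (f x))\<^sup>2 + (cmod (g x))\<^sup>2" for x
    using sum_squares_bound[of "cmod (f x)" "cmod (g x)"]
      mult_nonneg_nonneg[of "cmod (f x)" "cmod (g x)", OF norm_ge_zero norm_ge_zero] by linarith
  then show "AE x in M. norm (f x * g x) \<le> norm ((cmod (f x))\<^sup>2 + (cmod (g x))\<^sup>2)"
    by (auto simp: norm_mult abs_of_nonneg)
qed

text \<open>The squared norm of t |f| - |g| is a nonnegative quadratic polynomial in t; its value at
  the minimiser gives the inequality.\<close>

lemma Cauchy_Schwarz_L2:
  assumes "f \<in> L2fun M" "g \<in> L2fun M"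
  shows "(LINT x|M. cmod (f x) * cmod (g x))\<^sup>2 \<le> sqn M f * sqn M g"
proof -
  let ?I = "LINT x|M. cmod (f x) * cmod (g x)"
  have i: "integrable M (\<lambda>x. cmod (f x) * cmod (g x))"
    using integrable_norm[OF L2fun_mult_integrable[OF assms]] by (simp add: norm_mult)
  have q: "0 \<le> sqn M f * t\<^sup>2 - 2 * ?I * t + sqn M g" for t
  proof -
    have "0 \<le> (LINT x|M. (t * cmod (f x) - cmod (g x))\<^sup>2)" by simp
    also have "\<dots> = (LINT x|M. t\<^sup>2 * (cmod (f x))\<^sup>2 - 2 * t * (cmod (f x) * cmod (g x)) + (cmod (g x))\<^sup>2)"
      by (intro Bochner_Integration.integral_cong) (auto simp: power2_eq_square algebra_simps)
    also have "\<dots> = t\<^sup>2 * sqn M f - 2 * t * ?I + sqn M g"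
      using i assms by (simp add: sqn_def L2fun_integrable)
    finally show ?thesis by (simp add: mult_ac)
  qed
  show ?thesis
  proof (cases "sqn M f = 0")
    case True
    then have "0 \<le> sqn M g - 2 * ?I * t" for t
      using q[of t] by simp
    \<comment> \<open>For nonzero \<open>?I\<close> this t would give the value -1.\<close>
    from this[of "(sqn M g + 1) / (2 * ?I)"] have "?I = 0"
      by (cases "?I = 0") (auto)
    then show ?thesis by simp
  next
    case False
    then have p: "sqn M f > 0" using sqn_nonneg[of M f] by linarith
    have "0 \<le> sqn M f * (sqn M f * (?I / sqn M f)\<^sup>2 - 2 * ?I * (?I / sqn M f) + sqn M g)"
      using q[of "?I / sqn M f"] p by (intro mult_nonneg_nonneg) auto
    also have "\<dots> = sqn M f * sqn M g - ?I\<^sup>2"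
      using p by (simp add: field_simps power2_eq_square)
    finally show ?thesis by simp
  qed
qed

lemma Cauchy_Schwarz_integral:
  assumes "f \<in> L2fun M" "g \<in> L2fun M"
  shows "cmod (LINT x|M. f x * g x) \<le> sqrt (sqn M f * sqn M g)"
proof (rule real_le_rsqrt)
  have "cmod (LINT x|M. f x * g x) \<le> (LINT x|M. cmod (f x) * cmod (g x))"
    using integral_norm_bound[of M "\<lambda>x. f x * g x"] by (simp add: norm_mult)
  then have "(cmod (LINT x|M. f x * g x))\<^sup>2 \<le> (LINT x|M. cmod (f x) * cmod (g x))\<^sup>2"
    by (intro power_mono) auto
  also note Cauchy_Schwarz_L2[OF assms]
  finally show "(cmod (LINT x|M. f x * g x))\<^sup>2 \<le> sqn M f * sqn M g" .
qed

section \<open>Limits, completeness and projections in L2\<close>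

lemma L2_tendsto_integral_mult:
  assumes "\<And>n. f n \<in> L2fun M" "g \<in> L2fun M" "h \<in> L2fun M"
    and "((\<lambda>n. sqn M (\<lambda>x. f n x - g x)) \<longlongrightarrow> 0) F"
  shows "((\<lambda>n. LINT x|M. f n x * h x) \<longlongrightarrow> (LINT x|M. g x * h x)) F"
proof (rule LIM_zero_cancel, rule tendsto_norm_zero_cancel)
  have "((\<lambda>n. sqrt (sqn M (\<lambda>x. f n x - g x) * sqn M h)) \<longlongrightarrow> sqrt (0 * sqn M h)) F"
    by (intro tendsto_intros assms)
  then have lim: "((\<lambda>n. sqrt (sqn M (\<lambda>x. f n x - g x) * sqn M h)) \<longlongrightarrow> 0) F" by simp
  have b: "cmod ((LINT x|M. f n x * h x) - (LINT x|M. g x * h x)) \<le> sqrt (sqn M (\<lambda>x. f n x - g x) * sqn M h)" for n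
  proof -
    have "(LINT x|M. f n x * h x) - (LINT x|M. g x * h x) = (LINT x|M. (f n x - g x) * h x)"
      using assms by (simp add: L2fun_mult_integrable left_diff_distrib)
    then show ?thesis
      using Cauchy_Schwarz_integral[of "\<lambda>x. f n x - g x" M h] assms by (simp add: L2fun_diff)
  qed
  show "((\<lambda>n. cmod ((LINT x|M. f n x * h x) - (LINT x|M. g x * h x))) \<longlongrightarrow> 0) F"
    by (rule tendsto_sandwich[OF _ _ tendsto_const lim]) (use b in auto)
qed

lemma L2_limit_unique:
  assumes "\<And>n. f n \<in> L2fun M" "g \<in> L2fun M" "h \<in> L2fun M" "F \<noteq> bot"
    and "((\<lambda>n. sqn M (\<lambda>x. f n x - g x)) \<longlongrightarrow> 0) F" "((\<lambda>n. sqn M (\<lambda>x. f n x - h x)) \<longlongrightarrow> 0) F"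
  shows "AE x in M. g x = h x"
proof -
  have "((\<lambda>n. 2 * sqn M (\<lambda>x. f n x - g x) + 2 * sqn M (\<lambda>x. f n x - h x)) \<longlongrightarrow> 2 * 0 + 2 * 0) F"
    by (intro tendsto_intros assms)
  moreover have "sqn M (\<lambda>x. g x - h x) \<le> 2 * sqn M (\<lambda>x. f n x - g x) + 2 * sqn M (\<lambda>x. f n x - h x)" for n
    using sqn_diff_triangle[of g M "f n" h] assms by (simp add: sqn_minus_commute)
  ultimately have "sqn M (\<lambda>x. g x - h x) \<le> 0"
    by (intro tendsto_lowerbound[of _ _ F]) (use assms(4) in auto)
  then have "AE x in M. g x - h x = 0"
    by (intro sqn_eq_0D L2fun_diff assms) (use sqn_nonneg[of M] in \<open>auto intro: antisym\<close>)
  then show ?thesis by simp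
qed

lemma nn_integral_cmod_sq:
  "f \<in> L2fun M \<Longrightarrow> (\<integral>\<^sup>+x. ennreal ((cmod (f x))\<^sup>2) \<partial>M) = ennreal (sqn M f)"
  unfolding sqn_def by (rule nn_integral_eq_integral) (auto simp: L2fun_integrable)

lemma L2fun_from_nn:
  assumes "f \<in> borel_measurable M" "(\<integral>\<^sup>+x. ennreal ((cmod (f x))\<^sup>2) \<partial>M) < \<infinity>"
  shows "f \<in> L2fun M"
  using assms by (auto simp: L2fun_def intro!: integrableI_nonneg)

text \<open>Made for the completeness proof, where a pointwise limit along a subsequence has to
  inherit norm estimates.\<close>

lemma L2_Fatou:
  assumes f: "\<And>n. f n \<in> L2fun M" and g: "g \<in> borel_measurable M"
    and lim: "AE x in M. (\<lambda>n. f n x) \<longlonglongrightarrow> g x"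
    and bd: "\<forall>\<^sub>F n in sequentially. sqn M (f n) \<le> e"
  shows "g \<in> L2fun M" "sqn M g \<le> e"
proof -
  have [measurable]: "f n \<in> borel_measurable M" "g \<in> borel_measurable M" for n
    using f g by (auto simp: L2fun_measurable)
  have "(\<integral>\<^sup>+x. ennreal ((cmod (g x))\<^sup>2) \<partial>M) = (\<integral>\<^sup>+x. liminf (\<lambda>n. ennreal ((cmod (f n x))\<^sup>2)) \<partial>M)"
  proof (rule nn_integral_cong_AE, use lim in eventually_elim)
    case (elim x)
    then have "(\<lambda>n. ennreal ((cmod (f n x))\<^sup>2)) \<longlonglongrightarrow> ennreal ((cmod (g x))\<^sup>2)"
      by (intro tendsto_intros)
    then show ?case
      by (rule lim_imp_Liminf[symmetric, rotated]) simp
  qed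
  also have "\<dots> \<le> liminf (\<lambda>n. \<integral>\<^sup>+x. ennreal ((cmod (f n x))\<^sup>2) \<partial>M)"
    by (rule nn_integral_liminf) simp
  also have "\<dots> = liminf (\<lambda>n. ennreal (sqn M (f n)))"
    using f by (simp add: nn_integral_cmod_sq)
  also have "\<dots> \<le> limsup (\<lambda>n. ennreal (sqn M (f n)))"
    by (rule Liminf_le_Limsup) simp
  also have "\<dots> \<le> ennreal e"
    by (rule Limsup_bounded) (use bd in \<open>auto elim!: eventually_mono intro: ennreal_leI\<close>)
  finally have le: "(\<integral>\<^sup>+x. ennreal ((cmod (g x))\<^sup>2) \<partial>M) \<le> ennreal e" .
  show "g \<in> L2fun M"
    by (rule L2fun_from_nn[OF g]) (use le in \<open>auto intro: le_less_trans\<close>)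
  \<comment> \<open>\<open>ennreal\<close> sends negative numbers to 0, so e >= 0 has to be
    recovered from one of the bounded norms before the inequality can be read in the reals.\<close>
  then show "sqn M g \<le> e"
    using le bd eventually_sequentially[of "\<lambda>n. sqn M (f n) \<le> e"] 
    by (metis ennreal_le_iff nle_le nn_integral_cmod_sq order_trans sqn_nonneg)
qed

text \<open>Riesz-Fischer. Along r the squared norms of the increments are below 8^-n, so even after
  weighting by 4^n their sum has a finite integral. A finite weighted sum c at x bounds the n-th
  increment there by sqrt c / 2^n, whence pointwise convergence. The subsequence is part of the
  conclusion because it identifies limits that are known pointwise.\<close>

lemma L2_complete:
  assumes h: "\<And>n. h n \<in> L2fun M"
    and C: "\<And>e. e > 0 \<Longrightarrow> \<exists>N. \<forall>m\<ge>N. \<forall>n\<ge>N. sqn M (\<lambda>x. h m x - h n x) < e"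
  obtains F r where "F \<in> L2fun M" "(\<lambda>n. sqn M (\<lambda>x. h n x - F x)) \<longlonglongrightarrow> 0"
    "strict_mono (r :: nat \<Rightarrow> nat)" "AE x in M. (\<lambda>n. h (r n) x) \<longlonglongrightarrow> F x"
proof -
  have [measurable]: "h n \<in> borel_measurable M" for n
    using h by (simp add: L2fun_measurable)
  have "\<exists>r. \<forall>n. (\<forall>i\<ge>r n. \<forall>j\<ge>r n. sqn M (\<lambda>x. h i x - h j x) < (1/8) ^ n) \<and> r n < r (Suc n)"
  proof (intro dependent_nat_choice, goal_cases)
    case 1
    then show ?case using C[of "(1/8)^0"] by auto
  next
    case (2 x n)
    obtain N where N: "\<forall>m\<ge>N. \<forall>n'\<ge>N. sqn M (\<lambda>x. h m x - h n' x) < (1/8) ^ Suc n"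
      using C[of "(1/8) ^ Suc n"] by auto
    show ?case
      by (rule exI[of _ "max N (Suc x)"]) (use N in auto)
  qed
  then obtain r where r: "\<And>n i j. i \<ge> r n \<Longrightarrow> j \<ge> r n \<Longrightarrow> sqn M (\<lambda>x. h i x - h j x) < (1/8) ^ n"
    and rS: "\<And>n. r n < r (Suc n)" by blast
  have sm: "strict_mono r" using rS by (simp add: strict_mono_Suc_iff)
  define d where "d n x = h (r (Suc n)) x - h (r n) x" for n x
  have [measurable]: "d n \<in> borel_measurable M" for n
    unfolding d_def by simp
  have dL: "d n \<in> L2fun M" for n
    using L2fun_diff[OF h h] by (simp add: d_def[abs_def])
  have "(\<integral>\<^sup>+x. (\<Sum>n. ennreal (4 ^ n * (cmod (d n x))\<^sup>2)) \<partial>M) = (\<Sum>n. \<integral>\<^sup>+x. ennreal (4 ^ n * (cmod (d n x))\<^sup>2) \<partial>M)"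
    by (rule nn_integral_suminf) simp
  also have "\<dots> = (\<Sum>n. ennreal (4 ^ n * sqn M (d n)))"
    using dL by (simp add: ennreal_mult' nn_integral_cmult nn_integral_cmod_sq)
  also have "\<dots> \<le> (\<Sum>n. ennreal ((1/2) ^ n))"
  proof (intro suminf_le ennreal_leI allI summableI)
    fix n
    have "sqn M (d n) \<le> (1/8) ^ n"
      unfolding d_def using r[of n "r (Suc n)" "r n"] rS[of n] by simp
    then have "4 ^ n * sqn M (d n) \<le> 4 ^ n * (1/8) ^ n" by simp
    also have "\<dots> = (1/2 :: real) ^ n" by (simp flip: power_mult_distrib)
    finally show "4 ^ n * sqn M (d n) \<le> (1/2) ^ n" .
  qed
  also have "\<dots> = ennreal (\<Sum>n. (1/2) ^ n)"
    by (rule suminf_ennreal2) (auto simp: summable_geometric)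
  also have "\<dots> < \<infinity>" by simp
  finally have "AE x in M. (\<Sum>n. ennreal (4 ^ n * (cmod (d n x))\<^sup>2)) \<noteq> \<infinity>"
    by (intro nn_integral_PInf_AE) auto
  then have conv: "AE x in M. convergent (\<lambda>n. h (r n) x)"
  proof eventually_elim
    case (elim x)
    define c where "c = enn2real (\<Sum>n. ennreal (4 ^ n * (cmod (d n x))\<^sup>2))"
    have cn: "0 \<le> c" by (simp add: c_def)
    have c: "ennreal c = (\<Sum>n. ennreal (4 ^ n * (cmod (d n x))\<^sup>2))"
      using elim by (simp add: c_def less_top)
    have "cmod (d n x) \<le> sqrt c * (1/2) ^ n" for n
    proof -
      have "ennreal (4 ^ n * (cmod (d n x))\<^sup>2) \<le> ennreal c"
        unfolding c
        by (rule order_trans[OF _ sum_le_suminf[of _ "{n}"]]) (auto simp: summableI)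
      then have "4 ^ n * (cmod (d n x))\<^sup>2 \<le> c"
        using cn by simp
      moreover have "(4::real) ^ n = (2 ^ n)\<^sup>2" by (simp add: power2_eq_square flip: power_mult_distrib)
      ultimately have "(2 ^ n * cmod (d n x))\<^sup>2 \<le> c"
        by (simp add: power_mult_distrib)
      then have "2 ^ n * cmod (d n x) \<le> sqrt c"
        by (rule real_le_rsqrt)
      then show ?thesis by (simp add: field_simps power_divide)
    qed
    then have "summable (\<lambda>n. d n x)"
      by (rule summable_comparison_test'[where g = "\<lambda>n. sqrt c * (1/2) ^ n" and N = 0, rotated])
         (rule summable_mult, rule summable_geometric, simp)
    then have "convergent (\<lambda>n. \<Sum>i<n. d i x)"
      by (simp add: summable_iff_convergent)
    then have "convergent (\<lambda>n. (h (r n) x - h (r 0) x) + h (r 0) x)"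
      by (intro convergent_add convergent_const) (simp add: d_def sum_lessThan_telescope[of "\<lambda>n. h (r n) x"])
    then show ?case by simp
  qed
  define F where "F x = lim (\<lambda>n. h (r n) x)" for x
  have [measurable]: "F \<in> borel_measurable M"
    unfolding F_def by measurable
  have lim: "AE x in M. (\<lambda>n. h (r n) x) \<longlonglongrightarrow> F x"
    using conv by eventually_elim (simp add: F_def convergent_LIMSEQ_iff)
  \<comment> \<open>Fatou is applied as k grows in h m - h (r k). The index m is any one beyond r n,
    not only a member of the subsequence, so the whole sequence converges in norm.\<close>
  have key: "(\<lambda>x. h m x - F x) \<in> L2fun M \<and> sqn M (\<lambda>x. h m x - F x) \<le> (1/8) ^ n" if "m \<ge> r n" for m n
  proof -
    have 1: "(\<lambda>x. h m x - h (r k) x) \<in> L2fun M" for k by (intro L2fun_diff h)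
    have 2: "(\<lambda>x. h m x - F x) \<in> borel_measurable M" by simp
    have 3: "AE x in M. (\<lambda>k. h m x - h (r k) x) \<longlonglongrightarrow> h m x - F x"
      using lim by eventually_elim (intro tendsto_intros)
    have 4: "\<forall>\<^sub>F k in sequentially. sqn M (\<lambda>x. h m x - h (r k) x) \<le> (1/8) ^ n"
      using eventually_ge_at_top[of n]
    proof eventually_elim
      case (elim k)
      then have "r k \<ge> r n" using sm by (simp add: strict_mono_less_eq)
      then show ?case using r[OF that, of "r k"] by simp
    qed
    show ?thesis using L2_Fatou[OF 1 2 3 4] by blast
  qed
  have FL: "F \<in> L2fun M"
    using L2fun_diff[OF h[of "r 0"] conjunct1[OF key[of 0 "r 0"]]] by simp
  have "(\<lambda>n. sqn M (\<lambda>x. h n x - F x)) \<longlonglongrightarrow> 0"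
  proof (rule LIMSEQ_I)
    fix e :: real assume "e > 0"
    then obtain n where n: "(1/8 :: real) ^ n < e"
      using real_arch_pow_inv[of e "1/8"] by auto
    show "\<exists>N. \<forall>m\<ge>N. norm (sqn M (\<lambda>x. h m x - F x) - 0) < e"
      by (rule exI[of _ "r n"]) (use key[of n] n in \<open>auto intro: le_less_trans\<close>)
  qed
  with FL sm lim that show ?thesis by blast
qed

lemma cmod_diff_sq: "(cmod (a - b))\<^sup>2 = (cmod a)\<^sup>2 - 2 * Re (a * cnj b) + (cmod b)\<^sup>2"
  unfolding cmod_power2 by (simp add: power2_eq_square algebra_simps)

lemma sqn_diff_expand:
  assumes f: "f \<in> L2fun M" and g: "g \<in> L2fun M"
  shows "sqn M (\<lambda>x. f x - g x) = sqn M f - 2 * Re (LINT x|M. f x * cnj (g x)) + sqn M g"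
proof -
  have lin: "(LINT x|M. p x - 2 * Re (q x) + r x) = (LINT x|M. p x) - 2 * Re (LINT x|M. q x) + (LINT x|M. r x)"
    if "integrable M p" "integrable M q" "integrable M r" for p q r
    using that by simp
  show ?thesis
    unfolding sqn_def cmod_diff_sq
    by (rule lin[OF L2fun_integrable[OF f] L2fun_mult_integrable[OF f L2fun_cnj[OF g]] L2fun_integrable[OF g]])
qed

lemma sqn_add_expand:
  assumes f: "f \<in> L2fun M" and g: "g \<in> L2fun M"
  shows "sqn M (\<lambda>x. f x + g x) = sqn M f + 2 * Re (LINT x|M. f x * cnj (g x)) + sqn M g"
  using sqn_diff_expand[OF f L2fun_uminus[OF g]] by (simp add: sqn_def)

lemma sqn_tendsto:
  assumes "\<And>n. f n \<in> L2fun M" "g \<in> L2fun M" "((\<lambda>n. sqn M (\<lambda>x. f n x - g x)) \<longlongrightarrow> 0) F"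
  shows "((\<lambda>n. sqn M (f n)) \<longlongrightarrow> sqn M g) F"
proof (rule LIM_zero_cancel, rule tendsto_norm_zero_cancel)
  let ?d = "\<lambda>n. sqn M (\<lambda>x. f n x - g x)"
  have "((\<lambda>n. ?d n + 2 * sqrt (?d n * sqn M g)) \<longlongrightarrow> 0 + 2 * sqrt (0 * sqn M g)) F"
    by (intro tendsto_intros assms)
  then have lim: "((\<lambda>n. ?d n + 2 * sqrt (?d n * sqn M g)) \<longlongrightarrow> 0) F" by simp
  have b: "norm (sqn M (f n) - sqn M g) \<le> ?d n + 2 * sqrt (?d n * sqn M g)" for n
  proof -
    have d: "(\<lambda>x. f n x - g x) \<in> L2fun M" and c: "(\<lambda>x. cnj (g x)) \<in> L2fun M"
      using assms by (auto intro: L2fun_intros)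
    have "sqn M (f n) = ?d n + 2 * Re (LINT x|M. (f n x - g x) * cnj (g x)) + sqn M g"
      using sqn_add_expand[OF d assms(2)] by simp
    then have "norm (sqn M (f n) - sqn M g) \<le> ?d n + 2 * \<bar>Re (LINT x|M. (f n x - g x) * cnj (g x))\<bar>"
      using sqn_nonneg[of M "\<lambda>x. f n x - g x"] unfolding real_norm_def by linarith
    also have "\<dots> \<le> ?d n + 2 * cmod (LINT x|M. (f n x - g x) * cnj (g x))"
      using abs_Re_le_cmod by simp
    also have "\<dots> \<le> ?d n + 2 * sqrt (?d n * sqn M g)"
      using Cauchy_Schwarz_integral[OF d c] by (simp add: sqn_def)
    finally show ?thesis .
  qed
  show "((\<lambda>n. norm (sqn M (f n) - sqn M g)) \<longlongrightarrow> 0) F"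
    by (rule tendsto_sandwich[OF _ _ tendsto_const lim]) (use b in auto)
qed

lemma tendsto_sqn_dominated:
  fixes f :: "nat \<Rightarrow> 'a \<Rightarrow> complex"
  assumes "\<And>n. f n \<in> borel_measurable M" "w \<in> L2fun M"
    and "AE x in M. (\<lambda>n. f n x) \<longlonglongrightarrow> 0" "\<And>n. AE x in M. cmod (f n x) \<le> cmod (w x)"
  shows "(\<lambda>n. sqn M (f n)) \<longlonglongrightarrow> 0"
proof -
  have "(\<lambda>n. LINT x|M. (cmod (f n x))\<^sup>2) \<longlonglongrightarrow> (LINT x|M. 0)"
  proof (rule integral_dominated_convergence[OF _ _ L2fun_integrable[OF assms(2)]])
    show "(\<lambda>x. (cmod (f n x))\<^sup>2) \<in> borel_measurable M" for n using assms(1)[of n] by measurable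
    show "AE x in M. (\<lambda>i. (cmod (f i x))\<^sup>2) \<longlonglongrightarrow> 0"
      using assms(3)
    proof eventually_elim
      case (elim x)
      then have "(\<lambda>i. (cmod (f i x))\<^sup>2) \<longlonglongrightarrow> (cmod 0)\<^sup>2" by (intro tendsto_intros)
      then show ?case by simp
    qed
    show "AE x in M. norm ((cmod (f n x))\<^sup>2) \<le> (cmod (w x))\<^sup>2" for n
      using assms(4)[of n] by eventually_elim (auto intro: power_mono)
  qed simp
  then show ?thesis by (simp add: sqn_def)
qed

lemma L2_tendsto_imp_Cauchy:
  assumes f: "\<And>n. f n \<in> L2fun M" and g: "g \<in> L2fun M"
    and lim: "(\<lambda>n. sqn M (\<lambda>x. f n x - g x)) \<longlonglongrightarrow> 0" and "e > 0"
  shows "\<exists>N. \<forall>m\<ge>N. \<forall>n\<ge>N. sqn M (\<lambda>x. f m x - f n x) < e"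
proof -
  have p: "e / 4 > 0" using \<open>e > 0\<close> by simp
  obtain N where N: "\<And>n. n \<ge> N \<Longrightarrow> sqn M (\<lambda>x. f n x - g x) < e / 4"
    using order_tendstoD(2)[OF lim p] unfolding eventually_sequentially by blast
  have "sqn M (\<lambda>x. f m x - f n x) < e" if "m \<ge> N" "n \<ge> N" for m n
    using sqn_diff_triangle[OF f g f, of m n] N[OF that(1)] N[OF that(2)] sqn_minus_commute[of M g "f n"] by simp
  then show ?thesis by blast
qed

lemma L2_tendsto_AE_subseq:
  assumes f: "\<And>n. f n \<in> L2fun M" and g: "g \<in> L2fun M"
    and lim: "(\<lambda>n. sqn M (\<lambda>x. f n x - g x)) \<longlonglongrightarrow> 0"
  obtains r where "strict_mono (r :: nat \<Rightarrow> nat)" "AE x in M. (\<lambda>n. f (r n) x) \<longlonglongrightarrow> g x"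
proof -
  obtain F r where F: "F \<in> L2fun M" "(\<lambda>n. sqn M (\<lambda>x. f n x - F x)) \<longlonglongrightarrow> 0"
    and r: "strict_mono r" "AE x in M. (\<lambda>n. f (r n) x) \<longlonglongrightarrow> F x"
    using L2_complete[OF f L2_tendsto_imp_Cauchy[OF f g lim]] by blast
  have "AE x in M. F x = g x"
    by (rule L2_limit_unique[OF f F(1) g _ F(2) lim]) simp
  then have "AE x in M. (\<lambda>n. f (r n) x) \<longlonglongrightarrow> g x"
    using r(2) by eventually_elim simp
  with r(1) show thesis by (rule that)
qed

text \<open>A minimising sequence is Cauchy by the parallelogram law: the midpoint of two of its
  members is again in C, so it is no closer to p than the infimum d, which leaves little room for
  their difference.\<close>

lemma L2_projection_exists:
  assumes C: "C \<subseteq> L2fun M" "C \<noteq> {}"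
    and mid: "\<And>f g. f \<in> C \<Longrightarrow> g \<in> C \<Longrightarrow> (\<lambda>x. (f x + g x) / 2) \<in> C"
    and closed: "\<And>f g. (\<And>n. f n \<in> C) \<Longrightarrow> g \<in> L2fun M \<Longrightarrow> (\<lambda>n. sqn M (\<lambda>x. f n x - g x)) \<longlonglongrightarrow> 0 \<Longrightarrow> g \<in> C"
    and p: "p \<in> L2fun M"
  obtains h where "h \<in> C" "\<And>k. k \<in> C \<Longrightarrow> sqn M (\<lambda>x. h x - p x) \<le> sqn M (\<lambda>x. k x - p x)"
proof -
  define d where "d = (INF k\<in>C. sqn M (\<lambda>x. k x - p x))"
  have bdd: "bdd_below ((\<lambda>k. sqn M (\<lambda>x. k x - p x)) ` C)"
    by (rule bdd_belowI[of _ 0]) auto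
  have dle: "d \<le> sqn M (\<lambda>x. k x - p x)" if "k \<in> C" for k
    unfolding d_def by (rule cINF_lower[OF bdd that])
  have "\<exists>k\<in>C. sqn M (\<lambda>x. k x - p x) < d + 1 / real (Suc n)" for n
  proof (rule ccontr)
    assume "\<not> ?thesis"
    then have "d + 1 / real (Suc n) \<le> d"
      unfolding d_def[symmetric] by (subst (2) d_def) (intro cINF_greatest C(2), auto simp: not_less)
    then show False by simp
  qed
  then obtain h where hC: "\<And>n. h n \<in> C" and hd: "\<And>n. sqn M (\<lambda>x. h n x - p x) < d + 1 / real (Suc n)"
    by metis
  have hL: "h n \<in> L2fun M" for n using hC C(1) by blast
  have par: "sqn M (\<lambda>x. h m x - h n x) \<le> 2 / real (Suc m) + 2 / real (Suc n)" for m n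
  proof -
    have a: "(\<lambda>x. h m x - p x) \<in> L2fun M" and b: "(\<lambda>x. h n x - p x) \<in> L2fun M"
      by (intro L2fun_diff hL p)+
    have "sqn M (\<lambda>x. (h m x - p x) - (h n x - p x)) + sqn M (\<lambda>x. (h m x - p x) + (h n x - p x))
        = 2 * sqn M (\<lambda>x. h m x - p x) + 2 * sqn M (\<lambda>x. h n x - p x)"
      unfolding sqn_diff_expand[OF a b] sqn_add_expand[OF a b] by simp
    moreover have "sqn M (\<lambda>x. (h m x - p x) + (h n x - p x)) = 4 * sqn M (\<lambda>x. (h m x + h n x) / 2 - p x)"
    proof -
      have "(\<lambda>x. (h m x - p x) + (h n x - p x)) = (\<lambda>x. 2 * ((h m x + h n x) / 2 - p x))"
        by (auto simp: field_simps)
      then show ?thesis by (simp only: sqn_cmult) simp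
    qed
    moreover have "d \<le> sqn M (\<lambda>x. (h m x + h n x) / 2 - p x)"
      by (rule dle[OF mid[OF hC hC]])
    moreover have "sqn M (\<lambda>x. (h m x - p x) - (h n x - p x)) = sqn M (\<lambda>x. h m x - h n x)" by simp
    moreover have "2 / real (Suc m) = 2 * (1 / real (Suc m))" "2 / real (Suc n) = 2 * (1 / real (Suc n))"
      by simp_all
    ultimately show ?thesis using hd[of m] hd[of n] by linarith
  qed
  have "\<exists>N. \<forall>m\<ge>N. \<forall>n\<ge>N. sqn M (\<lambda>x. h m x - h n x) < e" if "e > 0" for e
  proof -
    obtain N where N: "4 / e < real (Suc N)"
      using reals_Archimedean2[of "4 / e"] by (meson less_trans of_nat_less_iff lessI)
    have "sqn M (\<lambda>x. h m x - h n x) < e" if mn: "m \<ge> N" "n \<ge> N" for m n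
    proof -
      have "2 / real (Suc m) \<le> 2 / real (Suc N)" "2 / real (Suc n) \<le> 2 / real (Suc N)"
        using mn by (auto intro!: divide_left_mono)
      moreover have "4 / real (Suc N) < e" using N \<open>e > 0\<close> by (simp add: field_simps)
      moreover have "4 / real (Suc N) = 2 / real (Suc N) + 2 / real (Suc N)" by simp
      ultimately show ?thesis using par[of m n] by linarith
    qed
    then show ?thesis by blast
  qed
  from L2_complete[OF hL this] obtain H where H: "H \<in> L2fun M" "(\<lambda>n. sqn M (\<lambda>x. h n x - H x)) \<longlonglongrightarrow> 0"
    by blast
  have "(\<lambda>n. sqn M (\<lambda>x. h n x - p x)) \<longlonglongrightarrow> sqn M (\<lambda>x. H x - p x)"
    by (rule sqn_tendsto) (use H hL p in \<open>auto intro: L2fun_intros\<close>)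
  moreover have "(\<lambda>n. d + 1 / real (Suc n)) \<longlonglongrightarrow> d + 0"
    by (intro tendsto_intros LIMSEQ_Suc[OF lim_const_over_n])
  ultimately have "sqn M (\<lambda>x. H x - p x) \<le> d + 0"
    by (rule LIMSEQ_le) (use less_imp_le[OF hd] in blast)
  then have "sqn M (\<lambda>x. H x - p x) \<le> d" by simp
  then show thesis
    using that[OF closed[OF hC H]] dle by (meson order_trans)
qed

section \<open>The Plancherel theorem\<close>

lemma borel_measurable_cis [measurable (raw)]:
  "f \<in> borel_measurable M \<Longrightarrow> (\<lambda>x. cis (f x)) \<in> borel_measurable M"
  unfolding cis_conv_exp by measurable

text \<open>Sign and normalisation are those of \<open>L2_fourier\<close>: exponent +i and no factor
  in front, so that Plancherel's identity carries the factor 2 pi.\<close>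

definition fourier1 :: "(real \<Rightarrow> complex) \<Rightarrow> real \<Rightarrow> complex" where
  "fourier1 x \<omega> = (LINT u|lborel. x u * cis (u * \<omega>))"

lemma fourier1_measurable [measurable]:
  assumes [measurable]: "x \<in> borel_measurable borel"
  shows "fourier1 x \<in> borel_measurable borel"
proof -
  have "(\<lambda>\<omega>. LINT u|lborel. x u * cis (u * \<omega>)) \<in> borel_measurable borel"
    by (rule lborel.borel_measurable_lebesgue_integral) simp
  then show ?thesis unfolding fourier1_def[abs_def] .
qed

lemma integrable_cis_mult:
  assumes "integrable lborel (x :: real \<Rightarrow> complex)"
  shows "integrable lborel (\<lambda>u. x u * cis (u * \<omega>))"
  by (rule Bochner_Integration.integrable_bound[OF assms]) (use assms in \<open>auto simp: norm_mult\<close>)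

lemma fourier1_bound:
  assumes "integrable lborel x"
  shows "cmod (fourier1 x \<omega>) \<le> (LINT u|lborel. cmod (x u))"
  using integral_norm_bound[of lborel "\<lambda>u. x u * cis (u * \<omega>)"] by (simp add: fourier1_def norm_mult)

lemma fourier1_diff:
  "integrable lborel x \<Longrightarrow> integrable lborel y \<Longrightarrow>
    fourier1 (\<lambda>u. x u - y u) \<omega> = fourier1 x \<omega> - fourier1 y \<omega>"
  by (simp add: fourier1_def integrable_cis_mult left_diff_distrib)

lemma fourier1_diff_fun:
  "integrable lborel x \<Longrightarrow> integrable lborel y \<Longrightarrow>
    fourier1 (\<lambda>u. x u - y u) = (\<lambda>\<omega>. fourier1 x \<omega> - fourier1 y \<omega>)"
  by (rule ext) (rule fourier1_diff)

lemma fourier1_cmult: "fourier1 (\<lambda>u. c * x u) \<omega> = c * fourier1 x \<omega>"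
  by (simp add: fourier1_def mult.assoc)

text \<open>Fubini's theorem. Moving the transform from one factor to the other replaces a pointwise
  inversion theorem: with a modulated Gaussian as second factor, the right-hand side is an explicit
  average of x.\<close>

lemma fourier1_multiplication:
  assumes x: "integrable lborel x" and y: "integrable lborel y"
  shows "(LINT \<omega>|lborel. fourier1 x \<omega> * y \<omega>) = (LINT u|lborel. x u * fourier1 y u)"
proof -
  have [measurable]: "x \<in> borel_measurable borel" "y \<in> borel_measurable borel"
    using x y by auto
  have i: "integrable (lborel \<Otimes>\<^sub>M lborel) (\<lambda>(u, \<omega>). x u * (y \<omega> * cis (\<omega> * u)))"
  proof (rule lborel_pair.Fubini_integrable)
    have "integrable lborel (\<lambda>u. cmod (x u) * (LINT \<omega>|lborel. cmod (y \<omega>)))"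
      using x by simp
    then show "integrable lborel (\<lambda>u. LINT \<omega>|lborel. norm (case (u, \<omega>) of (u, \<omega>) \<Rightarrow> x u * (y \<omega> * cis (\<omega> * u))))"
      by (simp add: norm_mult)
    show "AE u in lborel. integrable lborel (\<lambda>\<omega>. case (u, \<omega>) of (u, \<omega>) \<Rightarrow> x u * (y \<omega> * cis (\<omega> * u)))"
      using integrable_cis_mult[OF y] by simp
  qed simp
  have "(LINT u|lborel. x u * fourier1 y u) = (LINT u|lborel. LINT \<omega>|lborel. x u * (y \<omega> * cis (\<omega> * u)))"
    by (simp add: fourier1_def)
  also have "\<dots> = (LINT \<omega>|lborel. LINT u|lborel. x u * (y \<omega> * cis (\<omega> * u)))"
    by (rule lborel_pair.Fubini_integral[OF i, symmetric])
  also have "\<dots> = (LINT \<omega>|lborel. fourier1 x \<omega> * y \<omega>)"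
    unfolding fourier1_def
    by (subst integral_mult_left_zero[symmetric]) (simp add: mult_ac)
  finally show ?thesis by simp
qed

text \<open>\<open>gauss n\<close> is not normalised: it equals 1 at the origin, so \<open>gauss n\<close> increases to 1.\<close>

definition gauss :: "real \<Rightarrow> real \<Rightarrow> complex" where
  "gauss n \<omega> = complex_of_real (exp (- (\<omega> / n)\<^sup>2 / 2))"

lemma gauss_measurable [measurable]: "gauss n \<in> borel_measurable borel"
  unfolding gauss_def[abs_def] by measurable

text \<open>Read off from the standard normal distribution: up to the factor sqrt (2 pi), the last
  formula is its characteristic function.\<close>

lemma integrable_exp_half_sq: "integrable lborel (\<lambda>s::real. exp (- s\<^sup>2 / 2))"
  and integral_exp_half_sq: "(LINT s|lborel. exp (- s\<^sup>2 / 2)) = sqrt (2 * pi)"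
  and integral_exp_half_sq_cis: "(LINT s|lborel. complex_of_real (exp (- s\<^sup>2 / 2)) * cis (s * t))
         = sqrt (2 * pi) * exp (- t\<^sup>2 / 2)"
proof -
  have e: "exp (- s\<^sup>2 / 2) = sqrt (2 * pi) * std_normal_density s" for s
    by (simp add: std_normal_density_def)
  show "integrable lborel (\<lambda>s::real. exp (- s\<^sup>2 / 2))"
    unfolding e by (simp add: integrable_normal_density)
  show "(LINT s|lborel. exp (- s\<^sup>2 / 2)) = sqrt (2 * pi)"
    unfolding e by (simp add: integral_normal_density)
  have "char std_normal_distribution t = (LINT s|lborel. std_normal_density s *\<^sub>R cis (t * s))"
    unfolding char_def by (subst integral_density) (auto simp: cis_conv_exp normal_density_nonneg)
  then have "(LINT s|lborel. std_normal_density s *\<^sub>R cis (t * s)) = exp (- t\<^sup>2 / 2)"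
    by (simp add: char_std_normal_distribution)
  then have "(LINT s|lborel. sqrt (2 * pi) *\<^sub>R (std_normal_density s *\<^sub>R cis (t * s))) = sqrt (2 * pi) * exp (- t\<^sup>2 / 2)"
    by (subst integral_scaleR_right) (simp add: scaleR_conv_of_real)
  then show "(LINT s|lborel. complex_of_real (exp (- s\<^sup>2 / 2)) * cis (s * t)) = sqrt (2 * pi) * exp (- t\<^sup>2 / 2)"
    unfolding e by (simp add: scaleR_conv_of_real mult_ac)
qed

lemma integrable_gauss: "n > 0 \<Longrightarrow> integrable lborel (gauss n)"
  using lborel_integrable_real_affine[OF integrable_exp_half_sq, of "1 / n" 0]
  unfolding gauss_def[abs_def] by (intro integrable_of_real) simp

lemma fourier1_gauss:
  assumes "n > 0"
  shows "fourier1 (gauss n) u = n * sqrt (2 * pi) * exp (- (n * u)\<^sup>2 / 2)"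
proof -
  have "fourier1 (gauss n) u = \<bar>n\<bar> *\<^sub>R (LINT s|lborel. gauss n (0 + n * s) * cis ((0 + n * s) * u))"
    unfolding fourier1_def by (rule lborel_integral_real_affine) (use assms in auto)
  also have "(\<lambda>s. gauss n (0 + n * s) * cis ((0 + n * s) * u)) = (\<lambda>s. complex_of_real (exp (- s\<^sup>2 / 2)) * cis (s * (n * u)))"
    using assms by (auto simp: gauss_def mult_ac)
  finally show ?thesis
    using assms integral_exp_half_sq_cis[of "n * u"] by (simp add: scaleR_conv_of_real mult_ac)
qed

lemma fourier1_modulate: "fourier1 (\<lambda>\<omega>. x \<omega> * cis (\<omega> * v)) u = fourier1 x (u + v)"
  by (simp add: fourier1_def mult.assoc cis_mult distrib_left add.commute)

text \<open>The inversion integral with a Gaussian summability factor. After the substitution v = u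
  + s / n the parameter n occurs only in the argument of y, so that the limit for large n is a
  matter of continuity of y.\<close>

lemma fourier1_gauss_inverse:
  assumes y: "integrable lborel y" and n: "n > 0"
  shows "(LINT \<omega>|lborel. fourier1 y \<omega> * (gauss n \<omega> * cis (\<omega> * (- u))))
       = sqrt (2 * pi) * (LINT s|lborel. y (u + s / n) * complex_of_real (exp (- s\<^sup>2 / 2)))"
proof -
  have "(LINT \<omega>|lborel. fourier1 y \<omega> * (gauss n \<omega> * cis (\<omega> * (- u))))
      = (LINT v|lborel. y v * fourier1 (\<lambda>\<omega>. gauss n \<omega> * cis (\<omega> * (- u))) v)"
    by (rule fourier1_multiplication[OF y integrable_cis_mult[OF integrable_gauss[OF n]]])
  also have "\<dots> = (LINT v|lborel. y v * (n * sqrt (2 * pi) * exp (- (n * (v + - u))\<^sup>2 / 2)))"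
    unfolding fourier1_modulate fourier1_gauss[OF n] by simp
  also have "\<dots> = \<bar>1 / n\<bar> *\<^sub>R (LINT s|lborel. y (u + 1 / n * s) * (n * sqrt (2 * pi) * exp (- (n * ((u + 1 / n * s) + - u))\<^sup>2 / 2)))"
    by (rule lborel_integral_real_affine) (use n in auto)
  also have "(\<lambda>s. y (u + 1 / n * s) * (n * sqrt (2 * pi) * exp (- (n * ((u + 1 / n * s) + - u))\<^sup>2 / 2)))
     = (\<lambda>s. (n * sqrt (2 * pi)) * (y (u + s / n) * complex_of_real (exp (- s\<^sup>2 / 2))))"
    using n by (auto simp: mult_ac)
  finally show ?thesis
    using n by (simp add: scaleR_conv_of_real)
qed

section \<open>Plancherel's identity for compactly supported continuous functions\<close>

definition Cc :: "(real \<Rightarrow> complex) set" where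
  "Cc = {g. continuous_on UNIV g \<and> (\<exists>R. \<forall>x. R < \<bar>x\<bar> \<longrightarrow> g x = 0)}"

lemma Cc_bounded:
  assumes "g \<in> Cc"
  obtains B where "B \<ge> 0" "\<And>x. cmod (g x) \<le> B"
proof -
  obtain R where c: "continuous_on UNIV g" and R: "\<And>x. R < \<bar>x\<bar> \<Longrightarrow> g x = 0"
    using assms by (auto simp: Cc_def)
  have "compact (g ` {-R..R})"
    using c by (intro compact_continuous_image) (auto intro: continuous_on_subset)
  then obtain B where B: "\<And>x. x \<in> {-R..R} \<Longrightarrow> cmod (g x) \<le> B"
    by (meson bounded_iff compact_imp_bounded imageI)
  have "cmod (g x) \<le> max B 0" for x
  proof (cases "R < \<bar>x\<bar>")
    case False
    then have "x \<in> {-R..R}" by (auto simp: abs_le_iff)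
    then show ?thesis using B by (auto intro: max.coboundedI1)
  qed (simp add: R)
  then show thesis by (intro that[of "max B 0"]) auto
qed

lemma Cc_diff: "f \<in> Cc \<Longrightarrow> g \<in> Cc \<Longrightarrow> (\<lambda>x. f x - g x) \<in> Cc"
  unfolding Cc_def
proof safe
  fix R R' assume "\<forall>x. R < \<bar>x\<bar> \<longrightarrow> f x = 0" "\<forall>x. R' < \<bar>x\<bar> \<longrightarrow> g x = 0"
  then show "\<exists>R. \<forall>x. R < \<bar>x\<bar> \<longrightarrow> f x - g x = 0"
    by (intro exI[of _ "max R R'"]) auto
qed (auto intro: continuous_intros)

lemma Cc_measurable: "g \<in> Cc \<Longrightarrow> g \<in> borel_measurable borel"
  by (auto simp: Cc_def borel_measurable_continuous_onI)

text \<open>Serves the L1 and the L2 norm together, with the identity and the squared modulus for F;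
  F 0 = 0 preserves the compact support.\<close>

lemma Cc_integrable_cont:
  fixes F :: "complex \<Rightarrow> 'a :: {banach, second_countable_topology}"
  assumes g: "g \<in> Cc" and F: "continuous_on UNIV F" "F 0 = 0"
  shows "integrable lborel (\<lambda>x. F (g x))"
proof -
  obtain R where c: "continuous_on UNIV g" and R: "\<And>x. R < \<bar>x\<bar> \<Longrightarrow> g x = 0"
    using g by (auto simp: Cc_def)
  have "set_integrable lborel {-R..R} (\<lambda>x. F (g x))"
    by (intro borel_integrable_atLeastAtMost' continuous_on_compose2[OF F(1)]
        continuous_on_subset[OF c]) auto
  moreover have "(\<lambda>x. indicator {-R..R} x *\<^sub>R F (g x)) = (\<lambda>x. F (g x))"
    using R F(2) by (auto simp: indicator_def fun_eq_iff abs_less_iff not_le abs_if)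
  ultimately show ?thesis by (simp add: set_integrable_def)
qed

lemma Cc_L2: "g \<in> Cc \<Longrightarrow> g \<in> L2fun lborel"
  using Cc_integrable_cont[of g "\<lambda>z. (cmod z)\<^sup>2"]
  by (auto simp: L2fun_def Cc_measurable intro!: continuous_intros)

lemma Cc_L1: "g \<in> Cc \<Longrightarrow> integrable lborel g"
  using Cc_integrable_cont[of g "\<lambda>z. z"] by auto

text \<open>The integral of the squared transform is regularised by Gaussians increasing to 1. The
  multiplication formula and the Gaussian inversion formula turn each regularised integral into sqrt
  (2 pi) times a pairing of y with a Gaussian average of y, and the averages converge boundedly by
  continuity. Monotone convergence on the frequency side then yields finiteness and value at the
  same time.\<close>

lemma Plancherel_Cc:
  assumes y: "y \<in> Cc"
  shows "fourier1 y \<in> L2fun lborel" "sqn lborel (fourier1 y) = 2 * pi * sqn lborel y"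
proof -
  note [measurable] = Cc_measurable[OF y]
  note yi = Cc_L1[OF y]
  obtain B where B: "B \<ge> 0" "\<And>x. cmod (y x) \<le> B" using Cc_bounded[OF y] by blast
  have cont: "isCont y u" for u
    using y by (auto simp: Cc_def continuous_on_eq_continuous_at)
  \<comment> \<open>This is sqrt (2 pi) times the mean of y under the normal distribution around u
    with standard deviation 1 / n.\<close>
  define w where "w n u = (LINT s|lborel. y (u + s / n) * complex_of_real (exp (- s\<^sup>2 / 2)))" for n u :: real
  have wm [measurable]: "w n \<in> borel_measurable borel" for n
    unfolding w_def by (rule lborel.borel_measurable_lebesgue_integral) simp
  have wlim: "(\<lambda>i. w (real (Suc i)) u) \<longlonglongrightarrow> sqrt (2 * pi) * y u" for u
  proof -
    have "(\<lambda>i. w (real (Suc i)) u) \<longlonglongrightarrow> (LINT s|lborel. y u * complex_of_real (exp (- s\<^sup>2 / 2)))"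
      unfolding w_def
    proof (rule integral_dominated_convergence[where w = "\<lambda>s. B * exp (- s\<^sup>2 / 2)"])
      show "integrable lborel (\<lambda>s. B * exp (- s\<^sup>2 / 2))"
        by (intro integrable_mult_right integrable_exp_half_sq)
      show "AE s in lborel. (\<lambda>i. y (u + s / real (Suc i)) * complex_of_real (exp (- s\<^sup>2 / 2))) \<longlonglongrightarrow> y u * complex_of_real (exp (- s\<^sup>2 / 2))"
      proof (intro AE_I2 tendsto_intros)
        fix s :: real
        have "(\<lambda>i. u + s / real (Suc i)) \<longlonglongrightarrow> u + 0"
          by (intro tendsto_add tendsto_const LIMSEQ_Suc lim_const_over_n)
        then show "(\<lambda>i. y (u + s / real (Suc i))) \<longlonglongrightarrow> y u"
          using isCont_tendsto_compose[OF cont] by simp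
      qed
      show "AE s in lborel. norm (y (u + s / real (Suc i)) * complex_of_real (exp (- s\<^sup>2 / 2))) \<le> B * exp (- s\<^sup>2 / 2)" for i
        using B by (auto simp: norm_mult intro!: mult_right_mono)
    qed simp_all
    also have "(LINT s|lborel. y u * complex_of_real (exp (- s\<^sup>2 / 2))) = sqrt (2 * pi) * y u"
      using integral_exp_half_sq by simp
    finally show ?thesis .
  qed
  have wb: "cmod (w n u) \<le> B * sqrt (2 * pi)" for n u
  proof -
    have "cmod (w n u) \<le> (LINT s|lborel. cmod (y (u + s / n) * complex_of_real (exp (- s\<^sup>2 / 2))))"
      unfolding w_def by (rule integral_norm_bound)
    also have "\<dots> \<le> (LINT s|lborel. B * exp (- s\<^sup>2 / 2))"
    proof (rule integral_mono)
      show "integrable lborel (\<lambda>s. cmod (y (u + s / n) * complex_of_real (exp (- s\<^sup>2 / 2))))"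
        by (rule Bochner_Integration.integrable_bound[OF integrable_mult_right[OF integrable_exp_half_sq, of B]])
           (use B in \<open>auto simp: norm_mult intro!: mult_right_mono\<close>)
    qed (use B integrable_exp_half_sq in \<open>auto simp: norm_mult intro!: mult_right_mono\<close>)
    finally show ?thesis using integral_exp_half_sq by simp
  qed
  define f where "f i \<omega> = (cmod (fourier1 y \<omega>))\<^sup>2 * exp (- (\<omega> / real (Suc i))\<^sup>2 / 2)" for i \<omega>
  have fi: "integrable lborel (f i)" for i
  proof (rule Bochner_Integration.integrable_bound)
    show "integrable lborel (\<lambda>\<omega>. (LINT u|lborel. cmod (y u))\<^sup>2 * exp (- (\<omega> / real (Suc i))\<^sup>2 / 2))"
      using integrable_norm[OF integrable_gauss[of "real (Suc i)"]]
      by (intro integrable_mult_right) (simp add: gauss_def)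
    show "f i \<in> borel_measurable lborel" unfolding f_def by measurable
    show "AE x in lborel. norm (f i x) \<le> norm ((LINT u|lborel. cmod (y u))\<^sup>2 * exp (- (x / real (Suc i))\<^sup>2 / 2))"
      using fourier1_bound[OF yi] by (auto simp: f_def intro!: mult_right_mono power_mono)
  qed
  have eq: "complex_of_real (LINT \<omega>|lborel. f i \<omega>) = sqrt (2 * pi) * (LINT u|lborel. y u * cnj (w (real (Suc i)) u))" for i
  proof -
    let ?g = "gauss (real (Suc i))"
    have ig: "integrable lborel ?g" by (rule integrable_gauss) simp
    have i2: "integrable lborel (\<lambda>\<omega>. cnj (fourier1 y \<omega>) * ?g \<omega>)"
    proof (rule Bochner_Integration.integrable_bound[OF integrable_mult_right[OF ig, of "LINT u|lborel. cmod (y u)"]])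
      show "(\<lambda>\<omega>. cnj (fourier1 y \<omega>) * ?g \<omega>) \<in> borel_measurable lborel"
        by measurable
    qed (use fourier1_bound[OF yi] in \<open>auto simp: norm_mult intro!: mult_right_mono\<close>)
    have cnjF: "fourier1 (\<lambda>\<omega>. cnj (fourier1 y \<omega>) * ?g \<omega>) u = sqrt (2 * pi) * cnj (w (real (Suc i)) u)" for u
    proof -
      have "fourier1 (\<lambda>\<omega>. cnj (fourier1 y \<omega>) * ?g \<omega>) u
         = cnj (LINT \<omega>|lborel. fourier1 y \<omega> * (?g \<omega> * cis (\<omega> * (- u))))"
        unfolding fourier1_def[of "\<lambda>\<omega>. cnj (fourier1 y \<omega>) * ?g \<omega>"]
        by (subst Bochner_Integration.integral_cnj[symmetric], intro Bochner_Integration.integral_cong) (auto simp: gauss_def cis_cnj mult.assoc)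
      then show ?thesis
        by (subst (asm) fourier1_gauss_inverse[OF yi]) (auto simp: w_def)
    qed
    have "complex_of_real (LINT \<omega>|lborel. f i \<omega>) = (LINT \<omega>|lborel. complex_of_real (f i \<omega>))"
      by simp
    also have "\<dots> = (LINT \<omega>|lborel. fourier1 y \<omega> * (cnj (fourier1 y \<omega>) * ?g \<omega>))"
      by (intro Bochner_Integration.integral_cong)
         (auto simp: f_def gauss_def complex_norm_square mult.assoc[symmetric] simp flip: of_real_power)
    also have "\<dots> = (LINT u|lborel. y u * fourier1 (\<lambda>\<omega>. cnj (fourier1 y \<omega>) * ?g \<omega>) u)"
      by (rule fourier1_multiplication[OF yi i2])
    also have "\<dots> = sqrt (2 * pi) * (LINT u|lborel. y u * cnj (w (real (Suc i)) u))"
      unfolding cnjF by (subst integral_mult_right_zero[symmetric]) (simp add: mult_ac)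
    finally show ?thesis .
  qed
  have "(\<lambda>i. LINT u|lborel. y u * cnj (w (real (Suc i)) u)) \<longlonglongrightarrow> (LINT u|lborel. y u * cnj (sqrt (2 * pi) * y u))"
  proof (rule integral_dominated_convergence[where w = "\<lambda>u. cmod (y u) * (B * sqrt (2 * pi))"])
    show "integrable lborel (\<lambda>u. cmod (y u) * (B * sqrt (2 * pi)))"
      using yi by simp
    show "AE u in lborel. (\<lambda>i. y u * cnj (w (real (Suc i)) u)) \<longlonglongrightarrow> y u * cnj (sqrt (2 * pi) * y u)"
      by (intro AE_I2 tendsto_intros wlim)
    show "AE u in lborel. norm (y u * cnj (w (real (Suc i)) u)) \<le> cmod (y u) * (B * sqrt (2 * pi))" for i
      using wb by (auto simp: norm_mult intro!: mult_left_mono)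
  qed measurable
  then have "(\<lambda>i. sqrt (2 * pi) * (LINT u|lborel. y u * cnj (w (real (Suc i)) u)))
      \<longlonglongrightarrow> sqrt (2 * pi) * (LINT u|lborel. y u * cnj (sqrt (2 * pi) * y u))"
    by (intro tendsto_intros)
  also have "(\<lambda>u. y u * cnj (sqrt (2 * pi) * y u)) = (\<lambda>u. sqrt (2 * pi) * complex_of_real ((cmod (y u))\<^sup>2))"
    unfolding complex_norm_square by (simp add: mult.left_commute)
  also have "sqrt (2 * pi) * (LINT u|lborel. sqrt (2 * pi) * complex_of_real ((cmod (y u))\<^sup>2))
     = complex_of_real (sqrt (2 * pi) * sqrt (2 * pi)) * (LINT u|lborel. complex_of_real ((cmod (y u))\<^sup>2))"
    unfolding integral_mult_right_zero of_real_mult by (simp only: mult.assoc)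
  also have "\<dots> = complex_of_real (2 * pi * sqn lborel y)"
    by (simp add: sqn_def del: of_real_power)
  finally have "(\<lambda>i. complex_of_real (LINT \<omega>|lborel. f i \<omega>)) \<longlonglongrightarrow> complex_of_real (2 * pi * sqn lborel y)"
    unfolding eq .
  then have lim: "(\<lambda>i. LINT \<omega>|lborel. f i \<omega>) \<longlonglongrightarrow> 2 * pi * sqn lborel y"
    by (simp only: tendsto_of_real_iff)
  have mono: "AE \<omega> in lborel. mono (\<lambda>i. f i \<omega>)"
  proof (intro AE_I2 monoI)
    fix \<omega> and i j :: nat assume "i \<le> j"
    then have "\<bar>\<omega> / real (Suc j)\<bar> \<le> \<bar>\<omega> / real (Suc i)\<bar>"
      by (auto simp: abs_mult intro!: divide_left_mono)
    then have "(\<omega> / real (Suc j))\<^sup>2 \<le> (\<omega> / real (Suc i))\<^sup>2"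
      by (simp only: abs_le_square_iff)
    then show "f i \<omega> \<le> f j \<omega>"
      by (auto simp: f_def intro!: mult_left_mono)
  qed
  have pt: "AE \<omega> in lborel. (\<lambda>i. f i \<omega>) \<longlonglongrightarrow> (cmod (fourier1 y \<omega>))\<^sup>2"
  proof (rule AE_I2)
    fix \<omega> :: real
    have "(\<lambda>i. (cmod (fourier1 y \<omega>))\<^sup>2 * exp (- (\<omega> / real (Suc i))\<^sup>2 / 2)) \<longlonglongrightarrow> (cmod (fourier1 y \<omega>))\<^sup>2 * exp (- 0\<^sup>2 / 2)"
      by (intro tendsto_intros LIMSEQ_Suc lim_const_over_n) simp
    then show "(\<lambda>i. f i \<omega>) \<longlonglongrightarrow> (cmod (fourier1 y \<omega>))\<^sup>2" by (simp add: f_def)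
  qed
  have m: "(\<lambda>\<omega>. (cmod (fourier1 y \<omega>))\<^sup>2) \<in> borel_measurable lborel" by measurable
  show "fourier1 y \<in> L2fun lborel"
    using integrable_monotone_convergence[OF fi mono pt lim m] by (simp add: L2fun_def)
  show "sqn lborel (fourier1 y) = 2 * pi * sqn lborel y"
    using integral_monotone_convergence[OF fi mono pt lim m] by (simp add: sqn_def)
qed

text \<open>One factor fades out linearly for k <= |x| <= k + 1, the other scales z back to modulus
  at most k. Both are continuous, so that continuous functions are sent into \<open>Cc\<close>,
  which an indicator would not achieve.\<close>

definition cutoff :: "real \<Rightarrow> real \<Rightarrow> complex \<Rightarrow> complex" where
  "cutoff k x z = (max 0 (min 1 (k + 1 - \<bar>x\<bar>)) * (k / max k (cmod z))) *\<^sub>R z"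

lemma cutoff_le:
  assumes "k > 0"
  shows "cmod (cutoff k x z) \<le> cmod z" "cmod (cutoff k x z) \<le> k * indicator {-(k+1)..k+1} x"
proof -
  have a: "0 \<le> k / max k (cmod z)" "k / max k (cmod z) \<le> 1" "k / max k (cmod z) * cmod z \<le> k"
    using assms by (auto simp: field_simps max_def divide_le_eq)
  have b: "0 \<le> max 0 (min 1 (k + 1 - \<bar>x\<bar>))" "max 0 (min 1 (k + 1 - \<bar>x\<bar>)) \<le> indicator {-(k+1)..k+1} x"
     "max 0 (min 1 (k + 1 - \<bar>x\<bar>)) \<le> 1"
    by (auto simp: indicator_def)
  have n: "cmod (cutoff k x z) = max 0 (min 1 (k + 1 - \<bar>x\<bar>)) * (k / max k (cmod z) * cmod z)"
    unfolding cutoff_def norm_scaleR abs_mult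
    by (simp only: abs_of_nonneg[OF b(1)] abs_of_nonneg[OF a(1)] mult.assoc)
  show "cmod (cutoff k x z) \<le> cmod z"
    unfolding n
    by (rule order_trans[OF mult_mono[OF b(3) mult_right_mono[OF a(2)]]])
       (use mult_nonneg_nonneg[OF a(1) norm_ge_zero] in simp_all)
  show "cmod (cutoff k x z) \<le> k * indicator {-(k+1)..k+1} x"
    unfolding n mult.commute[of k]
    by (rule mult_mono[OF b(2) a(3)]) (use a assms in simp_all)
qed

lemma cutoff_eq:
  assumes "k > 0" "\<bar>x\<bar> \<le> k" "cmod z \<le> k"
  shows "cutoff k x z = z"
  using assms by (simp add: cutoff_def max_def min_def)

lemma cutoff_continuous:
  assumes "k > 0" "continuous_on UNIV g"
  shows "continuous_on UNIV (\<lambda>x. cutoff k x (g x))"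
  unfolding cutoff_def using assms by (intro continuous_intros) (auto simp: max_def)

lemma cutoff_tendsto:
  assumes "k > 0" "(f \<longlongrightarrow> z) F"
  shows "((\<lambda>n. cutoff k x (f n)) \<longlongrightarrow> cutoff k x z) F"
  unfolding cutoff_def using assms by (intro tendsto_intros) (auto simp: max_def)

lemma cutoff_measurable [measurable]:
  assumes [measurable]: "g \<in> borel_measurable borel"
  shows "(\<lambda>x. cutoff k x (g x)) \<in> borel_measurable borel"
  unfolding cutoff_def by measurable

text \<open>The same g must be close in both norms: closeness in L1 controls the transforms
  pointwise, closeness in L2 controls the norms. First y is cut off to a bounded function with
  bounded support; then continuous functions converging to y almost everywhere are cut off at the
  same level, which makes dominated convergence applicable in both norms.\<close>

lemma Cc_dense:
  assumes L2: "y \<in> L2fun lborel" and L1: "integrable lborel y" and "e > 0"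
  obtains g where "g \<in> Cc" "sqn lborel (\<lambda>x. g x - y x) < e" "(LINT x|lborel. cmod (g x - y x)) < e"
proof -
  have [measurable]: "y \<in> borel_measurable borel" using L1 by auto
  define c where "c k x = cutoff (real (Suc k)) x (y x)" for k x
  have [measurable]: "c k \<in> borel_measurable borel" for k
    unfolding c_def by measurable
  have c_le: "cmod (c k x) \<le> cmod (y x)" for k x
    unfolding c_def by (rule cutoff_le) simp
  then have cy_le: "cmod (c k x - y x) \<le> 2 * cmod (y x)" for k x
    using norm_triangle_ineq4[of "c k x" "y x"] by (smt (verit))
  have c_lim: "(\<lambda>k. c k x - y x) \<longlonglongrightarrow> 0" for x
  proof (rule tendsto_eventually)
    obtain n where n: "max \<bar>x\<bar> (cmod (y x)) \<le> real n" using real_arch_simple by blast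
    show "\<forall>\<^sub>F k in sequentially. c k x - y x = 0"
      using eventually_ge_at_top[of n]
      by eventually_elim (use n in \<open>auto simp: c_def intro!: cutoff_eq\<close>)
  qed
  have "(\<lambda>k. sqn lborel (\<lambda>x. c k x - y x)) \<longlonglongrightarrow> 0"
    by (rule tendsto_sqn_dominated[where w = "\<lambda>x. 2 * y x"])
       (use c_lim cy_le L2 in \<open>auto simp: norm_mult intro!: L2fun_cmult\<close>)
  then have 1: "\<forall>\<^sub>F k in sequentially. sqn lborel (\<lambda>x. c k x - y x) < e / 4"
    by (rule order_tendstoD) (use \<open>e > 0\<close> in simp)
  have "(\<lambda>k. LINT x|lborel. cmod (c k x - y x)) \<longlonglongrightarrow> (LINT x|(lborel :: real measure). (0 :: real))"
    by (rule integral_dominated_convergence[where w = "\<lambda>x. 2 * cmod (y x)"])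
       (use cy_le L1 tendsto_norm_zero[OF c_lim] in auto)
  then have 2: "\<forall>\<^sub>F k in sequentially. (LINT x|lborel. cmod (c k x - y x)) < e / 4"
    using \<open>e > 0\<close> by (intro order_tendstoD(2)[where y = "0 :: real"]) (simp_all del: divide_less_eq_numeral1 less_divide_eq_numeral1)
  obtain k where k: "sqn lborel (\<lambda>x. c k x - y x) < e / 4" "(LINT x|lborel. cmod (c k x - y x)) < e / 4"
    using eventually_happens'[OF _ eventually_conj[OF 1 2]] by auto
  define K where "K = real (Suc k)"
  have K: "K > 0" by (simp add: K_def)
  \<comment> \<open>Both functions compared below are at most K in modulus and supported in this
    interval, so their difference is dominated by \<open>b\<close>.\<close>
  define b where "b x = complex_of_real (2 * K * indicator {-(K+1)..K+1} x)" for x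
  have "(\<lambda>x. cmod (b x)) = (\<lambda>x. 2 * K * indicator {-(K+1)..K+1} x)"
     "(\<lambda>x. (cmod (b x))\<^sup>2) = (\<lambda>x. (2 * K)\<^sup>2 * indicator {-(K+1)..K+1} x)"
    using K by (auto simp: b_def fun_eq_iff indicator_def)
  moreover have "integrable lborel (indicator {-(K+1)..K+1} :: real \<Rightarrow> real)"
    by (rule integrable_real_indicator) (auto simp: emeasure_lborel_Icc_eq)
  ultimately have bi: "integrable lborel (\<lambda>x. cmod (b x))" "integrable lborel (\<lambda>x. (cmod (b x))\<^sup>2)"
    by (simp_all only: integrable_mult_right)
  then have bL: "b \<in> L2fun lborel"
    unfolding L2fun_def b_def by auto
  \<comment> \<open>The Henstock-Kurzweil notion \<open>measurable_on\<close> provides continuous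
    functions converging to y off a negligible set.\<close>
  have "y measurable_on UNIV"
    by (rule lebesgue_measurable_imp_measurable_on) (auto intro: measurable_completion)
  then obtain N g where N: "negligible N" and gc: "\<And>n. continuous_on UNIV (g n :: real \<Rightarrow> complex)"
    and gl: "\<And>x. x \<notin> N \<Longrightarrow> (\<lambda>n. g n x) \<longlonglongrightarrow> y x"
    unfolding measurable_on_def by auto
  have "AE x in lebesgue. x \<notin> N"
    using N by (simp add: AE_not_in negligible_iff_null_sets)
  then have AEl: "AE x in lborel. (\<lambda>n. g n x) \<longlonglongrightarrow> y x"
    unfolding AE_completion_iff by eventually_elim (rule gl)
  define d where "d n x = cutoff K x (g n x)" for n x
  have dcont: "continuous_on UNIV (d n)" for n
    unfolding d_def by (rule cutoff_continuous[OF K gc])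
  then have [measurable]: "d n \<in> borel_measurable borel" for n
    by (rule borel_measurable_continuous_onI)
  have dz: "\<And>x. K + 1 < \<bar>x\<bar> \<Longrightarrow> d n x = 0" for n
    by (simp add: d_def cutoff_def)
  have dCc: "d n \<in> Cc" for n
    using dcont dz by (auto simp: Cc_def)
  have dlim: "AE x in lborel. (\<lambda>n. d n x - c k x) \<longlonglongrightarrow> 0"
    using AEl
  proof eventually_elim
    case (elim x)
    have "(\<lambda>n. d n x) \<longlonglongrightarrow> c k x"
      unfolding d_def c_def K_def[symmetric] by (rule cutoff_tendsto[OF K elim])
    then show ?case by (rule LIM_zero)
  qed
  have dle: "cmod (d n x - c k x) \<le> cmod (b x)" for n x
  proof -
    have "cmod (d n x - c k x) \<le> cmod (d n x) + cmod (c k x)" by (rule norm_triangle_ineq4)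
    also have "\<dots> \<le> 2 * K * indicator {-(K+1)..K+1} x"
      using cutoff_le(2)[OF K, of x "g n x"] cutoff_le(2)[OF K, of x "y x"]
      unfolding d_def c_def K_def[symmetric] by linarith
    also have "\<dots> = cmod (b x)" using K by (simp add: b_def norm_mult indicator_def)
    finally show ?thesis .
  qed
  have "(\<lambda>n. sqn lborel (\<lambda>x. d n x - c k x)) \<longlonglongrightarrow> 0"
    by (rule tendsto_sqn_dominated[OF _ bL dlim]) (use dle in auto)
  then have 3: "\<forall>\<^sub>F n in sequentially. sqn lborel (\<lambda>x. d n x - c k x) < e / 4"
    by (rule order_tendstoD) (use \<open>e > 0\<close> in simp)
  have "(\<lambda>n. LINT x|lborel. cmod (d n x - c k x)) \<longlonglongrightarrow> (LINT x|(lborel :: real measure). (0 :: real))"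
    by (rule integral_dominated_convergence[OF _ _ bi(1)])
       (use dle dlim in \<open>auto intro: tendsto_norm_zero\<close>)
  then have 4: "\<forall>\<^sub>F n in sequentially. (LINT x|lborel. cmod (d n x - c k x)) < e / 4"
    using \<open>e > 0\<close> by (intro order_tendstoD(2)[where y = "0 :: real"]) (simp_all del: divide_less_eq_numeral1 less_divide_eq_numeral1)
  obtain n where n: "sqn lborel (\<lambda>x. d n x - c k x) < e / 4" "(LINT x|lborel. cmod (d n x - c k x)) < e / 4"
    using eventually_happens'[OF _ eventually_conj[OF 3 4]] by auto
  have cL: "c k \<in> L2fun lborel"
    by (rule L2fun_bound[OF L2]) (use c_le in auto)
  have cI: "integrable lborel (c k)"
    by (rule Bochner_Integration.integrable_bound[OF L1]) (use c_le in auto)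
  show thesis
  proof (rule that[OF dCc])
    show "sqn lborel (\<lambda>x. d n x - y x) < e"
      using sqn_diff_triangle[OF Cc_L2[OF dCc[of n]] cL L2] n(1) k(1) by simp
    have "(LINT x|lborel. cmod (d n x - y x)) \<le> (LINT x|lborel. cmod (d n x - c k x) + cmod (c k x - y x))"
    proof (rule integral_mono)
      show "cmod (d n x - y x) \<le> cmod (d n x - c k x) + cmod (c k x - y x)" for x
        using norm_triangle_ineq[of "d n x - c k x" "c k x - y x"] by simp
    qed (use Cc_L1[OF dCc[of n]] cI L1 in auto)
    also have "\<dots> = (LINT x|lborel. cmod (d n x - c k x)) + (LINT x|lborel. cmod (c k x - y x))"
      using Cc_L1[OF dCc[of n]] cI L1 by simp
    finally show "(LINT x|lborel. cmod (d n x - y x)) < e"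
      using n(2) k(2) \<open>e > 0\<close> by simp
  qed
qed

text \<open>Approximants close in L1 have pointwise convergent transforms, and being close in L2
  makes these transforms Cauchy in L2. A subsequence shows that the L2 limit is the transform given
  by the integral.\<close>

lemma Plancherel_L1_L2:
  assumes L2: "y \<in> L2fun lborel" and L1: "integrable lborel y"
  shows "fourier1 y \<in> L2fun lborel" "sqn lborel (fourier1 y) = 2 * pi * sqn lborel y"
proof -
  have "\<exists>g. g \<in> Cc \<and> sqn lborel (\<lambda>x. g x - y x) < 1 / real (Suc n) \<and> (LINT x|lborel. cmod (g x - y x)) < 1 / real (Suc n)" for n
    by (rule Cc_dense[OF L2 L1, of "1 / real (Suc n)"]) auto
  then obtain g where g: "\<And>n. g n \<in> Cc" and g2: "\<And>n. sqn lborel (\<lambda>x. g n x - y x) < 1 / real (Suc n)"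
    and g1: "\<And>n. (LINT x|lborel. cmod (g n x - y x)) < 1 / real (Suc n)"
    by metis
  have l0: "(\<lambda>n. 1 / real (Suc n)) \<longlonglongrightarrow> 0"
    by (rule LIMSEQ_Suc[OF lim_const_over_n])
  have s0: "(\<lambda>n. sqn lborel (\<lambda>x. g n x - y x)) \<longlonglongrightarrow> 0"
    by (rule tendsto_sandwich[OF _ _ tendsto_const l0]) (use less_imp_le[OF g2] in auto)
  have FL: "fourier1 (g n) \<in> L2fun lborel" for n by (rule Plancherel_Cc[OF g])
  have Fd: "sqn lborel (\<lambda>\<omega>. fourier1 (g m) \<omega> - fourier1 (g n) \<omega>) = 2 * pi * sqn lborel (\<lambda>x. g m x - g n x)" for m n
    using Plancherel_Cc(2)[OF Cc_diff[OF g[of m] g[of n]]]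
    by (simp add: fourier1_diff[OF Cc_L1[OF g] Cc_L1[OF g]] sqn_def)
  have pw: "(\<lambda>n. fourier1 (g n) \<omega>) \<longlonglongrightarrow> fourier1 y \<omega>" for \<omega>
  proof (rule LIM_zero_cancel, rule tendsto_norm_zero_cancel, rule tendsto_sandwich[OF _ _ tendsto_const l0])
    have "cmod (fourier1 (g n) \<omega> - fourier1 y \<omega>) \<le> (LINT x|lborel. cmod (g n x - y x))" for n
      using fourier1_bound[of "\<lambda>x. g n x - y x" \<omega>] Cc_L1[OF g[of n]] L1 by (simp add: fourier1_diff)
    then show "\<forall>\<^sub>F n in sequentially. cmod (fourier1 (g n) \<omega> - fourier1 y \<omega>) \<le> 1 / real (Suc n)"
      using g1 by (intro always_eventually allI) (meson less_imp_le order_trans)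
  qed auto
  have C: "\<exists>N. \<forall>m\<ge>N. \<forall>n\<ge>N. sqn lborel (\<lambda>\<omega>. fourier1 (g m) \<omega> - fourier1 (g n) \<omega>) < e" if "e > 0" for e
    unfolding Fd using L2_tendsto_imp_Cauchy[OF Cc_L2[OF g] L2 s0, of "e / (2 * pi)"] that
    by (simp add: pos_less_divide_eq mult.commute)
  obtain F r where F: "F \<in> L2fun lborel" "(\<lambda>n. sqn lborel (\<lambda>\<omega>. fourier1 (g n) \<omega> - F \<omega>)) \<longlonglongrightarrow> 0"
    and r: "strict_mono r" "AE \<omega> in lborel. (\<lambda>n. fourier1 (g (r n)) \<omega>) \<longlonglongrightarrow> F \<omega>"
    using L2_complete[of "\<lambda>n. fourier1 (g n)" lborel, OF FL C] by blast
  have eq: "AE \<omega> in lborel. F \<omega> = fourier1 y \<omega>"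
    using r(2) by eventually_elim
      (use LIMSEQ_subseq_LIMSEQ[OF pw r(1)] in \<open>auto simp: o_def intro: LIMSEQ_unique\<close>)
  have my: "fourier1 y \<in> borel_measurable lborel"
    using fourier1_measurable[of y] L1 by auto
  show "fourier1 y \<in> L2fun lborel"
    by (rule L2fun_cong_AE[OF F(1) eq my])
  have "(\<lambda>n. sqn lborel (fourier1 (g n))) \<longlonglongrightarrow> sqn lborel F"
    by (rule sqn_tendsto[OF FL F])
  moreover have "(\<lambda>n. sqn lborel (fourier1 (g n))) \<longlonglongrightarrow> 2 * pi * sqn lborel y"
    unfolding Plancherel_Cc(2)[OF g] by (intro tendsto_intros sqn_tendsto[OF Cc_L2[OF g] L2 s0])
  ultimately have "sqn lborel F = 2 * pi * sqn lborel y" by (rule LIMSEQ_unique)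
  then show "sqn lborel (fourier1 y) = 2 * pi * sqn lborel y"
    using sqn_cong_AE[OF eq L2fun_measurable[OF F(1)] my] by simp
qed

section \<open>The Fourier transform on all of L2\<close>

definition trunc :: "real \<Rightarrow> (real \<Rightarrow> complex) \<Rightarrow> real \<Rightarrow> complex" where
  "trunc r x = (\<lambda>u. indicator {-r..r} u *\<^sub>R x u)"

lemma L2_space_UNIV: "L2_space UNIV = L2fun lborel"
  by (auto simp: L2_space_def L2fun_def set_borel_measurable_def set_integrable_def)

text \<open>Since values off X are irrelevant, elements of L2(X) are handled as their extensions by
  zero to the whole line.\<close>

lemma L2_space_iff: "x \<in> L2_space X \<longleftrightarrow> (\<lambda>u. indicator X u *\<^sub>R x u) \<in> L2fun lborel"
proof -
  have "(\<lambda>u. (cmod (indicator X u *\<^sub>R x u))\<^sup>2) = (\<lambda>u. indicator X u *\<^sub>R (cmod (x u))\<^sup>2)"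
    by (auto simp: indicator_def)
  then show ?thesis
    by (simp add: L2_space_def L2fun_def set_borel_measurable_def set_integrable_def)
qed

text \<open>Both sides choose from the same predicate; hence equality of functions and not merely
  almost everywhere.\<close>

lemma L2_fourier_set: "L2_fourier X x = L2_fourier UNIV (\<lambda>u. indicator X u *\<^sub>R x u)"
proof -
  have "(LINT u:X \<inter> {-r..r}|lborel. x u * cis (u * \<omega>))
     = (LINT u:UNIV \<inter> {-r..r}|lborel. (indicator X u *\<^sub>R x u) * cis (u * \<omega>))" for r \<omega> :: real
    unfolding set_lebesgue_integral_def
    by (intro Bochner_Integration.integral_cong) (auto simp: indicator_def)
  then show ?thesis
    unfolding L2_fourier_def has_L2_fourier_def by simp
qed

abbreviation (input) Ft :: "(real \<Rightarrow> complex) \<Rightarrow> real \<Rightarrow> complex" where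
  "Ft \<equiv> L2_fourier UNIV"

lemma trunc_L2:
  assumes "x \<in> L2fun lborel"
  shows "trunc r x \<in> L2fun lborel" "integrable lborel (trunc r x)"
proof -
  have m: "trunc r x \<in> borel_measurable lborel"
    using assms unfolding trunc_def by measurable
  show L: "trunc r x \<in> L2fun lborel"
    by (rule L2fun_bound[OF assms m]) (auto simp: trunc_def indicator_def)
  have i: "integrable lborel (indicator {-r..r} :: real \<Rightarrow> real)"
    by (rule integrable_real_indicator) (auto simp: emeasure_lborel_Icc_eq)
  have "(\<lambda>u. complex_of_real (indicator {-r..r} u)) \<in> L2fun lborel"
    using i by (auto simp: L2fun_def power2_eq_square simp flip: indicator_inter_arith)
  moreover have "(\<lambda>u. complex_of_real (indicator {-r..r} u) * trunc r x u) = trunc r x"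
    by (auto simp: trunc_def indicator_def)
  ultimately show "integrable lborel (trunc r x)"
    using L2fun_mult_integrable[OF _ L] by metis
qed

lemma trunc_tendsto:
  assumes "x \<in> L2fun lborel"
  shows "((\<lambda>r. sqn lborel (\<lambda>u. trunc r x u - x u)) \<longlongrightarrow> 0) at_top"
proof -
  have [measurable]: "x \<in> borel_measurable borel" using L2fun_measurable[OF assms] by simp
  have "((\<lambda>r. LINT u|lborel. (cmod (trunc r x u - x u))\<^sup>2) \<longlongrightarrow> (LINT u|(lborel :: real measure). (0 :: real))) at_top"
  proof (rule integral_dominated_convergence_at_top[OF _ _ L2fun_integrable[OF assms]])
    show "\<forall>\<^sub>F r in at_top. AE u in lborel. norm ((cmod (trunc r x u - x u))\<^sup>2) \<le> (cmod (x u))\<^sup>2"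
      by (auto simp: trunc_def indicator_def)
    show "AE u in lborel. ((\<lambda>r. (cmod (trunc r x u - x u))\<^sup>2) \<longlongrightarrow> 0) at_top"
    proof (rule AE_I2, rule tendsto_eventually)
      show "\<forall>\<^sub>F r in at_top. (cmod (trunc r x u - x u))\<^sup>2 = 0" for u
        using eventually_ge_at_top[of "\<bar>u\<bar>"]
        by eventually_elim (auto simp: trunc_def indicator_def)
    qed
    show "(\<lambda>u. (cmod (trunc r x u - x u))\<^sup>2) \<in> borel_measurable lborel" for r
      unfolding trunc_def by measurable
  qed simp
  then show ?thesis by (simp add: sqn_def)
qed

lemma trunc_tendsto_seq:
  "x \<in> L2fun lborel \<Longrightarrow> (\<lambda>n. sqn lborel (\<lambda>u. trunc (real n) x u - x u)) \<longlonglongrightarrow> 0"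
  by (rule filterlim_compose[OF trunc_tendsto filterlim_real_sequentially])

lemma has_L2_fourier_UNIV_iff:
  assumes "x \<in> L2fun lborel"
  shows "has_L2_fourier UNIV x F \<longleftrightarrow> F \<in> L2fun lborel \<and>
    ((\<lambda>r. sqn lborel (\<lambda>\<omega>. fourier1 (trunc r x) \<omega> - F \<omega>)) \<longlongrightarrow> 0) at_top"
proof -
  have e: "(LINT u:UNIV \<inter> {-r..r}|lborel. x u * cis (u * \<omega>)) = fourier1 (trunc r x) \<omega>" for r \<omega>
    by (simp add: set_lebesgue_integral_def fourier1_def trunc_def)
  have n: "(\<integral>\<^sup>+\<omega>. ennreal ((cmod (fourier1 (trunc r x) \<omega> - F \<omega>))\<^sup>2) \<partial>lborel)
      = ennreal (sqn lborel (\<lambda>\<omega>. fourier1 (trunc r x) \<omega> - F \<omega>))" if "F \<in> L2fun lborel" for r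
    by (rule nn_integral_cmod_sq, rule L2fun_diff[OF Plancherel_L1_L2(1) that]) (rule trunc_L2[OF assms])+
  have t: "((\<lambda>r. ennreal (sqn lborel (\<lambda>\<omega>. fourier1 (trunc r x) \<omega> - F \<omega>))) \<longlongrightarrow> 0) at_top \<longleftrightarrow>
     ((\<lambda>r. sqn lborel (\<lambda>\<omega>. fourier1 (trunc r x) \<omega> - F \<omega>)) \<longlongrightarrow> 0) at_top"
    using tendsto_ennreal_iff[of "\<lambda>r. sqn lborel (\<lambda>\<omega>. fourier1 (trunc r x) \<omega> - F \<omega>)" at_top 0] by simp
  show ?thesis
    unfolding has_L2_fourier_def L2_space_UNIV e using n t by auto
qed

text \<open>A limit along the integers already fixes the distance of F to the transform of any y in
  L1 and L2. With \<open>trunc r x\<close> for y, this carries the convergence from integers to real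
  r, as \<open>has_L2_fourier\<close> demands.\<close>

lemma L2_limit_fourier1_diff:
  assumes x: "x \<in> L2fun lborel" and F: "F \<in> L2fun lborel"
    and lim: "(\<lambda>n. sqn lborel (\<lambda>\<omega>. fourier1 (trunc (real n) x) \<omega> - F \<omega>)) \<longlonglongrightarrow> 0"
    and y: "y \<in> L2fun lborel" "integrable lborel y"
  shows "sqn lborel (\<lambda>\<omega>. fourier1 y \<omega> - F \<omega>) = 2 * pi * sqn lborel (\<lambda>u. y u - x u)"
proof (rule LIMSEQ_unique)
  let ?x = "\<lambda>n. trunc (real n) x"
  note xi = trunc_L2[OF x]
  show "(\<lambda>n. sqn lborel (\<lambda>\<omega>. fourier1 y \<omega> - fourier1 (?x n) \<omega>)) \<longlonglongrightarrow> sqn lborel (\<lambda>\<omega>. fourier1 y \<omega> - F \<omega>)"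
    by (rule sqn_tendsto)
       (use lim xi y F in \<open>auto intro!: L2fun_intros Plancherel_L1_L2(1) simp: sqn_minus_commute[of lborel F]\<close>)
  have "(\<lambda>n. sqn lborel (\<lambda>u. y u - ?x n u)) \<longlonglongrightarrow> sqn lborel (\<lambda>u. y u - x u)"
    by (rule sqn_tendsto)
       (use trunc_tendsto_seq[OF x] xi y x in \<open>auto intro!: L2fun_intros simp: sqn_minus_commute[of lborel x]\<close>)
  moreover have "sqn lborel (\<lambda>\<omega>. fourier1 y \<omega> - fourier1 (?x n) \<omega>) = 2 * pi * sqn lborel (\<lambda>u. y u - ?x n u)" for n
    using Plancherel_L1_L2(2)[of "\<lambda>u. y u - ?x n u"] y xi by (simp add: L2fun_diff fourier1_diff_fun)
  ultimately show "(\<lambda>n. sqn lborel (\<lambda>\<omega>. fourier1 y \<omega> - fourier1 (?x n) \<omega>)) \<longlonglongrightarrow> 2 * pi * sqn lborel (\<lambda>u. y u - x u)"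
    by (simp add: tendsto_mult_left)
qed

lemma has_L2_fourier_exists:
  assumes x: "x \<in> L2fun lborel"
  shows "\<exists>F. has_L2_fourier UNIV x F"
proof -
  let ?x = "\<lambda>n. trunc (real n) x"
  note xi = trunc_L2[OF x]
  have FL: "fourier1 (?x n) \<in> L2fun lborel" for n
    by (rule Plancherel_L1_L2(1)[OF xi])
  have Fd: "sqn lborel (\<lambda>\<omega>. fourier1 (?x m) \<omega> - fourier1 (?x n) \<omega>) = 2 * pi * sqn lborel (\<lambda>u. ?x m u - ?x n u)" for m n
    using Plancherel_L1_L2(2)[of "\<lambda>u. ?x m u - ?x n u"] xi by (simp add: L2fun_diff fourier1_diff_fun)
  have C: "\<exists>N. \<forall>m\<ge>N. \<forall>n\<ge>N. sqn lborel (\<lambda>\<omega>. fourier1 (?x m) \<omega> - fourier1 (?x n) \<omega>) < e" if "e > 0" for e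
    unfolding Fd using L2_tendsto_imp_Cauchy[OF xi(1) x trunc_tendsto_seq[OF x], of "e / (2 * pi)"] that
    by (simp add: pos_less_divide_eq mult.commute)
  obtain F where F: "F \<in> L2fun lborel" "(\<lambda>n. sqn lborel (\<lambda>\<omega>. fourier1 (?x n) \<omega> - F \<omega>)) \<longlonglongrightarrow> 0"
    using L2_complete[of "\<lambda>n. fourier1 (?x n)" lborel, OF FL C] by blast
  have "((\<lambda>r. 2 * pi * sqn lborel (\<lambda>u. trunc r x u - x u)) \<longlongrightarrow> 2 * pi * 0) at_top"
    by (intro tendsto_intros trunc_tendsto x)
  then have "((\<lambda>r. sqn lborel (\<lambda>\<omega>. fourier1 (trunc r x) \<omega> - F \<omega>)) \<longlongrightarrow> 0) at_top"
    by (simp add: L2_limit_fourier1_diff[OF x F xi])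
  then show ?thesis
    using has_L2_fourier_UNIV_iff[OF x] F(1) by blast
qed

lemma has_L2_fourier_Ft:
  "x \<in> L2fun lborel \<Longrightarrow> has_L2_fourier UNIV x (Ft x)"
  unfolding L2_fourier_def by (rule someI_ex[OF has_L2_fourier_exists])

lemma Ft_L2: "x \<in> L2fun lborel \<Longrightarrow> Ft x \<in> L2fun lborel"
  using has_L2_fourier_Ft has_L2_fourier_UNIV_iff by blast

lemma Ft_measurable: "x \<in> L2fun lborel \<Longrightarrow> Ft x \<in> borel_measurable borel"
  using L2fun_measurable[OF Ft_L2] by simp

lemma sqn_fourier1_Ft_diff:
  assumes "x \<in> L2fun lborel" "y \<in> L2fun lborel" "integrable lborel y"
  shows "sqn lborel (\<lambda>\<omega>. fourier1 y \<omega> - Ft x \<omega>) = 2 * pi * sqn lborel (\<lambda>u. y u - x u)"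
proof -
  have "((\<lambda>r. sqn lborel (\<lambda>\<omega>. fourier1 (trunc r x) \<omega> - Ft x \<omega>)) \<longlongrightarrow> 0) at_top"
    using has_L2_fourier_Ft[OF assms(1)] has_L2_fourier_UNIV_iff[OF assms(1)] by blast
  from filterlim_compose[OF this filterlim_real_sequentially] show ?thesis
    by (intro L2_limit_fourier1_diff Ft_L2 assms)
qed

lemma Ft_eq_fourier1:
  assumes "y \<in> L2fun lborel" "integrable lborel y"
  shows "AE \<omega> in lborel. Ft y \<omega> = fourier1 y \<omega>"
proof -
  have "AE \<omega> in lborel. fourier1 y \<omega> - Ft y \<omega> = 0"
    using sqn_fourier1_Ft_diff[OF assms(1) assms]
    by (intro sqn_eq_0D L2fun_diff Plancherel_L1_L2 Ft_L2 assms) (simp add: sqn_def)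
  then show ?thesis by eventually_elim simp
qed

lemma fourier1_trunc_tendsto:
  assumes x: "x \<in> L2fun lborel"
  shows "(\<lambda>n. sqn lborel (\<lambda>\<omega>. fourier1 (trunc (real n) x) \<omega> - Ft x \<omega>)) \<longlonglongrightarrow> 0"
proof -
  have "(\<lambda>n. 2 * pi * sqn lborel (\<lambda>u. trunc (real n) x u - x u)) \<longlonglongrightarrow> 2 * pi * 0"
    by (intro tendsto_intros trunc_tendsto_seq x)
  then show ?thesis by (simp add: sqn_fourier1_Ft_diff[OF x trunc_L2[OF x]])
qed

lemma sqn_Ft_diff:
  assumes x: "x \<in> L2fun lborel" and y: "y \<in> L2fun lborel"
  shows "sqn lborel (\<lambda>\<omega>. Ft x \<omega> - Ft y \<omega>) = 2 * pi * sqn lborel (\<lambda>u. x u - y u)"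
proof (rule LIMSEQ_unique)
  let ?x = "\<lambda>n. trunc (real n) x"
  note xi = trunc_L2[OF x]
  show "(\<lambda>n. sqn lborel (\<lambda>\<omega>. fourier1 (?x n) \<omega> - Ft y \<omega>)) \<longlonglongrightarrow> sqn lborel (\<lambda>\<omega>. Ft x \<omega> - Ft y \<omega>)"
    by (rule sqn_tendsto)
       (use fourier1_trunc_tendsto[OF x] xi x y in \<open>auto intro!: L2fun_intros Plancherel_L1_L2(1) Ft_L2\<close>)
  have "(\<lambda>n. sqn lborel (\<lambda>u. ?x n u - y u)) \<longlonglongrightarrow> sqn lborel (\<lambda>u. x u - y u)"
    by (rule sqn_tendsto)
       (use trunc_tendsto_seq[OF x] xi y x in \<open>auto intro!: L2fun_intros\<close>)
  then show "(\<lambda>n. sqn lborel (\<lambda>\<omega>. fourier1 (?x n) \<omega> - Ft y \<omega>)) \<longlonglongrightarrow> 2 * pi * sqn lborel (\<lambda>u. x u - y u)"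
    by (simp add: sqn_fourier1_Ft_diff[OF y xi] tendsto_mult_left)
qed

lemma sqn_Ft:
  assumes x: "x \<in> L2fun lborel"
  shows "sqn lborel (Ft x) = 2 * pi * sqn lborel x"
proof -
  have 0: "(\<lambda>n. sqn lborel (fourier1 (trunc (real n) x))) \<longlonglongrightarrow> sqn lborel (Ft x)"
    by (rule sqn_tendsto[OF Plancherel_L1_L2(1)[OF trunc_L2[OF x]] Ft_L2[OF x] fourier1_trunc_tendsto[OF x]])
  have "(\<lambda>n. sqn lborel (trunc (real n) x)) \<longlonglongrightarrow> sqn lborel x"
    by (rule sqn_tendsto[OF trunc_L2(1)[OF x] x trunc_tendsto_seq[OF x]])
  then have "(\<lambda>n. sqn lborel (fourier1 (trunc (real n) x))) \<longlonglongrightarrow> 2 * pi * sqn lborel x"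
    by (simp add: Plancherel_L1_L2(2)[OF trunc_L2[OF x]] tendsto_mult_left)
  with 0 show ?thesis by (rule LIMSEQ_unique)
qed

lemma Ft_cmult:
  assumes x: "x \<in> L2fun lborel"
  shows "AE \<omega> in lborel. Ft (\<lambda>u. c * x u) \<omega> = c * Ft x \<omega>"
proof (rule L2_limit_unique[OF _ _ _ _ fourier1_trunc_tendsto])
  let ?z = "\<lambda>u. c * x u"
  show z: "?z \<in> L2fun lborel" using x by (rule L2fun_cmult)
  show "fourier1 (trunc (real n) ?z) \<in> L2fun lborel" for n
    by (rule Plancherel_L1_L2(1)[OF trunc_L2[OF z]])
  have tr: "trunc (real n) ?z = (\<lambda>u. c * trunc (real n) x u)" for n
    by (auto simp: trunc_def algebra_simps)
  have "(\<lambda>n. (cmod c)\<^sup>2 * sqn lborel (\<lambda>\<omega>. fourier1 (trunc (real n) x) \<omega> - Ft x \<omega>)) \<longlonglongrightarrow> (cmod c)\<^sup>2 * 0"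
    by (intro tendsto_intros fourier1_trunc_tendsto x)
  then show "(\<lambda>n. sqn lborel (\<lambda>\<omega>. fourier1 (trunc (real n) ?z) \<omega> - c * Ft x \<omega>)) \<longlonglongrightarrow> 0"
    unfolding tr fourier1_cmult by (simp add: right_diff_distrib[symmetric] sqn_cmult del: right_diff_distrib)
qed (use x in \<open>auto intro: L2fun_intros Ft_L2\<close>)

text \<open>The formula for integrable functions is extended one factor at a time, as the pairing is
  continuous in each: first x is truncated, then y.\<close>

lemma Ft_multiplication:
  assumes x: "x \<in> L2fun lborel" and y: "y \<in> L2fun lborel"
  shows "(LINT \<omega>|lborel. Ft x \<omega> * y \<omega>) = (LINT u|lborel. x u * Ft y u)"
proof -
  note xi = trunc_L2[OF x] and yi = trunc_L2[OF y]
  have 1: "(LINT \<omega>|lborel. Ft x \<omega> * z \<omega>) = (LINT u|lborel. x u * fourier1 z u)"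
    if z: "z \<in> L2fun lborel" "integrable lborel z" for z
  proof (rule LIMSEQ_unique)
    show "(\<lambda>n. LINT \<omega>|lborel. fourier1 (trunc (real n) x) \<omega> * z \<omega>) \<longlonglongrightarrow> (LINT \<omega>|lborel. Ft x \<omega> * z \<omega>)"
      by (rule L2_tendsto_integral_mult[OF Plancherel_L1_L2(1)[OF xi] Ft_L2[OF x] z(1) fourier1_trunc_tendsto[OF x]])
    show "(\<lambda>n. LINT \<omega>|lborel. fourier1 (trunc (real n) x) \<omega> * z \<omega>) \<longlonglongrightarrow> (LINT u|lborel. x u * fourier1 z u)"
      unfolding fourier1_multiplication[OF xi(2) z(2)]
      by (rule L2_tendsto_integral_mult[OF xi(1) x Plancherel_L1_L2(1)[OF z] trunc_tendsto_seq[OF x]])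
  qed
  show ?thesis
  proof (rule LIMSEQ_unique)
    show "(\<lambda>n. LINT \<omega>|lborel. trunc (real n) y \<omega> * Ft x \<omega>) \<longlonglongrightarrow> (LINT \<omega>|lborel. Ft x \<omega> * y \<omega>)"
      using L2_tendsto_integral_mult[OF yi(1) y Ft_L2[OF x] trunc_tendsto_seq[OF y]] by (simp add: mult.commute)
    have "(\<lambda>n. LINT u|lborel. fourier1 (trunc (real n) y) u * x u) \<longlonglongrightarrow> (LINT u|lborel. Ft y u * x u)"
      by (rule L2_tendsto_integral_mult[OF Plancherel_L1_L2(1)[OF yi] Ft_L2[OF y] x fourier1_trunc_tendsto[OF y]])
    then show "(\<lambda>n. LINT \<omega>|lborel. trunc (real n) y \<omega> * Ft x \<omega>) \<longlonglongrightarrow> (LINT u|lborel. x u * Ft y u)"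
      using 1[OF yi] by (simp add: mult.commute)
  qed
qed

text \<open>Polarisation. Plancherel's identity for x - c y shows that both sides agree in real part
  after multiplication by cnj c; c = 1 and c = \<i> give the real and the imaginary part.\<close>

lemma Parseval:
  assumes x: "x \<in> L2fun lborel" and y: "y \<in> L2fun lborel"
  shows "(LINT \<omega>|lborel. Ft x \<omega> * cnj (Ft y \<omega>)) = 2 * pi * (LINT u|lborel. x u * cnj (y u))"
proof -
  let ?a = "LINT \<omega>|lborel. Ft x \<omega> * cnj (Ft y \<omega>)" and ?b = "LINT u|lborel. x u * cnj (y u)"
  have "Re (cnj c * ?a) = Re (cnj c * (2 * pi * ?b))" for c
  proof -
    have yc: "(\<lambda>u. c * y u) \<in> L2fun lborel" by (rule L2fun_cmult[OF y])
    have "2 * pi * (sqn lborel x - 2 * Re (LINT u|lborel. x u * cnj (c * y u)) + sqn lborel (\<lambda>u. c * y u))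
        = sqn lborel (Ft x) - 2 * Re (LINT \<omega>|lborel. Ft x \<omega> * cnj (Ft (\<lambda>u. c * y u) \<omega>)) + sqn lborel (Ft (\<lambda>u. c * y u))"
      using sqn_Ft_diff[OF x yc] sqn_diff_expand[OF x yc] sqn_diff_expand[OF Ft_L2[OF x] Ft_L2[OF yc]] by simp
    then have "Re (LINT \<omega>|lborel. Ft x \<omega> * cnj (Ft (\<lambda>u. c * y u) \<omega>)) = 2 * pi * Re (LINT u|lborel. x u * cnj (c * y u))"
      unfolding sqn_Ft[OF x] sqn_Ft[OF yc] by (simp add: algebra_simps)
    also have "(LINT \<omega>|lborel. Ft x \<omega> * cnj (Ft (\<lambda>u. c * y u) \<omega>)) = (LINT \<omega>|lborel. cnj c * (Ft x \<omega> * cnj (Ft y \<omega>)))"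
    proof (rule integral_cong_AE)
      show "AE \<omega> in lborel. Ft x \<omega> * cnj (Ft (\<lambda>u. c * y u) \<omega>) = cnj c * (Ft x \<omega> * cnj (Ft y \<omega>))"
        using Ft_cmult[OF y, of c] by eventually_elim simp
    qed (use Ft_L2[OF x] Ft_L2[OF y] Ft_L2[OF yc] in measurable)
    also have "(LINT u|lborel. x u * cnj (c * y u)) = (LINT u|lborel. cnj c * (x u * cnj (y u)))"
      by (simp add: mult_ac)
    finally show ?thesis by (simp add: algebra_simps)
  qed
  from this[of 1] this[of \<i>] show ?thesis by (simp add: complex_eq_iff)
qed

text \<open>By the multiplication formula and Parseval's identity, the difference of the two sides
  pairs to 0 with every element of L2, in particular with its own conjugate, so its norm is
  0.\<close>

lemma Ft_inversion:
  assumes k: "k \<in> L2fun lborel"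
  shows "AE u in lborel. Ft (\<lambda>\<omega>. cnj (Ft k \<omega>)) u = 2 * pi * cnj (k u)"
proof -
  let ?z = "\<lambda>\<omega>. cnj (Ft k \<omega>)"
  have z: "?z \<in> L2fun lborel" by (intro L2fun_cnj Ft_L2 k)
  define d where "d u = Ft ?z u - 2 * pi * cnj (k u)" for u
  have d: "d \<in> L2fun lborel"
    unfolding d_def[abs_def] by (intro L2fun_intros Ft_L2 z k)
  have e: "(LINT u|lborel. x u * d u) = 0" if x: "x \<in> L2fun lborel" for x
  proof -
    have i1: "integrable lborel (\<lambda>u. x u * Ft ?z u)"
      by (rule L2fun_mult_integrable[OF x Ft_L2[OF z]])
    have i2: "integrable lborel (\<lambda>u. x u * cnj (k u))"
      by (rule L2fun_mult_integrable[OF x L2fun_cnj[OF k]])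
    have "(LINT u|lborel. x u * d u) = (LINT u|lborel. x u * Ft ?z u - 2 * pi * (x u * cnj (k u)))"
      by (simp add: d_def algebra_simps)
    also have "\<dots> = (LINT u|lborel. x u * Ft ?z u) - 2 * pi * (LINT u|lborel. x u * cnj (k u))"
      using i1 i2 by simp
    finally show ?thesis
      using Ft_multiplication[OF x z] Parseval[OF x k] by simp
  qed
  have "complex_of_real (sqn lborel d) = (LINT u|lborel. cnj (d u) * d u)"
    unfolding sqn_def integral_complex_of_real[symmetric] complex_norm_square by (simp add: mult.commute)
  also have "\<dots> = 0" by (rule e[OF L2fun_cnj[OF d]])
  finally have "AE u in lborel. d u = 0"
    by (intro sqn_eq_0D d) simp
  then show ?thesis by (auto simp: d_def)
qed

section \<open>Reflection and conjugation\<close>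

lemma integral_reflect_lborel:
  fixes f :: "real \<Rightarrow> 'b :: {banach, second_countable_topology}"
  shows "(LINT u|lborel. f (- u)) = (LINT u|lborel. f u)"
  using lborel_integral_real_affine[of "-1" f 0] by simp

lemma AE_reflect_lborel:
  fixes P :: "real \<Rightarrow> bool"
  assumes "AE u in lborel. P u"
  shows "AE u in lborel. P (- u)"
proof -
  have "AE u in distr lborel borel uminus. P u"
    unfolding lborel_distr_uminus by (rule assms)
  then show ?thesis
    by (rule AE_distrD[rotated]) simp
qed

lemma L2fun_reflect:
  fixes x :: "real \<Rightarrow> complex"
  assumes "x \<in> L2fun lborel"
  shows "(\<lambda>u. x (- u)) \<in> L2fun lborel"
proof -
  have [measurable]: "x \<in> borel_measurable borel" using L2fun_measurable[OF assms] by simp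
  show ?thesis
    using lborel_integrable_real_affine[OF L2fun_integrable[OF assms], of "-1" 0]
    by (simp add: L2fun_def)
qed

text \<open>Turns the conjugated transform that occurs in the weak equation for \<open>B_op\<close>
  into a transform again, to which the multiplication formula applies.\<close>

lemma Ft_cnj_reflect:
  assumes k: "k \<in> L2fun lborel"
  shows "AE \<omega> in lborel. Ft (\<lambda>u. cnj (k (- u))) \<omega> = cnj (Ft k \<omega>)"
proof (rule L2_limit_unique[OF _ _ _ _ fourier1_trunc_tendsto])
  let ?z = "\<lambda>u. cnj (k (- u))"
  show z: "?z \<in> L2fun lborel" by (intro L2fun_cnj L2fun_reflect k)
  show "fourier1 (trunc (real n) ?z) \<in> L2fun lborel" for n
    by (rule Plancherel_L1_L2(1)[OF trunc_L2[OF z]])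
  have "fourier1 (trunc (real n) ?z) \<omega> = cnj (fourier1 (trunc (real n) k) \<omega>)" for n \<omega>
  proof -
    have "fourier1 (trunc (real n) ?z) \<omega> = (LINT u|lborel. cnj (trunc (real n) k (- u) * cis (- u * \<omega>)))"
      unfolding fourier1_def by (intro Bochner_Integration.integral_cong) (auto simp: trunc_def cis_cnj indicator_def)
    also have "\<dots> = cnj (fourier1 (trunc (real n) k) \<omega>)"
      unfolding Bochner_Integration.integral_cnj fourier1_def
      by (subst integral_reflect_lborel[of "\<lambda>u. trunc (real n) k u * cis (u * \<omega>)"]) simp
    finally show ?thesis .
  qed
  then show "(\<lambda>n. sqn lborel (\<lambda>\<omega>. fourier1 (trunc (real n) ?z) \<omega> - cnj (Ft k \<omega>))) \<longlonglongrightarrow> 0"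
    using fourier1_trunc_tendsto[OF k] by (simp add: sqn_def flip: complex_cnj_diff)
qed (intro Ft_L2 L2fun_cnj L2fun_reflect k | simp)+

section \<open>Exponential sums in weighted spaces\<close>

text \<open>With f + g for w, the integrals in \<open>L2s\<close> become norms of a finite measure,
  to which the general results on \<open>L2fun\<close> apply.\<close>

definition weighted :: "(real \<Rightarrow> real) \<Rightarrow> real measure" where
  "weighted w = density lborel (\<lambda>\<omega>. ennreal (w \<omega>))"

lemma weighted_measurable [simp]: "h \<in> borel_measurable (weighted w) \<longleftrightarrow> h \<in> borel_measurable borel"
  unfolding weighted_def by simp

lemma
  assumes w: "\<And>\<omega>. 0 \<le> w \<omega>" "w \<in> borel_measurable borel"
  shows L2fun_weighted: "h \<in> L2fun (weighted w) \<longleftrightarrow>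
      h \<in> borel_measurable borel \<and> integrable lborel (\<lambda>\<omega>. (cmod (h \<omega>))\<^sup>2 * w \<omega>)"
    and sqn_weighted: "h \<in> borel_measurable borel \<Longrightarrow> sqn (weighted w) h = (LINT \<omega>|lborel. (cmod (h \<omega>))\<^sup>2 * w \<omega>)"
proof -
  have "integrable (weighted w) (\<lambda>\<omega>. (cmod (h \<omega>))\<^sup>2) \<longleftrightarrow> integrable lborel (\<lambda>\<omega>. (cmod (h \<omega>))\<^sup>2 * w \<omega>)"
    if "h \<in> borel_measurable borel" for h
    unfolding weighted_def by (subst integrable_density) (use w that in \<open>auto simp: mult.commute\<close>)
  then show "h \<in> L2fun (weighted w) \<longleftrightarrow>
      h \<in> borel_measurable borel \<and> integrable lborel (\<lambda>\<omega>. (cmod (h \<omega>))\<^sup>2 * w \<omega>)"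
    by (auto simp: L2fun_def)
  show "sqn (weighted w) h = (LINT \<omega>|lborel. (cmod (h \<omega>))\<^sup>2 * w \<omega>)" if "h \<in> borel_measurable borel"
    unfolding weighted_def sqn_def by (subst integral_density) (use w that in \<open>auto simp: mult.commute\<close>)
qed

lemma AE_weighted:
  assumes w: "w \<in> borel_measurable borel" and "AE \<omega> in lborel. P \<omega>"
  shows "AE \<omega> in weighted w. P \<omega>"
  unfolding weighted_def using assms by (subst AE_density) auto

lemma L2fun_weighted_bounded:
  assumes w: "\<And>\<omega>. 0 \<le> w \<omega>" "integrable lborel w"
    and h: "h \<in> borel_measurable borel" "AE \<omega> in lborel. cmod (h \<omega>) \<le> b"
  shows "h \<in> L2fun (weighted w)"
proof -
  have [measurable]: "w \<in> borel_measurable borel" using w by auto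
  have "integrable lborel (\<lambda>\<omega>. (cmod (h \<omega>))\<^sup>2 * w \<omega>)"
  proof (rule Bochner_Integration.integrable_bound[OF integrable_mult_right[OF w(2), of "b\<^sup>2"]])
    show "AE \<omega> in lborel. norm ((cmod (h \<omega>))\<^sup>2 * w \<omega>) \<le> norm (b\<^sup>2 * w \<omega>)"
      using h(2) by eventually_elim (use w in \<open>auto simp: abs_mult intro!: mult_right_mono power_mono\<close>)
  qed (use h in simp)
  then show ?thesis using w h by (subst L2fun_weighted) auto
qed

definition trig_sum :: "real set \<Rightarrow> (real \<Rightarrow> complex) \<Rightarrow> real \<Rightarrow> complex" where
  "trig_sum F c \<omega> = (\<Sum>t\<in>F. c t * cis (t * \<omega>))"

lemma trig_sum_measurable [measurable]: "trig_sum F c \<in> borel_measurable borel"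
  unfolding trig_sum_def[abs_def] by measurable

lemma trig_sum_bound: "cmod (trig_sum F c \<omega>) \<le> (\<Sum>t\<in>F. cmod (c t))"
  unfolding trig_sum_def by (rule order_trans[OF norm_sum]) (simp add: norm_mult)

lemma trig_sum_L2fun:
  assumes "\<And>\<omega>. 0 \<le> w \<omega>" "integrable lborel w"
  shows "trig_sum F c \<in> L2fun (weighted w)"
  by (rule L2fun_weighted_bounded[OF assms]) (auto intro: trig_sum_bound)

lemma trig_sum_midpoint:
  assumes "finite F" "finite F'"
  shows "(trig_sum F c \<omega> + trig_sum F' c' \<omega>) / 2
     = trig_sum (F \<union> F') (\<lambda>t. ((if t \<in> F then c t else 0) + (if t \<in> F' then c' t else 0)) / 2) \<omega>"
proof -
  have 1: "trig_sum F c \<omega> = (\<Sum>t\<in>F \<union> F'. (if t \<in> F then c t else 0) * cis (t * \<omega>))"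
    unfolding trig_sum_def by (rule sum.mono_neutral_cong_left) (use assms in auto)
  have 2: "trig_sum F' c' \<omega> = (\<Sum>t\<in>F \<union> F'. (if t \<in> F' then c' t else 0) * cis (t * \<omega>))"
    unfolding trig_sum_def by (rule sum.mono_neutral_cong_left) (use assms in auto)
  show ?thesis
    unfolding 1 2 unfolding trig_sum_def sum.distrib[symmetric] sum_divide_distrib
    by (intro sum.cong refl) (simp add: field_simps)
qed

definition trig_span :: "real set \<Rightarrow> real measure \<Rightarrow> (real \<Rightarrow> complex) set" where
  "trig_span U M = {h \<in> L2fun M. \<forall>e>0. \<exists>F c. finite F \<and> F \<subseteq> U \<and> sqn M (\<lambda>\<omega>. h \<omega> - trig_sum F c \<omega>) < e}"

lemma trig_span_approx:
  "h \<in> trig_span U M \<Longrightarrow> e > 0 \<Longrightarrow>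
    \<exists>F c. finite F \<and> F \<subseteq> U \<and> sqn M (\<lambda>\<omega>. h \<omega> - trig_sum F c \<omega>) < e"
  by (simp add: trig_span_def)

text \<open>As T contains the nonnegative half-line and S, the observed times are precisely the
  complement of T.\<close>

lemma L2s_eq_trig_span:
  assumes "spectral_density f" "spectral_density g"
  shows "L2s s N K f g = trig_span (- T_set s N K) (weighted (\<lambda>\<omega>. f \<omega> + g \<omega>))"
proof -
  have w: "\<And>\<omega>. 0 \<le> f \<omega> + g \<omega>" "(\<lambda>\<omega>. f \<omega> + g \<omega>) \<in> borel_measurable borel"
    using assms by (auto simp: spectral_density_def)
  have U: "{..<0} - S_set s N K = - T_set s N K"
    by (auto simp: T_set_def)
  have "sqn (weighted (\<lambda>\<omega>. f \<omega> + g \<omega>)) (\<lambda>\<omega>. h \<omega> - trig_sum F c \<omega>)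
      = (LINT \<omega>|lborel. (cmod (h \<omega> - (\<Sum>t\<in>F. c t * cis (t * \<omega>))))\<^sup>2 * (f \<omega> + g \<omega>))"
    if [measurable]: "h \<in> borel_measurable borel" for h F c
    by (subst sqn_weighted[OF w]) (auto simp: trig_sum_def)
  then show ?thesis
    unfolding L2s_def trig_span_def U by (auto simp: L2fun_weighted[OF w])
qed

lemma trig_span_mid:
  assumes w: "\<And>\<omega>. 0 \<le> w \<omega>" "integrable lborel w"
    and f: "f \<in> trig_span U (weighted w)" and g: "g \<in> trig_span U (weighted w)"
  shows "(\<lambda>\<omega>. (f \<omega> + g \<omega>) / 2) \<in> trig_span U (weighted w)"
proof -
  have fL: "f \<in> L2fun (weighted w)" and gL: "g \<in> L2fun (weighted w)"
    using f g by (auto simp: trig_span_def)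
  have hL: "(\<lambda>\<omega>. (f \<omega> + g \<omega>) / 2) \<in> L2fun (weighted w)"
    using L2fun_cmult[OF L2fun_add[OF fL gL], of "1/2"] by simp
  have "\<exists>F c. finite F \<and> F \<subseteq> U \<and> sqn (weighted w) (\<lambda>\<omega>. (f \<omega> + g \<omega>) / 2 - trig_sum F c \<omega>) < e" if e: "e > 0" for e
  proof -
    obtain F c where F: "finite F" "F \<subseteq> U" "sqn (weighted w) (\<lambda>\<omega>. f \<omega> - trig_sum F c \<omega>) < e"
      using trig_span_approx[OF f e] by blast
    obtain F' c' where F': "finite F'" "F' \<subseteq> U" "sqn (weighted w) (\<lambda>\<omega>. g \<omega> - trig_sum F' c' \<omega>) < e"
      using trig_span_approx[OF g e] by blast
    define c'' where "c'' t = ((if t \<in> F then c t else 0) + (if t \<in> F' then c' t else 0)) / 2" for t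
    have "sqn (weighted w) (\<lambda>\<omega>. (f \<omega> + g \<omega>) / 2 - trig_sum (F \<union> F') c'' \<omega>)
       = sqn (weighted w) (\<lambda>\<omega>. 1/2 * ((f \<omega> - trig_sum F c \<omega>) + (g \<omega> - trig_sum F' c' \<omega>)))"
      unfolding c''_def[abs_def] trig_sum_midpoint[OF F(1) F'(1), symmetric]
      by (intro arg_cong[where f = "sqn _"] ext) (simp add: diff_divide_distrib add_divide_distrib)
    also have "\<dots> = 1/4 * sqn (weighted w) (\<lambda>\<omega>. (f \<omega> - trig_sum F c \<omega>) + (g \<omega> - trig_sum F' c' \<omega>))"
      unfolding sqn_cmult by (simp add: power2_eq_square)
    also have "\<dots> \<le> 1/4 * (2 * sqn (weighted w) (\<lambda>\<omega>. f \<omega> - trig_sum F c \<omega>) + 2 * sqn (weighted w) (\<lambda>\<omega>. g \<omega> - trig_sum F' c' \<omega>))"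
      by (intro mult_left_mono sqn_add_le L2fun_diff fL gL trig_sum_L2fun w) simp
    also have "\<dots> < e" using F(3) F'(3) by simp
    finally show ?thesis
      using F F' by (intro exI[of _ "F \<union> F'"] exI[of _ c'']) auto
  qed
  with hL show ?thesis by (simp add: trig_span_def)
qed

lemma trig_span_closed:
  assumes w: "\<And>\<omega>. 0 \<le> w \<omega>" "integrable lborel w"
    and f: "\<And>n. f n \<in> trig_span U (weighted w)" and g: "g \<in> L2fun (weighted w)"
    and lim: "(\<lambda>n. sqn (weighted w) (\<lambda>\<omega>. f n \<omega> - g \<omega>)) \<longlonglongrightarrow> 0"
  shows "g \<in> trig_span U (weighted w)"
  unfolding trig_span_def
proof (safe intro!: g)
  fix e :: real assume "e > 0"
  then have p: "e / 4 > 0" by simp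
  obtain n where n: "sqn (weighted w) (\<lambda>\<omega>. f n \<omega> - g \<omega>) < e / 4"
    using order_tendstoD(2)[OF lim p] eventually_happens'[OF sequentially_bot] by blast
  obtain F c where F: "finite F" "F \<subseteq> U" "sqn (weighted w) (\<lambda>\<omega>. f n \<omega> - trig_sum F c \<omega>) < e / 4"
    using trig_span_approx[OF f p] by blast
  have "sqn (weighted w) (\<lambda>\<omega>. g \<omega> - trig_sum F c \<omega>) < e"
    using sqn_diff_triangle[OF g _ trig_sum_L2fun[OF w], of "f n" F c] f[of n] F(3) n
    by (simp add: trig_span_def sqn_minus_commute[of _ g])
  with F show "\<exists>F c. finite F \<and> F \<subseteq> U \<and> sqn (weighted w) (\<lambda>\<omega>. g \<omega> - trig_sum F c \<omega>) < e" by blast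
qed

lemma trig_sum_in_span:
  assumes w: "\<And>\<omega>. 0 \<le> w \<omega>" "integrable lborel w" and F: "finite F" "F \<subseteq> U"
  shows "trig_sum F c \<in> trig_span U (weighted w)"
  unfolding trig_span_def
proof (safe intro!: trig_sum_L2fun w)
  fix e :: real assume "e > 0"
  then show "\<exists>F' c'. finite F' \<and> F' \<subseteq> U \<and> sqn (weighted w) (\<lambda>\<omega>. trig_sum F c \<omega> - trig_sum F' c' \<omega>) < e"
    by (intro exI[of _ F] exI[of _ c]) (simp add: sqn_def F)
qed

lemma trig_span_projection:
  assumes w: "\<And>\<omega>. 0 \<le> w \<omega>" "integrable lborel w" and p: "p \<in> L2fun (weighted w)"
  obtains h where "h \<in> trig_span U (weighted w)"
    "\<And>k. k \<in> trig_span U (weighted w) \<Longrightarrow> sqn (weighted w) (\<lambda>\<omega>. h \<omega> - p \<omega>) \<le> sqn (weighted w) (\<lambda>\<omega>. k \<omega> - p \<omega>)"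
proof (rule L2_projection_exists[OF _ _ trig_span_mid[OF w] trig_span_closed[OF w] p])
  show "trig_span U (weighted w) \<subseteq> L2fun (weighted w)" by (auto simp: trig_span_def)
  show "trig_span U (weighted w) \<noteq> {}" using trig_sum_in_span[OF w, of "{}" U] by blast
qed (use that in auto)

text \<open>Riemann sums of the Fourier integral, with all tags taken in the set carrying \<open>G\<close>.\<close>

lemma fourier1_in_trig_span:
  assumes G: "integrable lborel G" "\<And>t. t \<notin> U \<Longrightarrow> G t = 0"
    and w: "\<And>\<omega>. 0 \<le> w \<omega>" "integrable lborel w"
  shows "fourier1 G \<in> trig_span U (weighted w)"
proof -
  have Gm [measurable]: "G \<in> borel_measurable borel" using G by auto
  have wm [measurable]: "w \<in> borel_measurable borel" using w by auto
  define cell where "cell n t = \<lfloor>real (Suc n) * t\<rfloor>" for n and t :: real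
  \<comment> \<open>For |t| <= n the product (n + 1) t lies between -n (n + 1) and n (n + 1), so
    finitely many cells suffice. Cells that miss U are dropped: they contain no admissible tag, and
    G vanishes on them.\<close>
  define J where "J n = {j \<in> {- int (n * Suc n)..int (n * Suc n)}. \<exists>u\<in>U. cell n u = j}" for n
  define tag where "tag n j = (SOME u. u \<in> U \<and> cell n u = j)" for n j
  define F where "F n = tag n ` J n" for n
  define H where "H n t = indicator {- real n..real n} t * G t" for n t
  define c where "c n v = (LINT t|lborel. (if cell n t = cell n v then H n t else 0))" for n v
  have cell_m [measurable]: "cell n \<in> borel \<rightarrow>\<^sub>M count_space UNIV" for n
    unfolding cell_def by measurable
  have Hm [measurable]: "H n \<in> borel_measurable borel" for n
    unfolding H_def by measurable
  have tag: "tag n j \<in> U \<and> cell n (tag n j) = j" if "\<exists>u\<in>U. cell n u = j" for n j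
    unfolding tag_def by (rule someI_ex) (use that in blast)
  have finF: "finite (F n)" for n
    unfolding F_def J_def by (intro finite_imageI finite_subset[OF _ finite_atLeastAtMost_int]) auto
  have FU: "F n \<subseteq> U" for n using tag by (auto simp: F_def J_def)
  \<comment> \<open>A tag determines its cell, so at most one summand of \<open>S\<close> below is
    nonzero at each t.\<close>
  have F_tag: "tag n (cell n v) = v" if v: "v \<in> F n" for n v
  proof -
    obtain j where "v = tag n j" "\<exists>u\<in>U. cell n u = j" using v by (auto simp: F_def J_def)
    with tag[of n j] show ?thesis by simp
  qed
  have Hi: "integrable lborel (\<lambda>t. if cell n t = cell n v then H n t else 0)" for n v
    by (rule Bochner_Integration.integrable_bound[OF G(1)])
       (auto simp: H_def indicator_def)
  \<comment> \<open>The integral of \<open>S\<close> is the exponential sum with coefficients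
    \<open>c\<close>: in the Fourier integral of G over [-n, n], the frequency t is replaced by the
    tag of its cell. The modulus never exceeds that of G.\<close>
  define S where "S n \<omega> t = (\<Sum>v\<in>F n. (if cell n t = cell n v then H n t else 0) * cis (v * \<omega>))" for n \<omega> t
  have S_eq: "S n \<omega> t = (if t \<in> U \<and> \<bar>t\<bar> \<le> real n then G t * cis (tag n (cell n t) * \<omega>) else 0)" for n \<omega> t
  proof (cases "t \<in> U \<and> \<bar>t\<bar> \<le> real n")
    case True
    let ?v = "tag n (cell n t)"
    have ex: "\<exists>u\<in>U. cell n u = cell n t" using True by blast
    have "real (Suc n) * - real n \<le> real (Suc n) * t" "real (Suc n) * t \<le> real (Suc n) * real n"
      using True by (intro mult_left_mono; linarith)+
    then have "of_int (- int (n * Suc n)) \<le> real (Suc n) * t" "real (Suc n) * t < of_int (int (n * Suc n)) + 1"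
      by (simp_all add: algebra_simps)
    then have "cell n t \<in> {- int (n * Suc n)..int (n * Suc n)}"
      unfolding cell_def by (simp only: atLeastAtMost_iff le_floor_iff floor_le_iff)
    then have vF: "?v \<in> F n" using ex by (auto simp: F_def J_def)
    have vc: "cell n ?v = cell n t" using tag[OF ex] by simp
    have "S n \<omega> t = (\<Sum>v\<in>{?v}. (if cell n t = cell n v then H n t else 0) * cis (v * \<omega>))"
      unfolding S_def
    proof (rule sum.mono_neutral_right[OF finF])
      show "\<forall>i\<in>F n - {?v}. (if cell n t = cell n i then H n t else 0) * cis (i * \<omega>) = 0"
        using F_tag by auto
    qed (use vF in auto)
    then show ?thesis using True vc by (auto simp: H_def indicator_def abs_le_iff)
  next
    case False
    then have "H n t = 0" using G(2)[of t] by (auto simp: H_def indicator_def abs_le_iff)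
    then have "S n \<omega> t = 0" unfolding S_def by (intro sum.neutral) auto
    then show ?thesis using False by auto
  qed
  have p_eq: "trig_sum (F n) (c n) \<omega> = (LINT t|lborel. S n \<omega> t)" for n \<omega>
    unfolding S_def trig_sum_def c_def
    by (subst Bochner_Integration.integral_sum) (use Hi in auto)
  have Sm: "S n \<omega> \<in> borel_measurable borel" for n \<omega>
    unfolding S_def by measurable
  have Sb: "cmod (S n \<omega> t) \<le> cmod (G t)" for n \<omega> t
    unfolding S_eq by (simp add: norm_mult)
  have S_lim: "(\<lambda>n. S n \<omega> t) \<longlonglongrightarrow> G t * cis (t * \<omega>)" for \<omega> t
  proof (cases "t \<in> U")
    case True
    have "\<bar>tag n (cell n t) - t\<bar> \<le> 1 / real (Suc n)" for n
    proof -
      have "cell n (tag n (cell n t)) = cell n t" using tag True by blast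
      then have "\<bar>real (Suc n) * tag n (cell n t) - real (Suc n) * t\<bar> \<le> 1"
        unfolding cell_def by linarith
      then have "real (Suc n) * \<bar>tag n (cell n t) - t\<bar> \<le> 1"
        by (simp only: right_diff_distrib[symmetric] abs_mult abs_of_nat)
      then show ?thesis by (simp add: field_simps)
    qed
    then have "(\<lambda>n. tag n (cell n t) - t) \<longlonglongrightarrow> 0"
      by (intro tendsto_rabs_zero_cancel[OF tendsto_sandwich[OF _ _ tendsto_const LIMSEQ_Suc[OF lim_const_over_n[of 1]]]]) auto
    then have "(\<lambda>n. tag n (cell n t)) \<longlonglongrightarrow> t" by (rule LIM_zero_cancel)
    then have "(\<lambda>n. G t * cis (tag n (cell n t) * \<omega>)) \<longlonglongrightarrow> G t * cis (t * \<omega>)"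
      unfolding cis_conv_exp by (intro tendsto_intros)
    moreover have "\<forall>\<^sub>F n in sequentially. G t * cis (tag n (cell n t) * \<omega>) = S n \<omega> t"
    proof -
      obtain m where m: "\<bar>t\<bar> \<le> real m" using real_arch_simple by blast
      show ?thesis using eventually_ge_at_top[of m]
        by eventually_elim (use m True in \<open>auto simp: S_eq\<close>)
    qed
    ultimately show ?thesis by (rule Lim_transform_eventually)
  next
    case False
    then show ?thesis using G(2)[of t] by (simp add: S_eq)
  qed
  have p_lim: "(\<lambda>n. trig_sum (F n) (c n) \<omega>) \<longlonglongrightarrow> fourier1 G \<omega>" for \<omega>
    unfolding p_eq fourier1_def
    by (rule integral_dominated_convergence[where w = "\<lambda>t. cmod (G t)"]) (use Sm S_lim Sb G in auto)
  let ?B = "LINT t|lborel. cmod (G t)"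
  have p_b: "cmod (trig_sum (F n) (c n) \<omega>) \<le> ?B" for n \<omega>
  proof -
    have Si: "integrable lborel (S n \<omega>)"
      by (rule Bochner_Integration.integrable_bound[OF G(1)]) (use Sm Sb in auto)
    have "cmod (trig_sum (F n) (c n) \<omega>) \<le> (LINT t|lborel. cmod (S n \<omega> t))"
      unfolding p_eq by (rule integral_norm_bound)
    also have "\<dots> \<le> ?B"
      by (rule integral_mono) (use Si Sb G in auto)
    finally show ?thesis .
  qed
  have FL: "fourier1 G \<in> L2fun (weighted w)"
    by (rule L2fun_weighted_bounded[OF w]) (use fourier1_bound[OF G(1)] in auto)
  have bL: "(\<lambda>_. complex_of_real (2 * ?B)) \<in> L2fun (weighted w)"
    by (rule L2fun_weighted_bounded[OF w]) auto
  have "(\<lambda>n. sqn (weighted w) (\<lambda>\<omega>. trig_sum (F n) (c n) \<omega> - fourier1 G \<omega>)) \<longlonglongrightarrow> 0"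
  proof (rule tendsto_sqn_dominated[OF _ bL])
    show "AE x in weighted w. (\<lambda>n. trig_sum (F n) (c n) x - fourier1 G x) \<longlonglongrightarrow> 0"
      using LIM_zero[OF p_lim] by simp
    have "cmod (trig_sum (F n) (c n) x - fourier1 G x) \<le> 2 * ?B" for n x
      using norm_triangle_ineq4[of "trig_sum (F n) (c n) x" "fourier1 G x"] p_b[of n x] fourier1_bound[OF G(1), of x]
      by linarith
    then show "AE x in weighted w. cmod (trig_sum (F n) (c n) x - fourier1 G x) \<le> cmod (complex_of_real (2 * ?B))" for n
      by simp
  qed simp
  then show ?thesis
    by (rule trig_span_closed[OF w trig_sum_in_span[OF w finF FU] FL])
qed

lemma integral_shifted_gauss:
  fixes n \<omega> :: real
  assumes "n > 0"
  shows "integrable lborel (\<lambda>\<mu>. exp (- (n * (\<mu> - \<omega>))\<^sup>2 / 2))"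
    and "(LINT \<mu>|lborel. exp (- (n * (\<mu> - \<omega>))\<^sup>2 / 2)) = sqrt (2 * pi) / n"
proof -
  have e: "(\<lambda>\<mu>. exp (- (n * (\<mu> - \<omega>))\<^sup>2 / 2)) = (\<lambda>\<mu>. exp (- (- (n * \<omega>) + n * \<mu>)\<^sup>2 / 2))"
    by (simp add: algebra_simps)
  show "integrable lborel (\<lambda>\<mu>. exp (- (n * (\<mu> - \<omega>))\<^sup>2 / 2))"
    unfolding e by (rule lborel_integrable_real_affine[OF integrable_exp_half_sq]) (use assms in simp)
  have "sqrt (2 * pi) = n * (LINT \<mu>|lborel. exp (- (- (n * \<omega>) + n * \<mu>)\<^sup>2 / 2))"
    using lborel_integral_real_affine[of n "\<lambda>s. exp (- s\<^sup>2 / 2)" "- (n * \<omega>)"] assms integral_exp_half_sq by simp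
  then show "(LINT \<mu>|lborel. exp (- (n * (\<mu> - \<omega>))\<^sup>2 / 2)) = sqrt (2 * pi) / n"
    unfolding e using assms by (simp add: field_simps)
qed

lemma gauss_L2: "n > 0 \<Longrightarrow> gauss n \<in> L2fun lborel"
proof -
  assume n: "n > 0"
  have "integrable lborel (\<lambda>x. (cmod (gauss n x))\<^sup>2)"
  proof (rule Bochner_Integration.integrable_bound[OF integrable_gauss[OF n]])
    show "AE x in lborel. norm ((cmod (gauss n x))\<^sup>2) \<le> norm (gauss n x)"
      by (auto simp: gauss_def power2_eq_square intro!: mult_left_le)
  qed simp
  then show ?thesis by (simp add: L2fun_def)
qed

text \<open>Multiplying \<open>H\<close> by a Gaussian convolves its transform with a probability density,
  so the bound \<open>b\<close> survives.\<close>

lemma fourier1_gauss_mult_bound: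
  assumes H: "H \<in> L2fun lborel" and n: "n > 0"
    and b: "AE \<omega> in lborel. cmod (Ft H \<omega>) \<le> b"
  shows "cmod (fourier1 (\<lambda>t. H t * gauss n t) \<omega>) \<le> b"
proof -
  \<comment> \<open>The conjugate of this modulated Gaussian is the damping factor times the
    exponential at \<omega>, so Parseval's identity expresses the value at \<omega> by the transform
    of H.\<close>
  define z where "z t = gauss n t * cis (t * (- \<omega>))" for t
  have zm: "z \<in> borel_measurable lborel" unfolding z_def by measurable
  have z2: "z \<in> L2fun lborel"
    by (rule L2fun_bound[OF gauss_L2[OF n] zm]) (simp add: z_def norm_mult)
  have z1: "integrable lborel z"
    unfolding z_def[abs_def] by (rule integrable_cis_mult[OF integrable_gauss[OF n]])
  have zF: "fourier1 z \<mu> = n * sqrt (2 * pi) * exp (- (n * (\<mu> - \<omega>))\<^sup>2 / 2)" for \<mu>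
    unfolding z_def[abs_def] fourier1_modulate fourier1_gauss[OF n] by simp
  have "fourier1 (\<lambda>t. H t * gauss n t) \<omega> = (LINT t|lborel. H t * cnj (z t))"
    unfolding fourier1_def z_def gauss_def by (simp add: cis_cnj mult.assoc)
  also have "2 * pi * \<dots> = (LINT \<mu>|lborel. Ft H \<mu> * cnj (Ft z \<mu>))"
    by (rule Parseval[OF H z2, symmetric])
  also have "\<dots> = (LINT \<mu>|lborel. Ft H \<mu> * cnj (fourier1 z \<mu>))"
  proof (rule integral_cong_AE)
    show "AE \<mu> in lborel. Ft H \<mu> * cnj (Ft z \<mu>) = Ft H \<mu> * cnj (fourier1 z \<mu>)"
      using Ft_eq_fourier1[OF z2 z1] by eventually_elim simp
    show "(\<lambda>\<mu>. Ft H \<mu> * cnj (Ft z \<mu>)) \<in> borel_measurable lborel"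
      using Ft_L2[OF H] Ft_L2[OF z2] by measurable
    show "(\<lambda>\<mu>. Ft H \<mu> * cnj (fourier1 z \<mu>)) \<in> borel_measurable lborel"
      using Ft_L2[OF H] zm by measurable
  qed
  finally have eq: "2 * pi * fourier1 (\<lambda>t. H t * gauss n t) \<omega> = (LINT \<mu>|lborel. Ft H \<mu> * cnj (fourier1 z \<mu>))" .
  \<comment> \<open>This kernel is positive with integral 2 pi, which cancels the factor of
    Parseval's identity: the bound b comes back with constant 1.\<close>
  let ?k = "\<lambda>\<mu>. n * sqrt (2 * pi) * exp (- (n * (\<mu> - \<omega>))\<^sup>2 / 2)"
  have ki: "integrable lborel ?k"
    by (intro integrable_mult_right integral_shifted_gauss n)
  have zn: "cmod (fourier1 z \<mu>) = ?k \<mu>" for \<mu>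
    unfolding zF using n by (simp add: norm_mult)
  have "cmod (LINT \<mu>|lborel. Ft H \<mu> * cnj (fourier1 z \<mu>)) \<le> (LINT \<mu>|lborel. cmod (Ft H \<mu> * cnj (fourier1 z \<mu>)))"
    by (rule integral_norm_bound)
  also have "\<dots> \<le> (LINT \<mu>|lborel. b * ?k \<mu>)"
  proof (rule integral_mono_AE)
    show "integrable lborel (\<lambda>\<mu>. cmod (Ft H \<mu> * cnj (fourier1 z \<mu>)))"
      by (intro integrable_norm L2fun_mult_integrable Ft_L2 H L2fun_cnj Plancherel_L1_L2(1) z1 z2)
    show "integrable lborel (\<lambda>\<mu>. b * ?k \<mu>)" by (intro integrable_mult_right[OF ki])
    show "AE \<mu> in lborel. cmod (Ft H \<mu> * cnj (fourier1 z \<mu>)) \<le> b * ?k \<mu>"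
      using b
    proof eventually_elim
      case (elim \<mu>)
      have "0 \<le> ?k \<mu>" using n by simp
      then show ?case unfolding norm_mult complex_mod_cnj zn using elim by (rule mult_right_mono[rotated])
    qed
  qed
  also have "\<dots> = 2 * pi * b"
    using integral_shifted_gauss(2)[OF n, of \<omega>] n by simp
  finally have "cmod (2 * pi * fourier1 (\<lambda>t. H t * gauss n t) \<omega>) \<le> 2 * pi * b"
    unfolding eq .
  then show ?thesis by (simp add: norm_mult)
qed

text \<open>Damped versions of the frequency function are integrable and vanish off U, so their
  transforms lie in the span; these are bounded by b and, along a subsequence, tend to h almost
  everywhere. Both facts pass to any measure with a density, and the finite mass of
  \<open>weighted w\<close> lets the constant 2 b dominate.\<close>

lemma bounded_Ft_in_trig_span:
  assumes U: "U \<in> sets borel" and H: "H \<in> L2fun lborel" "AE t in lborel. t \<notin> U \<longrightarrow> H t = 0"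
    and h: "h \<in> borel_measurable borel" "AE \<omega> in lborel. h \<omega> = Ft H \<omega>"
    and b: "AE \<omega> in lborel. cmod (h \<omega>) \<le> b"
    and w: "\<And>\<omega>. 0 \<le> w \<omega>" "integrable lborel w"
  shows "h \<in> trig_span U (weighted w)"
proof -
  have [measurable]: "H \<in> borel_measurable borel" using L2fun_measurable[OF H(1)] by simp
  have wm: "w \<in> borel_measurable borel" using w by auto
  \<comment> \<open>Riemann sums with tags in U ask for exact vanishing off U, not only almost
    everywhere.\<close>
  define H' where "H' t = indicator U t * H t" for t
  have H'm [measurable]: "H' \<in> borel_measurable borel"
    unfolding H'_def using U by measurable
  have H'H: "AE t in lborel. H' t = H t"
    using H(2) by eventually_elim (auto simp: H'_def indicator_def)
  have H'L: "H' \<in> L2fun lborel"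
    by (rule L2fun_bound[OF H(1)]) (auto simp: H'_def indicator_def)
  have "sqn lborel (\<lambda>\<omega>. Ft H' \<omega> - Ft H \<omega>) = 2 * pi * sqn lborel (\<lambda>t. H' t - H t)"
    by (rule sqn_Ft_diff[OF H'L H(1)])
  also have "sqn lborel (\<lambda>t. H' t - H t) = sqn lborel (\<lambda>t::real. 0)"
    by (rule sqn_cong_AE) (use H'H in auto)
  finally have "AE \<omega> in lborel. Ft H' \<omega> - Ft H \<omega> = 0"
    by (intro sqn_eq_0D L2fun_diff Ft_L2 H'L H(1)) (simp add: sqn_def)
  with h(2) have hF: "AE \<omega> in lborel. Ft H' \<omega> = h \<omega>" by eventually_elim simp
  have hL: "h \<in> L2fun lborel"
    by (rule L2fun_cong_AE[OF Ft_L2[OF H'L] hF]) (use h in simp)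
  have bF: "AE \<omega> in lborel. cmod (Ft H' \<omega>) \<le> b"
    using b hF by eventually_elim simp
  define G where "G n t = H' t * gauss (real (Suc n)) t" for n t
  have Gm [measurable]: "G n \<in> borel_measurable borel" for n
    unfolding G_def by measurable
  have g1: "cmod (gauss k t) \<le> 1" for k t by (simp add: gauss_def)
  have GL: "G n \<in> L2fun lborel" for n
    by (rule L2fun_bound[OF H'L]) (use g1 in \<open>auto simp: G_def norm_mult mult_left_le\<close>)
  have Gi: "integrable lborel (G n)" for n
    unfolding G_def[abs_def] by (intro L2fun_mult_integrable H'L gauss_L2) simp
  have GU: "t \<notin> U \<Longrightarrow> G n t = 0" for n t by (simp add: G_def H'_def)
  have Gb: "cmod (fourier1 (G n) \<omega>) \<le> b" for n \<omega>
    unfolding G_def[abs_def] by (rule fourier1_gauss_mult_bound[OF H'L _ bF]) simp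
  have "(\<lambda>n. sqn lborel (\<lambda>t. G n t - H' t)) \<longlonglongrightarrow> 0"
  proof (rule tendsto_sqn_dominated[where w = "\<lambda>t. 2 * H' t"])
    show "(\<lambda>t. 2 * H' t) \<in> L2fun lborel" by (rule L2fun_cmult[OF H'L])
    show "AE t in lborel. (\<lambda>n. G n t - H' t) \<longlonglongrightarrow> 0"
    proof (rule AE_I2)
      fix t
      have "(\<lambda>n. H' t * complex_of_real (exp (- (t / real (Suc n))\<^sup>2 / 2))) \<longlonglongrightarrow> H' t * complex_of_real (exp (- 0\<^sup>2 / 2))"
        by (intro tendsto_intros LIMSEQ_Suc lim_const_over_n) simp
      then show "(\<lambda>n. G n t - H' t) \<longlonglongrightarrow> 0"
        by (intro LIM_zero) (simp add: G_def gauss_def)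
    qed
    have "cmod (G n t - H' t) \<le> 2 * cmod (H' t)" for n t
    proof -
      have "cmod (G n t) \<le> cmod (H' t)"
        using g1 by (auto simp: G_def norm_mult mult_left_le)
      then show ?thesis using norm_triangle_ineq4[of "G n t" "H' t"] by linarith
    qed
    then show "AE t in lborel. cmod (G n t - H' t) \<le> cmod (2 * H' t)" for n
      by (simp add: norm_mult)
  qed simp
  then have "(\<lambda>n. 2 * pi * sqn lborel (\<lambda>t. G n t - H' t)) \<longlonglongrightarrow> 2 * pi * 0"
    by (intro tendsto_intros)
  then have "(\<lambda>n. sqn lborel (\<lambda>\<omega>. fourier1 (G n) \<omega> - Ft H' \<omega>)) \<longlonglongrightarrow> 0"
    by (simp add: sqn_fourier1_Ft_diff[OF H'L GL Gi])
  moreover have "sqn lborel (\<lambda>\<omega>. fourier1 (G n) \<omega> - Ft H' \<omega>) = sqn lborel (\<lambda>\<omega>. fourier1 (G n) \<omega> - h \<omega>)" for n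
  proof (rule sqn_cong_AE)
    show "AE \<omega> in lborel. fourier1 (G n) \<omega> - Ft H' \<omega> = fourier1 (G n) \<omega> - h \<omega>"
      using hF by eventually_elim simp
  qed (use Ft_measurable[OF H'L] h in auto)
  ultimately have "(\<lambda>n. sqn lborel (\<lambda>\<omega>. fourier1 (G n) \<omega> - h \<omega>)) \<longlonglongrightarrow> 0" by simp
  \<comment> \<open>Convergence in the norm of Lebesgue measure says nothing about an unbounded
    weight; the almost everywhere convergent subsequence is what passes over.\<close>
  then obtain r where r: "strict_mono r" "AE \<omega> in lborel. (\<lambda>n. fourier1 (G (r n)) \<omega>) \<longlonglongrightarrow> h \<omega>"
    using L2_tendsto_AE_subseq[where f = "\<lambda>n. fourier1 (G n)", OF Plancherel_L1_L2(1)[OF GL Gi] hL] by blast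
  have hw: "h \<in> L2fun (weighted w)"
    by (rule L2fun_weighted_bounded[OF w h(1) b])
  have bL: "(\<lambda>_. complex_of_real (2 * b)) \<in> L2fun (weighted w)"
    by (rule L2fun_weighted_bounded[OF w]) auto
  have "(\<lambda>n. sqn (weighted w) (\<lambda>\<omega>. fourier1 (G (r n)) \<omega> - h \<omega>)) \<longlonglongrightarrow> 0"
  proof (rule tendsto_sqn_dominated[OF _ bL])
    show "(\<lambda>\<omega>. fourier1 (G (r n)) \<omega> - h \<omega>) \<in> borel_measurable (weighted w)" for n
      using h(1) by simp
    have "AE \<omega> in lborel. (\<lambda>n. fourier1 (G (r n)) \<omega> - h \<omega>) \<longlonglongrightarrow> 0"
      using r(2) by eventually_elim (rule LIM_zero)
    then show "AE \<omega> in weighted w. (\<lambda>n. fourier1 (G (r n)) \<omega> - h \<omega>) \<longlonglongrightarrow> 0"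
      by (rule AE_weighted[OF wm])
    have "AE \<omega> in lborel. cmod (fourier1 (G (r n)) \<omega> - h \<omega>) \<le> cmod (complex_of_real (2 * b))" for n
      using b
    proof eventually_elim
      case (elim \<omega>)
      then show ?case
        using norm_triangle_ineq4[of "fourier1 (G (r n)) \<omega>" "h \<omega>"] Gb[of "r n" \<omega>] by simp
    qed
    then show "AE \<omega> in weighted w. cmod (fourier1 (G (r n)) \<omega> - h \<omega>) \<le> cmod (complex_of_real (2 * b))" for n
      by (rule AE_weighted[OF wm])
  qed
  moreover have "fourier1 (G n) \<in> trig_span U (weighted w)" for n
    by (rule fourier1_in_trig_span[OF Gi _ w]) (rule GU)
  ultimately show ?thesis
    by (intro trig_span_closed[where f = "\<lambda>n. fourier1 (G (r n))", OF w _ hw])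
qed

section \<open>Spectral characteristics\<close>

lemma abs_ratio_le_1: "0 \<le> u \<Longrightarrow> 0 \<le> v \<Longrightarrow> \<bar>u / (u + v)\<bar> \<le> 1" for u v :: real
  by (cases "u + v = 0") (auto simp: divide_le_eq_1)

lemma fourier1_isCont:
  assumes x: "integrable lborel x"
  shows "isCont (fourier1 x) \<omega>"
proof (rule continuous_at_sequentiallyI)
  fix u :: "nat \<Rightarrow> real" assume u: "u \<longlonglongrightarrow> \<omega>"
  show "(\<lambda>n. fourier1 x (u n)) \<longlonglongrightarrow> fourier1 x \<omega>"
    unfolding fourier1_def
  proof (rule integral_dominated_convergence[where w = "\<lambda>t. cmod (x t)"])
    show "AE t in lborel. (\<lambda>n. x t * cis (t * u n)) \<longlonglongrightarrow> x t * cis (t * \<omega>)"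
      unfolding cis_conv_exp by (intro AE_I2 tendsto_intros u)
  qed (use x in \<open>auto simp: norm_mult\<close>)
qed

text \<open>The transform is continuous, and a nonempty open set is not null. This is what gives
  orthogonality at every observation time instead of almost every one.\<close>

lemma fourier1_zero_on_open:
  assumes x: "integrable lborel x" and U: "open U"
    and z: "AE t in lborel. t \<in> U \<longrightarrow> fourier1 x t = 0" and t: "t \<in> U"
  shows "fourier1 x t = 0"
proof (rule ccontr)
  assume nz: "fourier1 x t \<noteq> 0"
  have "continuous_on UNIV (fourier1 x)"
    using fourier1_isCont[OF x] by (simp add: continuous_at_imp_continuous_on)
  then have "open (fourier1 x -` (- {0}))"
    by (rule open_vimage[rotated]) auto
  then have o: "open (U \<inter> fourier1 x -` (- {0}))"
    using U by blast
  have "AE t in lborel. t \<notin> U \<inter> fourier1 x -` (- {0})"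
    using z by eventually_elim auto
  then have "AE t in lebesgue. t \<notin> U \<inter> fourier1 x -` (- {0})"
    by (simp only: AE_completion_iff)
  then have "negligible (U \<inter> fourier1 x -` (- {0}))"
    using o by (subst negligible_iff_null_sets) (simp add: AE_iff_null_sets borel_open)
  then show False
    using open_not_negligible[OF o] t nz by blast
qed

text \<open>\<open>G\<close> is entire and not identically zero, so \<open>\<gamma>\<close> has
  countably many zeros. At any other point a zero of f + g makes the quotient infinite, which a
  finite integral permits only on a null set.\<close>

lemma minimality_imp_AE_pos:
  assumes f: "spectral_density f" and g: "spectral_density g" and m: "minimality f g"
  shows "AE \<omega> in lborel. 0 < f \<omega> + g \<omega>"
proof -
  obtain \<alpha> \<gamma> G where al: "set_integrable lborel {0..} \<alpha>"
    and ga: "\<forall>\<omega>. \<gamma> \<omega> = (LINT t:{0..}|lborel. \<alpha> t * cis (t * \<omega>))"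
    and G: "G holomorphic_on UNIV" "\<forall>\<omega>. G (complex_of_real \<omega>) = \<gamma> \<omega>"
    and nz: "\<exists>\<omega>. \<gamma> \<omega> \<noteq> 0"
    and fin: "(\<integral>\<^sup>+\<omega>. ennreal ((cmod (\<gamma> \<omega>))\<^sup>2) / ennreal (f \<omega> + g \<omega>) \<partial>lborel) < \<infinity>"
    using m unfolding minimality_def by blast
  have [measurable]: "f \<in> borel_measurable borel" "g \<in> borel_measurable borel"
    using f g by (auto simp: spectral_density_def)
  have "\<gamma> = fourier1 (\<lambda>t. indicator {0..} t *\<^sub>R \<alpha> t)"
    by (rule ext) (simp add: ga fourier1_def set_lebesgue_integral_def)
  then have [measurable]: "\<gamma> \<in> borel_measurable borel"
    using al by (auto simp: set_integrable_def)
  have "countable {z. G z = 0}"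
  proof (cases "G constant_on UNIV")
    case True
    then have "{z. G z = 0} = {}" using nz G(2) by (metis (mono_tags, lifting) Collect_empty_eq UNIV_I constant_on_def)
    then show ?thesis by simp
  next
    case False
    then show ?thesis using holomorphic_countable_zeros[OF G(1)] by auto
  qed
  then have "countable (complex_of_real -` {z. G z = 0})"
    by (rule countable_image_inj_Int_vimage[of complex_of_real UNIV, simplified, rotated]) (simp add: inj_def)
  then have "AE \<omega> in lborel. \<omega> \<notin> complex_of_real -` {z. G z = 0}"
    by (intro AE_not_in countable_imp_null_set_lborel)
  moreover have "AE \<omega> in lborel. ennreal ((cmod (\<gamma> \<omega>))\<^sup>2) / ennreal (f \<omega> + g \<omega>) \<noteq> \<infinity>"
    by (rule nn_integral_PInf_AE) (use fin in auto)
  ultimately show ?thesis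
  proof eventually_elim
    case (elim \<omega>)
    have "f \<omega> + g \<omega> \<noteq> 0"
    proof
      assume "f \<omega> + g \<omega> = 0"
      with elim(1) have "ennreal ((cmod (\<gamma> \<omega>))\<^sup>2) / ennreal (f \<omega> + g \<omega>) = \<infinity>"
        by (simp add: G(2) ennreal_divide_zero)
      with elim(2) show False by simp
    qed
    then show ?case using f g by (simp add: spectral_density_def less_le)
  qed
qed

section \<open>The operators and the spectrum of the optimal characteristic\<close>

lemma integral_scaleR_indicator_sq:
  "(LINT t:T|lborel. (cmod (x t))\<^sup>2) = sqn lborel (\<lambda>t. indicator T t *\<^sub>R x t)"
  unfolding set_lebesgue_integral_def sqn_def
  by (intro Bochner_Integration.integral_cong) (auto simp: indicator_def)

lemma L2fun_restrict:
  assumes [measurable]: "T \<in> sets borel" and x: "x \<in> L2fun lborel"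
  shows "(\<lambda>t. indicator T t *\<^sub>R x t) \<in> L2fun lborel"
proof (rule L2fun_bound[OF x])
  show "(\<lambda>t. indicator T t *\<^sub>R x t) \<in> borel_measurable lborel"
    using x by measurable
qed (auto simp: indicator_def)

text \<open>The multiplier f / (f + g) is at most 1 in modulus, also where the denominator is 0, so
  \<open>R_op\<close> can be applied without any domain condition.\<close>

lemma R_op_L2fun:
  assumes b: "b \<in> L2fun lborel" "\<And>t. t \<notin> T \<Longrightarrow> b t = 0"
    and f: "spectral_density f" and g: "spectral_density g"
  defines "q \<equiv> (\<lambda>\<omega>. Ft b (- \<omega>) * complex_of_real (f \<omega> / (f \<omega> + g \<omega>)))"
  shows "q \<in> L2fun lborel" "R_op T f g b = (\<lambda>t. 1 / (2 * pi) * Ft q (- t))" "R_op T f g b \<in> L2fun lborel"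
proof -
  have fg0: "\<And>\<omega>. 0 \<le> f \<omega>" "\<And>\<omega>. 0 \<le> g \<omega>" and [measurable]: "f \<in> borel_measurable borel" "g \<in> borel_measurable borel"
    using f g by (auto simp: spectral_density_def)
  have bT: "(\<lambda>t. indicator T t *\<^sub>R b t) = b"
    using b(2) by (auto simp: fun_eq_iff indicator_def)
  have Fb: "L2_fourier T b = Ft b"
    using L2_fourier_set[of T b] by (simp add: bT)
  show qL: "q \<in> L2fun lborel"
  proof (rule L2fun_bound[OF L2fun_reflect[OF Ft_L2[OF b(1)]]])
    show "q \<in> borel_measurable lborel"
      unfolding q_def using Ft_measurable[OF b(1)] by measurable
    have "\<bar>f \<omega> / (f \<omega> + g \<omega>)\<bar> \<le> 1" for \<omega>
      by (rule abs_ratio_le_1[OF fg0])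
    then show "AE \<omega> in lborel. cmod (q \<omega>) \<le> cmod (Ft b (- \<omega>))"
      unfolding q_def norm_mult norm_of_real by (intro AE_I2 mult_left_le) auto
  qed
  show r_eq: "R_op T f g b = (\<lambda>t. 1 / (2 * pi) * Ft q (- t))"
    unfolding R_op_def Fb q_def by simp
  show "R_op T f g b \<in> L2fun lborel"
    unfolding r_eq by (intro L2fun_cmult L2fun_reflect Ft_L2 qL)
qed

lemma B_op_B_inv:
  assumes "B_invertible T f g" "r \<in> L2_space T"
  shows "B_op T f g (B_inv T f g r) r"
proof -
  have "\<exists>x. B_op T f g x r" using assms by (auto simp: B_invertible_def)
  then show ?thesis unfolding B_inv_def by (rule someI_ex)
qed

lemma B_inv_L2fun:
  assumes "B_op T f g (B_inv T f g r) r"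
  shows "(\<lambda>t. indicator T t *\<^sub>R B_inv T f g r t) \<in> L2fun lborel"
  using assms by (simp add: B_op_def B_domain_def L2_space_iff)

text \<open>The equation for \<open>B_inv\<close>, tested with k in \<open>B_domain\<close>, says
  that h is orthogonal to the transform of k; density of the domain extends this to all of L2(T). A
  suitable test function then shows that the inverse transform of h vanishes on T. Membership of h
  in L2 is assumed because 1 / (f + g) is in general unbounded, so that the quotient by f + g may
  leave L2.\<close>

lemma optimal_char_spectrum:
  fixes f g :: "real \<Rightarrow> real" and b :: "real \<Rightarrow> complex" and T :: "real set"
  defines "C \<equiv> L2_fourier T (B_inv T f g (R_op T f g b))"
  defines "h \<equiv> (\<lambda>\<omega>. fourier1 b (- \<omega>) * complex_of_real (f \<omega> / (f \<omega> + g \<omega>)) - C \<omega> / complex_of_real (f \<omega> + g \<omega>))"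
  assumes T: "T \<in> sets borel" and b: "b \<in> L2fun lborel" "integrable lborel b" "\<And>t. t \<notin> T \<Longrightarrow> b t = 0"
    and f: "spectral_density f" and g: "spectral_density g" and B: "B_invertible T f g"
    and h: "h \<in> L2fun lborel"
  obtains H where "H \<in> L2fun lborel" "AE t in lborel. t \<in> T \<longrightarrow> H t = 0" "AE \<omega> in lborel. h \<omega> = Ft H \<omega>"
proof -
  note [measurable] = T
  have fg0: "\<And>\<omega>. 0 \<le> f \<omega>" "\<And>\<omega>. 0 \<le> g \<omega>" and [measurable]: "f \<in> borel_measurable borel" "g \<in> borel_measurable borel"
    using f g by (auto simp: spectral_density_def)
  have [measurable]: "b \<in> borel_measurable borel" using b(2) by auto
  define q where "q = (\<lambda>\<omega>. Ft b (- \<omega>) * complex_of_real (f \<omega> / (f \<omega> + g \<omega>)))"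
  have qL: "q \<in> L2fun lborel" and r_eq: "R_op T f g b = (\<lambda>t. 1 / (2 * pi) * Ft q (- t))"
    and rL: "R_op T f g b \<in> L2fun lborel"
    unfolding q_def by (rule R_op_L2fun[OF b(1) _ f g], rule b(3), assumption)+
  note restr = L2fun_restrict[OF T]
  have Bop: "B_op T f g (B_inv T f g (R_op T f g b)) (R_op T f g b)"
    by (rule B_op_B_inv[OF B]) (simp add: L2_space_iff restr rL)
  have CL: "C \<in> L2fun lborel"
    unfolding C_def L2_fourier_set[of T] by (intro Ft_L2 B_inv_L2fun Bop)
  \<comment> \<open>h is written with the integral of b and q with its L2 transform; the two differ
    on a null set.\<close>
  have hq: "AE \<omega> in lborel. h \<omega> = q \<omega> - C \<omega> / complex_of_real (f \<omega> + g \<omega>)"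
    using AE_reflect_lborel[OF Ft_eq_fourier1[OF b(1,2)]]
    by eventually_elim (simp add: h_def q_def)
  \<comment> \<open>The quotient is square integrable only through q and h, being their
    difference.\<close>
  have dL: "(\<lambda>\<omega>. C \<omega> / complex_of_real (f \<omega> + g \<omega>)) \<in> L2fun lborel"
  proof (rule L2fun_cong_AE[OF L2fun_diff[OF qL h]])
    show "AE \<omega> in lborel. q \<omega> - h \<omega> = C \<omega> / complex_of_real (f \<omega> + g \<omega>)"
      using hq by eventually_elim simp
  qed (use CL in measurable)
  have orthB: "(LINT \<omega>|lborel. h \<omega> * cnj (L2_fourier T k \<omega>)) = 0" if k: "k \<in> B_domain T f g" for k
  proof -
    define k' where "k' t = indicator T t *\<^sub>R k t" for t
    have k'L: "k' \<in> L2fun lborel"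
      using k by (auto simp: B_domain_def L2_space_iff k'_def[abs_def])
    have Fk: "L2_fourier T k = Ft k'"
      unfolding k'_def[abs_def] by (rule L2_fourier_set)
    have FkL: "(\<lambda>\<omega>. cnj (Ft k' \<omega>)) \<in> L2fun lborel" by (intro L2fun_cnj Ft_L2 k'L)
    have rk: "(\<lambda>t. cnj (k' (- t))) \<in> L2fun lborel" by (intro L2fun_cnj L2fun_reflect k'L)
    have "(LINT \<omega>|lborel. q \<omega> * cnj (Ft k' \<omega>)) = (LINT \<omega>|lborel. q \<omega> * Ft (\<lambda>t. cnj (k' (- t))) \<omega>)"
    proof (rule integral_cong_AE)
      show "AE \<omega> in lborel. q \<omega> * cnj (Ft k' \<omega>) = q \<omega> * Ft (\<lambda>t. cnj (k' (- t))) \<omega>"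
        using Ft_cnj_reflect[OF k'L] by eventually_elim simp
    qed (use qL FkL Ft_L2[OF rk] in measurable)
    also have "\<dots> = (LINT t|lborel. Ft q t * cnj (k' (- t)))"
      by (rule Ft_multiplication[OF qL rk, symmetric])
    also have "\<dots> = (LINT t|lborel. Ft q (- t) * cnj (k' t))"
      using integral_reflect_lborel[of "\<lambda>t. Ft q (- t) * cnj (k' t)"] by simp
    also have "\<dots> = (LINT t|lborel. 2 * pi * (indicator T t *\<^sub>R (R_op T f g b t * cnj (k t))))"
      unfolding r_eq k'_def by (intro Bochner_Integration.integral_cong) (auto simp: indicator_def)
    also have "\<dots> = 2 * pi * L2_inner T (R_op T f g b) k"
      unfolding L2_inner_def set_lebesgue_integral_def by (rule integral_mult_right_zero)
    also have "L2_inner T (R_op T f g b) k = 1 / (2 * pi) *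
       (LINT \<omega>|lborel. C \<omega> * cnj (Ft k' \<omega>) / complex_of_real (f \<omega> + g \<omega>))"
      using Bop k unfolding B_op_def C_def Fk[symmetric] by simp
    also have "2 * pi * (1 / (2 * pi) * (LINT \<omega>|lborel. C \<omega> * cnj (Ft k' \<omega>) / complex_of_real (f \<omega> + g \<omega>)))
       = (LINT \<omega>|lborel. C \<omega> / complex_of_real (f \<omega> + g \<omega>) * cnj (Ft k' \<omega>))"
      by simp
    finally have eq: "(LINT \<omega>|lborel. q \<omega> * cnj (Ft k' \<omega>))
       = (LINT \<omega>|lborel. C \<omega> / complex_of_real (f \<omega> + g \<omega>) * cnj (Ft k' \<omega>))" .
    have "(LINT \<omega>|lborel. h \<omega> * cnj (Ft k' \<omega>))
       = (LINT \<omega>|lborel. q \<omega> * cnj (Ft k' \<omega>) - C \<omega> / complex_of_real (f \<omega> + g \<omega>) * cnj (Ft k' \<omega>))"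
    proof (rule integral_cong_AE)
      show "AE \<omega> in lborel. h \<omega> * cnj (Ft k' \<omega>) = q \<omega> * cnj (Ft k' \<omega>) - C \<omega> / complex_of_real (f \<omega> + g \<omega>) * cnj (Ft k' \<omega>)"
        using hq by eventually_elim (simp add: left_diff_distrib)
    qed (use h qL FkL CL in measurable)
    also have "\<dots> = 0"
      unfolding Bochner_Integration.integral_diff[OF L2fun_mult_integrable[OF qL FkL] L2fun_mult_integrable[OF dL FkL]]
      using eq by simp
    finally show ?thesis unfolding Fk .
  qed
  have orth: "(LINT \<omega>|lborel. h \<omega> * cnj (Ft x \<omega>)) = 0" if x: "x \<in> L2fun lborel" and xT: "\<And>t. t \<notin> T \<Longrightarrow> x t = 0" for x
  proof -
    have xx: "(\<lambda>t. indicator T t *\<^sub>R x t) = x" using xT by (auto simp: fun_eq_iff indicator_def)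
    have "cmod (LINT \<omega>|lborel. h \<omega> * cnj (Ft x \<omega>)) \<le> e" if e: "e > 0" for e
    proof -
      \<comment> \<open>Chosen so that 2 pi \<open>sqn lborel h\<close> d is at most e^2; the
        summand 1 keeps the denominator positive when h = 0.\<close>
      define d where "d = e\<^sup>2 / (2 * pi * sqn lborel h + 1)"
      have P: "0 < 2 * pi * sqn lborel h + 1" by (simp add: add_nonneg_pos)
      have "d > 0" unfolding d_def using P e by simp
      then obtain k where k: "k \<in> B_domain T f g" "(LINT t:T|lborel. (cmod (x t - k t))\<^sup>2) < d"
        using B x xx unfolding B_invertible_def by (metis L2_space_iff)
      define k' where "k' t = indicator T t *\<^sub>R k t" for t
      have k'L: "k' \<in> L2fun lborel"
        using k by (auto simp: B_domain_def L2_space_iff k'_def[abs_def])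
      have Fk: "L2_fourier T k = Ft k'"
        unfolding k'_def[abs_def] by (rule L2_fourier_set)
      have "(\<lambda>t. indicator T t *\<^sub>R (x t - k t)) = (\<lambda>t. x t - k' t)"
        using xT by (auto simp: fun_eq_iff indicator_def k'_def)
      then have sd: "sqn lborel (\<lambda>t. x t - k' t) < d"
        using k(2) integral_scaleR_indicator_sq[of T "\<lambda>t. x t - k t"] by simp
      have zL: "(\<lambda>\<omega>. cnj (Ft x \<omega> - Ft k' \<omega>)) \<in> L2fun lborel"
        by (intro L2fun_cnj L2fun_diff Ft_L2 x k'L)
      have "(LINT \<omega>|lborel. h \<omega> * cnj (Ft x \<omega>)) = (LINT \<omega>|lborel. h \<omega> * cnj (Ft x \<omega>)) - (LINT \<omega>|lborel. h \<omega> * cnj (Ft k' \<omega>))"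
        using orthB[OF k(1)] by (simp add: Fk)
      also have "\<dots> = (LINT \<omega>|lborel. h \<omega> * cnj (Ft x \<omega> - Ft k' \<omega>))"
        using L2fun_mult_integrable[OF h L2fun_cnj[OF Ft_L2[OF x]]] L2fun_mult_integrable[OF h L2fun_cnj[OF Ft_L2[OF k'L]]]
        by (simp add: right_diff_distrib)
      also have "cmod \<dots> \<le> sqrt (sqn lborel h * sqn lborel (\<lambda>\<omega>. cnj (Ft x \<omega> - Ft k' \<omega>)))"
        by (rule Cauchy_Schwarz_integral[OF h zL])
      also have "sqn lborel (\<lambda>\<omega>. cnj (Ft x \<omega> - Ft k' \<omega>)) = 2 * pi * sqn lborel (\<lambda>t. x t - k' t)"
        using sqn_Ft_diff[OF x k'L] by (simp add: sqn_def del: complex_cnj_diff)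
      also have "sqrt (sqn lborel h * (2 * pi * sqn lborel (\<lambda>t. x t - k' t))) \<le> sqrt (e\<^sup>2)"
      proof (rule real_sqrt_le_mono)
        have "sqn lborel h * (2 * pi * sqn lborel (\<lambda>t. x t - k' t)) \<le> (2 * pi * sqn lborel h) * d"
          using mult_left_mono[OF less_imp_le[OF sd], of "2 * pi * sqn lborel h"] by (simp add: mult_ac)
        also have "\<dots> \<le> (2 * pi * sqn lborel h + 1) * d"
          using \<open>d > 0\<close> by (intro mult_right_mono) auto
        also have "\<dots> = e\<^sup>2" using P by (simp add: d_def)
        finally show "sqn lborel h * (2 * pi * sqn lborel (\<lambda>t. x t - k' t)) \<le> e\<^sup>2" .
      qed
      finally show ?thesis using e by simp
    qed
    then have "cmod (LINT \<omega>|lborel. h \<omega> * cnj (Ft x \<omega>)) \<le> 0"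
      by (rule field_le_epsilon[of _ 0, simplified])
    then show ?thesis by simp
  qed
  let ?y = "\<lambda>\<omega>. cnj (h \<omega>)"
  have yL: "?y \<in> L2fun lborel" by (rule L2fun_cnj[OF h])
  note FyL = Ft_L2[OF yL]
  \<comment> \<open>The test function whose pairing with h is its own squared norm, up to
    conjugation.\<close>
  define x where "x t = indicator T t *\<^sub>R cnj (Ft ?y t)" for t
  have xL: "x \<in> L2fun lborel" unfolding x_def[abs_def] by (intro restr L2fun_cnj FyL)
  have "complex_of_real (sqn lborel x) = (LINT t|lborel. x t * Ft ?y t)"
    unfolding sqn_def integral_complex_of_real[symmetric] complex_norm_square
    by (intro Bochner_Integration.integral_cong) (auto simp: x_def indicator_def)
  also have "\<dots> = (LINT \<omega>|lborel. Ft x \<omega> * ?y \<omega>)"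
    by (rule Ft_multiplication[OF xL yL, symmetric])
  also have "\<dots> = (LINT \<omega>|lborel. cnj (h \<omega> * cnj (Ft x \<omega>)))"
    by (simp add: mult.commute)
  also have "\<dots> = cnj (LINT \<omega>|lborel. h \<omega> * cnj (Ft x \<omega>))"
    by (rule Bochner_Integration.integral_cnj)
  also have "\<dots> = 0" using orth[OF xL] by (simp add: x_def)
  finally have x0: "AE t in lborel. x t = 0" by (intro sqn_eq_0D xL) simp
  \<comment> \<open>By the inversion formula the transform of \<open>cnj (Ft ?y)\<close> is 2 pi
    times \<open>cnj (?y)\<close>, that is, 2 pi h.\<close>
  define H where "H t = 1 / (2 * pi) * cnj (Ft ?y t)" for t
  have HL: "H \<in> L2fun lborel" unfolding H_def[abs_def] by (intro L2fun_cmult L2fun_cnj FyL)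
  show thesis
  proof (rule that[OF HL])
    show "AE t in lborel. t \<in> T \<longrightarrow> H t = 0"
      using x0 by eventually_elim (auto simp: x_def H_def)
    show "AE \<omega> in lborel. h \<omega> = Ft H \<omega>"
      using Ft_inversion[OF yL] Ft_cmult[OF L2fun_cnj[OF FyL], of "1 / (2 * pi)"]
      by eventually_elim (simp add: H_def[abs_def])
  qed
qed

section \<open>The functional and its mean-square error\<close>

lemma T_set_closed: "closed (T_set s N K)"
  unfolding T_set_def S_set_def by (intro closed_Un closed_UN) auto

lemma R_set_subset_T_set: "R_set s N K \<subseteq> T_set s N K"
  by (auto simp: R_set_def T_set_def)

lemma A_fun_eq_fourier1: "A_fun s N K a \<omega> = fourier1 (a_ext s N K a) (- \<omega>)"
  unfolding A_fun_def fourier1_def set_lebesgue_integral_def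
  by (intro Bochner_Integration.integral_cong) (auto simp: a_ext_def)

lemma a_ext_integrable:
  assumes "set_integrable lborel (R_set s N K) a"
  shows "integrable lborel (a_ext s N K a)"
proof -
  have "(\<lambda>t. indicator (R_set s N K) t *\<^sub>R a t) = a_ext s N K a"
    by (auto simp: a_ext_def fun_eq_iff)
  then show ?thesis using assms by (simp add: set_integrable_def)
qed

lemma A_fun_measurable:
  assumes "set_integrable lborel (R_set s N K) a"
  shows "A_fun s N K a \<in> borel_measurable borel"
proof -
  have [measurable]: "a_ext s N K a \<in> borel_measurable borel"
    using a_ext_integrable[OF assms] by auto
  show ?thesis unfolding A_fun_eq_fourier1[abs_def] by measurable
qed

lemma A_fun_bounded:
  assumes "set_integrable lborel (R_set s N K) a"
  obtains B where "B \<ge> 0" "\<And>\<omega>. cmod (A_fun s N K a \<omega>) \<le> B"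
  using that[of "LINT t|lborel. cmod (a_ext s N K a t)"] fourier1_bound[OF a_ext_integrable[OF assms]]
  by (simp add: A_fun_eq_fourier1)

text \<open>The noncausal Wiener filter: at each \<omega> it minimises |A - z|^2 f + |z|^2 g over
  complex z, without regard to which times are observed.\<close>

definition pointwise_opt :: "(real \<Rightarrow> complex) \<Rightarrow> (real \<Rightarrow> real) \<Rightarrow> (real \<Rightarrow> real) \<Rightarrow> real \<Rightarrow> complex" where
  "pointwise_opt A f g \<omega> = A \<omega> * complex_of_real (f \<omega> / (f \<omega> + g \<omega>))"

text \<open>Completing the square in h. The remainder is the error of the pointwise minimiser; for u
  = v = 0 all terms vanish, so the value of the quotient there does no harm.\<close>

lemma mse_pointwise:
  assumes "0 \<le> u" "0 \<le> (v :: real)"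
  shows "(cmod (A - h))\<^sup>2 * u + (cmod h)\<^sup>2 * v
    = (cmod (h - A * complex_of_real (u / (u + v))))\<^sup>2 * (u + v) + (cmod A)\<^sup>2 * (u * v / (u + v))"
proof (cases "u + v = 0")
  case True
  then have "u = 0" "v = 0" using assms by auto
  then show ?thesis by simp
next
  case False
  have "(cmod (h - A * complex_of_real k))\<^sup>2 = (cmod h)\<^sup>2 - 2 * (Re (A * cnj h) * k) + (cmod A)\<^sup>2 * k\<^sup>2" for k
    unfolding cmod_power2 by (simp add: power2_eq_square algebra_simps)
  then have "(cmod (h - A * complex_of_real (u / (u + v))))\<^sup>2 * (u + v) + (cmod A)\<^sup>2 * (u * v / (u + v))
     = ((cmod h)\<^sup>2 - 2 * (Re (A * cnj h) * (u / (u + v))) + (cmod A)\<^sup>2 * (u / (u + v))\<^sup>2) * (u + v) + (cmod A)\<^sup>2 * (u * v / (u + v))"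
    by (simp only:)
  also have "\<dots> = (cmod h)\<^sup>2 * (u + v) - 2 * Re (A * cnj h) * u + (cmod A)\<^sup>2 * u"
  proof -
    have "(x - 2 * (y * (u / (u + v))) + z * (u / (u + v))\<^sup>2) * (u + v) + z * (u * v / (u + v))
       = x * (u + v) - 2 * y * u + z * u" for x y z :: real
      using False by (simp add: divide_simps) (simp add: power2_eq_square algebra_simps)
    then show ?thesis .
  qed
  finally show ?thesis unfolding cmod_diff_sq by (simp add: algebra_simps)
qed

lemma pointwise_opt_L2fun:
  assumes f: "spectral_density f" and g: "spectral_density g"
    and A: "A \<in> borel_measurable borel" "\<And>\<omega>. cmod (A \<omega>) \<le> B"
  shows "pointwise_opt A f g \<in> L2fun (weighted (\<lambda>\<omega>. f \<omega> + g \<omega>))"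
proof (rule L2fun_weighted_bounded)
  show "AE \<omega> in lborel. cmod (pointwise_opt A f g \<omega>) \<le> B"
  proof (rule AE_I2)
    fix \<omega>
    have "\<bar>f \<omega> / (f \<omega> + g \<omega>)\<bar> \<le> 1"
      using f g by (intro abs_ratio_le_1) (auto simp: spectral_density_def)
    then have "cmod (pointwise_opt A f g \<omega>) \<le> cmod (A \<omega>)"
      unfolding pointwise_opt_def norm_mult norm_of_real by (intro mult_left_le) auto
    then show "cmod (pointwise_opt A f g \<omega>) \<le> B" using A(2) order_trans by blast
  qed
qed (use f g A in \<open>auto simp: spectral_density_def pointwise_opt_def[abs_def]\<close>)

text \<open>The last integral is independent of h, so minimising the error over \<open>L2s\<close>
  amounts to projecting \<open>pointwise_opt\<close> onto a closed span.\<close>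

lemma mse_eq_sqn:
  assumes f: "spectral_density f" and g: "spectral_density g"
    and a: "set_integrable lborel (R_set s N K) a"
    and h: "h \<in> L2fun (weighted (\<lambda>\<omega>. f \<omega> + g \<omega>))"
  shows "mse s N K a h f g = 1 / (2 * pi) *
     (sqn (weighted (\<lambda>\<omega>. f \<omega> + g \<omega>)) (\<lambda>\<omega>. h \<omega> - pointwise_opt (A_fun s N K a) f g \<omega>)
      + (LINT \<omega>|lborel. (cmod (A_fun s N K a \<omega>))\<^sup>2 * (f \<omega> * g \<omega> / (f \<omega> + g \<omega>))))"
proof -
  let ?A = "A_fun s N K a" and ?w = "\<lambda>\<omega>. f \<omega> + g \<omega>"
  let ?p = "pointwise_opt ?A f g"
  obtain B where B: "\<And>\<omega>. cmod (?A \<omega>) \<le> B" using A_fun_bounded[OF a] by blast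
  have fg0: "\<And>\<omega>. 0 \<le> f \<omega>" "\<And>\<omega>. 0 \<le> g \<omega>" and [measurable]: "f \<in> borel_measurable borel" "g \<in> borel_measurable borel"
    and fi: "integrable lborel f" "integrable lborel g"
    using f g by (auto simp: spectral_density_def)
  note [measurable] = A_fun_measurable[OF a]
  have w: "\<And>\<omega>. 0 \<le> ?w \<omega>" "integrable lborel ?w" and wm: "?w \<in> borel_measurable borel"
    using fg0 fi by auto
  have AL: "?A \<in> L2fun (weighted ?w)"
    by (rule L2fun_weighted_bounded[OF w]) (use B in auto)
  have pL: "?p \<in> L2fun (weighted ?w)"
    by (rule pointwise_opt_L2fun[OF f g]) (use B in auto)
  have [measurable]: "h \<in> borel_measurable borel" "?p \<in> borel_measurable borel"
    using L2fun_measurable[OF h] L2fun_measurable[OF pL] by auto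
  have part: "integrable lborel (\<lambda>\<omega>. (cmod (z \<omega>))\<^sup>2 * u \<omega>)"
    if z: "z \<in> L2fun (weighted ?w)" and [measurable]: "u \<in> borel_measurable borel" and u: "\<And>\<omega>. 0 \<le> u \<omega> \<and> u \<omega> \<le> ?w \<omega>" for z u
  proof (rule Bochner_Integration.integrable_bound)
    show "integrable lborel (\<lambda>\<omega>. (cmod (z \<omega>))\<^sup>2 * ?w \<omega>)"
      using z L2fun_weighted[OF w(1) wm] by blast
    show "AE \<omega> in lborel. norm ((cmod (z \<omega>))\<^sup>2 * u \<omega>) \<le> norm ((cmod (z \<omega>))\<^sup>2 * ?w \<omega>)"
      using u w(1) by (auto simp: abs_mult intro!: mult_left_mono)
    show "(\<lambda>\<omega>. (cmod (z \<omega>))\<^sup>2 * u \<omega>) \<in> borel_measurable lborel"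
      using L2fun_measurable[OF z] by simp
  qed
  have i1: "integrable lborel (\<lambda>\<omega>. (cmod (?A \<omega> - h \<omega>))\<^sup>2 * f \<omega>)"
    by (rule part[OF L2fun_diff[OF AL h]]) (use fg0 in auto)
  have i2: "integrable lborel (\<lambda>\<omega>. (cmod (h \<omega>))\<^sup>2 * g \<omega>)"
    by (rule part[OF h]) (use fg0 in auto)
  have i3: "integrable lborel (\<lambda>\<omega>. (cmod (h \<omega> - ?p \<omega>))\<^sup>2 * ?w \<omega>)"
    by (rule part[OF L2fun_diff[OF h pL]]) (use w wm in auto)
  have fgw: "0 \<le> f \<omega> * g \<omega> / (f \<omega> + g \<omega>) \<and> f \<omega> * g \<omega> / (f \<omega> + g \<omega>) \<le> f \<omega> + g \<omega>" for \<omega>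
  proof (cases "f \<omega> + g \<omega> = 0")
    case False
    then have "0 < f \<omega> + g \<omega>" using fg0 by (simp add: less_le)
    moreover have "f \<omega> * g \<omega> \<le> (f \<omega> + g \<omega>) * (f \<omega> + g \<omega>)"
      by (intro mult_mono) (use fg0 in auto)
    ultimately show ?thesis using fg0 by (simp add: divide_le_eq)
  qed simp
  have i4: "integrable lborel (\<lambda>\<omega>. (cmod (?A \<omega>))\<^sup>2 * (f \<omega> * g \<omega> / (f \<omega> + g \<omega>)))"
    by (rule part[OF AL]) (use fgw in auto)
  have "mse s N K a h f g = 1 / (2 * pi) * (LINT \<omega>|lborel. (cmod (?A \<omega> - h \<omega>))\<^sup>2 * f \<omega> + (cmod (h \<omega>))\<^sup>2 * g \<omega>)"
    unfolding mse_def Bochner_Integration.integral_add[OF i1 i2] by (rule distrib_left[symmetric])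
  also have "(\<lambda>\<omega>. (cmod (?A \<omega> - h \<omega>))\<^sup>2 * f \<omega> + (cmod (h \<omega>))\<^sup>2 * g \<omega>)
     = (\<lambda>\<omega>. (cmod (h \<omega> - ?p \<omega>))\<^sup>2 * ?w \<omega> + (cmod (?A \<omega>))\<^sup>2 * (f \<omega> * g \<omega> / (f \<omega> + g \<omega>)))"
    unfolding pointwise_opt_def by (intro ext mse_pointwise fg0)
  also have "(LINT \<omega>|lborel. (cmod (h \<omega> - ?p \<omega>))\<^sup>2 * ?w \<omega> + (cmod (?A \<omega>))\<^sup>2 * (f \<omega> * g \<omega> / (f \<omega> + g \<omega>)))
     = sqn (weighted ?w) (\<lambda>\<omega>. h \<omega> - ?p \<omega>) + (LINT \<omega>|lborel. (cmod (?A \<omega>))\<^sup>2 * (f \<omega> * g \<omega> / (f \<omega> + g \<omega>)))"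
    unfolding Bochner_Integration.integral_add[OF i3 i4] by (subst sqn_weighted[OF w(1) wm]) auto
  finally show ?thesis .
qed

lemma L2s_subset_L2fun:
  assumes "spectral_density f" "spectral_density g"
  shows "L2s s N K f g \<subseteq> L2fun (weighted (\<lambda>\<omega>. f \<omega> + g \<omega>))"
  unfolding L2s_eq_trig_span[OF assms] by (auto simp: trig_span_def)

text \<open>\<open>opt_char\<close> is an \<open>arg_min\<close>, so this needs the existence of a minimiser.\<close>

lemma opt_mse_le:
  assumes f: "spectral_density f" and g: "spectral_density g"
    and a: "set_integrable lborel (R_set s N K) a" and h: "h \<in> L2s s N K f g"
  shows "opt_mse s N K a f g \<le> mse s N K a h f g"
proof -
  let ?w = "\<lambda>\<omega>. f \<omega> + g \<omega>" and ?p = "pointwise_opt (A_fun s N K a) f g"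
  obtain B where B: "\<And>\<omega>. cmod (A_fun s N K a \<omega>) \<le> B" using A_fun_bounded[OF a] by blast
  have w: "\<And>\<omega>. 0 \<le> ?w \<omega>" "integrable lborel ?w"
    using f g by (auto simp: spectral_density_def)
  have pL: "?p \<in> L2fun (weighted ?w)"
    by (rule pointwise_opt_L2fun[OF f g A_fun_measurable[OF a] B])
  obtain k where k: "k \<in> L2s s N K f g"
    "\<And>k'. k' \<in> L2s s N K f g \<Longrightarrow> sqn (weighted ?w) (\<lambda>\<omega>. k \<omega> - ?p \<omega>) \<le> sqn (weighted ?w) (\<lambda>\<omega>. k' \<omega> - ?p \<omega>)"
    unfolding L2s_eq_trig_span[OF f g] using trig_span_projection[OF w pL] by blast
  have le: "mse s N K a k f g \<le> mse s N K a k' f g" if "k' \<in> L2s s N K f g" for k'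
  proof -
    have "k \<in> L2fun (weighted ?w)" "k' \<in> L2fun (weighted ?w)"
      using k(1) that L2s_subset_L2fun[OF f g] by blast+
    then show ?thesis
      using k(2)[OF that] by (simp add: mse_eq_sqn[OF f g a] divide_right_mono)
  qed
  show ?thesis
    unfolding opt_mse_def opt_char_def
    by (rule arg_minI[of "\<lambda>h. h \<in> L2s s N K f g" k]) (use k(1) le h in \<open>auto simp: not_less\<close>)
qed

section \<open>Orthogonality to the observations and extremality on the two balls\<close>

lemma trig_span_orthogonal:
  assumes w: "\<And>\<omega>. 0 \<le> w \<omega>" "integrable lborel w"
    and D: "D \<in> L2fun (weighted w)"
    and o: "\<And>t. t \<in> U \<Longrightarrow> (LINT \<omega>|weighted w. cis (t * \<omega>) * cnj (D \<omega>)) = 0"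
    and h: "h \<in> trig_span U (weighted w)"
  shows "(LINT \<omega>|weighted w. h \<omega> * cnj (D \<omega>)) = 0"
proof -
  have cL: "(\<lambda>\<omega>. cis (t * \<omega>)) \<in> L2fun (weighted w)" for t
    by (rule L2fun_weighted_bounded[OF w, of _ 1]) auto
  have hL: "h \<in> L2fun (weighted w)" using h by (simp add: trig_span_def)
  note DL = L2fun_cnj[OF D]
  have p0: "(LINT \<omega>|weighted w. trig_sum F c \<omega> * cnj (D \<omega>)) = 0" if "F \<subseteq> U" for F c
  proof -
    have "(LINT \<omega>|weighted w. trig_sum F c \<omega> * cnj (D \<omega>))
       = (LINT \<omega>|weighted w. (\<Sum>t\<in>F. c t * (cis (t * \<omega>) * cnj (D \<omega>))))"
      by (simp add: trig_sum_def sum_distrib_right mult.assoc)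
    also have "\<dots> = (\<Sum>t\<in>F. LINT \<omega>|weighted w. c t * (cis (t * \<omega>) * cnj (D \<omega>)))"
      by (intro Bochner_Integration.integral_sum integrable_mult_right L2fun_mult_integrable cL DL)
    also have "\<dots> = 0"
      using o that by (intro sum.neutral) auto
    finally show ?thesis .
  qed
  have "cmod (LINT \<omega>|weighted w. h \<omega> * cnj (D \<omega>)) \<le> e" if e: "e > 0" for e
  proof -
    define d where "d = e\<^sup>2 / (sqn (weighted w) D + 1)"
    have P: "0 < sqn (weighted w) D + 1" by (simp add: add_nonneg_pos)
    have dp: "d > 0" unfolding d_def using P e by simp
    obtain F c where F: "F \<subseteq> U" "sqn (weighted w) (\<lambda>\<omega>. h \<omega> - trig_sum F c \<omega>) < d"
      using trig_span_approx[OF h dp] by blast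
    have zL: "(\<lambda>\<omega>. h \<omega> - trig_sum F c \<omega>) \<in> L2fun (weighted w)"
      by (intro L2fun_diff hL trig_sum_L2fun w)
    have "(LINT \<omega>|weighted w. h \<omega> * cnj (D \<omega>))
       = (LINT \<omega>|weighted w. h \<omega> * cnj (D \<omega>)) - (LINT \<omega>|weighted w. trig_sum F c \<omega> * cnj (D \<omega>))"
      using p0[OF F(1)] by simp
    also have "\<dots> = (LINT \<omega>|weighted w. (h \<omega> - trig_sum F c \<omega>) * cnj (D \<omega>))"
      using L2fun_mult_integrable[OF hL DL] L2fun_mult_integrable[OF trig_sum_L2fun[OF w] DL]
      by (simp add: left_diff_distrib)
    also have "cmod \<dots> \<le> sqrt (sqn (weighted w) (\<lambda>\<omega>. h \<omega> - trig_sum F c \<omega>) * sqn (weighted w) (\<lambda>\<omega>. cnj (D \<omega>)))"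
      by (rule Cauchy_Schwarz_integral[OF zL DL])
    also have "\<dots> \<le> sqrt (e\<^sup>2)"
    proof (rule real_sqrt_le_mono)
      have "sqn (weighted w) (\<lambda>\<omega>. h \<omega> - trig_sum F c \<omega>) * sqn (weighted w) (\<lambda>\<omega>. cnj (D \<omega>)) \<le> d * (sqn (weighted w) D + 1)"
        by (intro mult_mono) (use F(2) dp in \<open>auto simp: sqn_def\<close>)
      also have "\<dots> = e\<^sup>2" using P by (simp add: d_def)
      finally show "sqn (weighted w) (\<lambda>\<omega>. h \<omega> - trig_sum F c \<omega>) * sqn (weighted w) (\<lambda>\<omega>. cnj (D \<omega>)) \<le> e\<^sup>2" .
    qed
    finally show ?thesis using e by simp
  qed
  then have "cmod (LINT \<omega>|weighted w. h \<omega> * cnj (D \<omega>)) \<le> 0"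
    by (rule field_le_epsilon[of _ 0, simplified])
  then show ?thesis by simp
qed

text \<open>Pointwise, P (f - f1) \<le> c |f - f1|, with equality for f = f0: where f0 > f1 because
  P = c, where f0 < f1 because c = 0 and hence P = 0. After integration f0 wins, as it is at least
  as far from f1 as f is.\<close>

lemma L1_ball_saddle:
  fixes f f0 f1 P :: "real \<Rightarrow> real"
  assumes f1: "integrable lborel f1" and f0: "integrable lborel f0" and f: "integrable lborel f"
    and le: "(LINT \<omega>|lborel. \<bar>f \<omega> - f1 \<omega>\<bar>) \<le> (LINT \<omega>|lborel. \<bar>f0 \<omega> - f1 \<omega>\<bar>)"
    and P: "P \<in> borel_measurable borel" "AE \<omega> in lborel. 0 \<le> P \<omega> \<and> P \<omega> \<le> c"
    and P_up: "AE \<omega> in lborel. f1 \<omega> < f0 \<omega> \<longrightarrow> P \<omega> = c"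
    and P_dn: "AE \<omega> in lborel. f0 \<omega> < f1 \<omega> \<longrightarrow> c = 0"
  shows "(LINT \<omega>|lborel. P \<omega> * f \<omega>) \<le> (LINT \<omega>|lborel. P \<omega> * f0 \<omega>)"
proof -
  \<comment> \<open>Lebesgue measure is not zero, so a property that holds almost everywhere holds
    at some point.\<close>
  have c0: "0 \<le> c"
  proof -
    have "ae_filter (lborel :: real measure) \<noteq> bot" by (simp add: ae_filter_eq_bot_iff)
    from eventually_happens'[OF this P(2)] show ?thesis by auto
  qed
  have Pi: "integrable lborel (\<lambda>\<omega>. P \<omega> * u \<omega>)" if u: "integrable lborel u" for u :: "real \<Rightarrow> real"
  proof (rule Bochner_Integration.integrable_bound[OF integrable_mult_right[OF u, of c]])
    show "AE \<omega> in lborel. norm (P \<omega> * u \<omega>) \<le> norm (c * u \<omega>)"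
      using P(2) by eventually_elim (auto simp: abs_mult intro!: mult_right_mono)
  qed (use P u in auto)
  have "(LINT \<omega>|lborel. P \<omega> * f \<omega>) - (LINT \<omega>|lborel. P \<omega> * f0 \<omega>) = (LINT \<omega>|lborel. P \<omega> * f \<omega> - P \<omega> * f0 \<omega>)"
    using Pi[OF f] Pi[OF f0] by simp
  also have "\<dots> \<le> (LINT \<omega>|lborel. c * \<bar>f \<omega> - f1 \<omega>\<bar> - c * \<bar>f0 \<omega> - f1 \<omega>\<bar>)"
  proof (rule integral_mono_AE)
    show "AE \<omega> in lborel. P \<omega> * f \<omega> - P \<omega> * f0 \<omega> \<le> c * \<bar>f \<omega> - f1 \<omega>\<bar> - c * \<bar>f0 \<omega> - f1 \<omega>\<bar>"
      using P(2) P_up P_dn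
    proof eventually_elim
      case (elim \<omega>)
      have "P \<omega> * (f \<omega> - f1 \<omega>) \<le> P \<omega> * \<bar>f \<omega> - f1 \<omega>\<bar>"
        using elim(1) by (intro mult_left_mono) auto
      also have "\<dots> \<le> c * \<bar>f \<omega> - f1 \<omega>\<bar>"
        using elim(1) by (intro mult_right_mono) auto
      finally have 1: "P \<omega> * (f \<omega> - f1 \<omega>) \<le> c * \<bar>f \<omega> - f1 \<omega>\<bar>" .
      have 2: "P \<omega> * (f0 \<omega> - f1 \<omega>) = c * \<bar>f0 \<omega> - f1 \<omega>\<bar>"
      proof (cases "f0 \<omega> < f1 \<omega>")
        case True
        then have "c = 0" "P \<omega> = 0" using elim by auto
        then show ?thesis by simp
      next
        case False
        then show ?thesis using elim(2) by (cases "f1 \<omega> < f0 \<omega>") auto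
      qed
      from 1 2 show ?case by (simp add: right_diff_distrib)
    qed
  qed (use Pi[OF f] Pi[OF f0] f f0 f1 in auto)
  also have "\<dots> = c * ((LINT \<omega>|lborel. \<bar>f \<omega> - f1 \<omega>\<bar>) - (LINT \<omega>|lborel. \<bar>f0 \<omega> - f1 \<omega>\<bar>))"
    using f f0 f1 by (simp add: right_diff_distrib)
  also have "\<dots> \<le> 0" using le c0 by (simp add: mult_le_0_iff)
  finally show ?thesis by simp
qed

text \<open>The product (g0 - g1) (g - g0) is half of |g - g1|^2 - |g0 - g1|^2 - |g - g0|^2.
  Dropping the last square leaves the difference of two squared distances, which is at most 0 after
  integration. The bound c makes the products with integrable densities integrable.\<close>

lemma L2_ball_saddle:
  fixes g g0 g1 Q :: "real \<Rightarrow> real"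
  assumes g0: "integrable lborel g0" "integrable lborel (\<lambda>\<omega>. \<bar>g0 \<omega> - g1 \<omega>\<bar>\<^sup>2)"
    and g: "integrable lborel g" "integrable lborel (\<lambda>\<omega>. \<bar>g \<omega> - g1 \<omega>\<bar>\<^sup>2)"
    and le: "(LINT \<omega>|lborel. \<bar>g \<omega> - g1 \<omega>\<bar>\<^sup>2) \<le> (LINT \<omega>|lborel. \<bar>g0 \<omega> - g1 \<omega>\<bar>\<^sup>2)"
    and Q: "Q \<in> borel_measurable borel" "AE \<omega> in lborel. \<bar>Q \<omega>\<bar> \<le> c"
    and Q_eq: "AE \<omega> in lborel. Q \<omega> = \<alpha> * (g0 \<omega> - g1 \<omega>)" and \<alpha>: "0 \<le> \<alpha>"
  shows "(LINT \<omega>|lborel. Q \<omega> * g \<omega>) \<le> (LINT \<omega>|lborel. Q \<omega> * g0 \<omega>)"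
proof -
  have Qi: "integrable lborel (\<lambda>\<omega>. Q \<omega> * u \<omega>)" if u: "integrable lborel u" for u :: "real \<Rightarrow> real"
  proof (rule Bochner_Integration.integrable_bound[OF integrable_mult_right[OF u, of c]])
    show "AE \<omega> in lborel. norm (Q \<omega> * u \<omega>) \<le> norm (c * u \<omega>)"
      using Q(2) by eventually_elim (auto simp: abs_mult intro!: mult_right_mono)
  qed (use Q u in auto)
  have "(LINT \<omega>|lborel. Q \<omega> * g \<omega>) - (LINT \<omega>|lborel. Q \<omega> * g0 \<omega>) = (LINT \<omega>|lborel. Q \<omega> * g \<omega> - Q \<omega> * g0 \<omega>)"
    using Qi[OF g(1)] Qi[OF g0(1)] by simp
  also have "\<dots> \<le> (LINT \<omega>|lborel. \<alpha> / 2 * \<bar>g \<omega> - g1 \<omega>\<bar>\<^sup>2 - \<alpha> / 2 * \<bar>g0 \<omega> - g1 \<omega>\<bar>\<^sup>2)"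
  proof (rule integral_mono_AE)
    show "AE \<omega> in lborel. Q \<omega> * g \<omega> - Q \<omega> * g0 \<omega> \<le> \<alpha> / 2 * \<bar>g \<omega> - g1 \<omega>\<bar>\<^sup>2 - \<alpha> / 2 * \<bar>g0 \<omega> - g1 \<omega>\<bar>\<^sup>2"
      using Q_eq
    proof eventually_elim
      case (elim \<omega>)
      have "0 \<le> \<alpha> / 2 * (g \<omega> - g0 \<omega>)\<^sup>2" using \<alpha> by simp
      then show ?case unfolding elim power2_abs by (simp add: power2_eq_square field_simps)
    qed
  qed (use Qi[OF g(1)] Qi[OF g0(1)] g g0 in auto)
  also have "\<dots> = \<alpha> / 2 * ((LINT \<omega>|lborel. \<bar>g \<omega> - g1 \<omega>\<bar>\<^sup>2) - (LINT \<omega>|lborel. \<bar>g0 \<omega> - g1 \<omega>\<bar>\<^sup>2))"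
    using g g0 by (simp add: right_diff_distrib)
  also have "\<dots> \<le> 0" using le \<alpha> by (intro mult_nonneg_nonpos) auto
  finally show ?thesis by simp
qed

text \<open>The third conjunct accounts for the definite article in speaking of the minimax-robust
  characteristic, which can be determined only up to a null set.\<close>

theorem theorem4p1:
  fixes s :: nat and N K :: "nat \<Rightarrow> real" and a :: "real \<Rightarrow> complex"
    and f1 g1 f0 g0 \<Psi> :: "real \<Rightarrow> real" and \<epsilon>1 \<epsilon>2 \<alpha>1 \<alpha>2 :: real
  defines "A \<equiv> A_fun s N K a"
    and "C0 \<equiv> C_fun s N K a f0 g0"
    and "D \<equiv> D1_class f1 \<epsilon>1 \<times> D2_class g1 \<epsilon>2"
    and "h0 \<equiv> (\<lambda>\<omega>. A_fun s N K a \<omega> * complex_of_real (f0 \<omega> / (f0 \<omega> + g0 \<omega>))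
                     - C_fun s N K a f0 g0 \<omega> / complex_of_real (f0 \<omega> + g0 \<omega>))"
  assumes s: "s \<ge> 1"
    and NK0: "N 0 = 0" "K 0 = 0"
    and NK_pos: "\<And>l. l \<in> {1..s} \<Longrightarrow> N l > 0 \<and> K l > 0"
    and disj: "disjoint_family_on (\<lambda>l. {Msum N K l .. Msum N K l + N l}) {1..s}"
    and a_L1: "set_integrable lborel (R_set s N K) a"
    and a_weighted: "set_integrable lborel (R_set s N K) (\<lambda>t. t * (cmod (a t))\<^sup>2)"
    and a_L2: "a_ext s N K a \<in> L2_space (T_set s N K)"
    and f1: "spectral_density f1" "bounded (range f1)"
    and g1: "spectral_density g1" "bounded (range g1)"
    and eps: "\<epsilon>1 > 0" "\<epsilon>2 > 0"
    and f0: "f0 \<in> D1_class f1 \<epsilon>1"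
    and g0: "g0 \<in> D2_class g1 \<epsilon>2"
    and minimal: "minimality f0 g0"
    and B0_inv: "B_invertible (T_set s N K) f0 g0"
    and hf_bounded: "\<exists>b. AE \<omega> in lborel.
          (cmod (A \<omega> * g0 \<omega> + C0 \<omega>))\<^sup>2 / (f0 \<omega> + g0 \<omega>)\<^sup>2 \<le> b"
    and hg_bounded: "\<exists>b. AE \<omega> in lborel.
          (cmod (A \<omega> * f0 \<omega> - C0 \<omega>))\<^sup>2 / (f0 \<omega> + g0 \<omega>)\<^sup>2 \<le> b"
    and alpha: "\<alpha>1 \<ge> 0" "\<alpha>2 \<ge> 0"
    and Psi_le: "\<And>\<omega>. \<bar>\<Psi> \<omega>\<bar> \<le> 1"
    and Psi_sgn: "\<And>\<omega>. f0 \<omega> \<noteq> f1 \<omega> \<Longrightarrow> \<Psi> \<omega> = sgn (f0 \<omega> - f1 \<omega>)"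
    and eq_f: "AE \<omega> in lborel.
          cmod (A \<omega> * g0 \<omega> + C0 \<omega>) = (f0 \<omega> + g0 \<omega>) * \<Psi> \<omega> * \<alpha>1"
    and eq_g: "AE \<omega> in lborel.
          (cmod (A \<omega> * f0 \<omega> - C0 \<omega>))\<^sup>2 = (f0 \<omega> + g0 \<omega>)\<^sup>2 * (g0 \<omega> - g1 \<omega>) * \<alpha>2"
    and norm_f: "1 / (2 * pi) * (LINT \<omega>|lborel. \<bar>f0 \<omega> - f1 \<omega>\<bar>) = \<epsilon>1"
    and norm_g: "1 / (2 * pi) * (LINT \<omega>|lborel. \<bar>g0 \<omega> - g1 \<omega>\<bar>\<^sup>2) = \<epsilon>2"
    and optimum: "\<forall>(f, g)\<in>D. objective s N K a f g \<le> operator_error s N K a f0 g0"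
  shows "least_favorable s N K a D f0 g0 \<and>
         minimax_robust s N K a D h0 \<and>
         (\<forall>h. minimax_robust s N K a D h \<longrightarrow> (AE \<omega> in lborel. h \<omega> = h0 \<omega>))"
proof -
  let ?T = "T_set s N K" and ?b = "a_ext s N K a"
  define w where "w \<omega> = f0 \<omega> + g0 \<omega>" for \<omega>
  define M where "M = weighted w"
  have f0s: "spectral_density f0" and g0s: "spectral_density g0"
    using f0 g0 by (auto simp: D1_class_def D2_class_def)
  have fg0: "\<And>\<omega>. 0 \<le> f0 \<omega>" "\<And>\<omega>. 0 \<le> g0 \<omega>" and [measurable]: "f0 \<in> borel_measurable borel" "g0 \<in> borel_measurable borel"
    and fgi: "integrable lborel f0" "integrable lborel g0"
    using f0s g0s by (auto simp: spectral_density_def)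
  have f1i: "integrable lborel f1" and g1i: "integrable lborel g1" and [measurable]: "g1 \<in> borel_measurable borel"
    using f1 g1 by (auto simp: spectral_density_def)
  have w: "\<And>\<omega>. 0 \<le> w \<omega>" "integrable lborel w" and wm [measurable]: "w \<in> borel_measurable borel"
    using fg0 fgi by (auto simp: w_def[abs_def])
  have wpos: "AE \<omega> in lborel. 0 < w \<omega>"
    unfolding w_def by (rule minimality_imp_AE_pos[OF f0s g0s minimal])
  have T: "?T \<in> sets borel" "open (- ?T)"
    using T_set_closed[of s N K] by (auto simp: open_Compl)
  have bi: "integrable lborel ?b" by (rule a_ext_integrable[OF a_L1])
  have bT: "?b t = 0" if "t \<notin> ?T" for t
    using that R_set_subset_T_set[of s N K] by (auto simp: a_ext_def)
  have "(\<lambda>t. indicator ?T t *\<^sub>R ?b t) = ?b"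
    using bT by (auto simp: fun_eq_iff indicator_def)
  then have bL: "?b \<in> L2fun lborel" using a_L2 by (simp add: L2_space_iff)
  have C0_eq: "C0 = L2_fourier ?T (B_inv ?T f0 g0 (R_op ?T f0 g0 ?b))"
    by (simp add: C0_def C_fun_def Let_def)
  note A_m [measurable] = A_fun_measurable[OF a_L1, folded A_def]
  obtain BA where BA: "BA \<ge> 0" "\<And>\<omega>. cmod (A \<omega>) \<le> BA"
    using A_fun_bounded[OF a_L1] unfolding A_def by blast
  have h0_fold: "h0 = (\<lambda>\<omega>. A \<omega> * complex_of_real (f0 \<omega> / (f0 \<omega> + g0 \<omega>)) - C0 \<omega> / complex_of_real (f0 \<omega> + g0 \<omega>))"
    unfolding h0_def A_def C0_def ..
  have h0_f1: "h0 = (\<lambda>\<omega>. fourier1 ?b (- \<omega>) * complex_of_real (f0 \<omega> / (f0 \<omega> + g0 \<omega>))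
      - L2_fourier ?T (B_inv ?T f0 g0 (R_op ?T f0 g0 ?b)) \<omega> / complex_of_real (f0 \<omega> + g0 \<omega>))"
    unfolding h0_fold C0_eq A_def A_fun_eq_fourier1 ..
  have h0_quot: "h0 \<omega> = (A \<omega> * f0 \<omega> - C0 \<omega>) / complex_of_real (f0 \<omega> + g0 \<omega>)" for \<omega>
    by (simp add: h0_fold diff_divide_distrib)
  have Ah0: "A \<omega> - h0 \<omega> = (A \<omega> * g0 \<omega> + C0 \<omega>) / complex_of_real (f0 \<omega> + g0 \<omega>)" if "0 < w \<omega>" for \<omega>
  proof -
    have "complex_of_real (f0 \<omega> + g0 \<omega>) \<noteq> 0" using that unfolding w_def of_real_eq_0_iff by simp
    then show ?thesis unfolding h0_quot by (simp add: field_simps)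
  qed
  obtain bh where bh: "AE \<omega> in lborel. (cmod (A \<omega> * f0 \<omega> - C0 \<omega>))\<^sup>2 / (f0 \<omega> + g0 \<omega>)\<^sup>2 \<le> bh"
    using hg_bounded by blast
  have h0_sq: "(cmod (h0 \<omega>))\<^sup>2 = (cmod (A \<omega> * f0 \<omega> - C0 \<omega>))\<^sup>2 / (f0 \<omega> + g0 \<omega>)\<^sup>2" for \<omega>
    unfolding h0_quot norm_divide norm_of_real power_divide power2_abs ..
  have h0_bd: "AE \<omega> in lborel. cmod (h0 \<omega>) \<le> sqrt bh"
    using bh by eventually_elim (intro real_le_rsqrt, simp only: h0_sq)
  have Q_eq: "AE \<omega> in lborel. (cmod (h0 \<omega>))\<^sup>2 = \<alpha>2 * (g0 \<omega> - g1 \<omega>)"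
    using eq_g wpos by eventually_elim (simp add: h0_sq w_def)
  have "R_op ?T f0 g0 ?b \<in> L2_space ?T"
    unfolding L2_space_iff by (intro L2fun_restrict T(1) R_op_L2fun(3) bL bT f0s g0s)
  note Bop = B_op_B_inv[OF B0_inv this]
  define c where "c t = indicator ?T t *\<^sub>R B_inv ?T f0 g0 (R_op ?T f0 g0 ?b) t" for t
  have cL: "c \<in> L2fun lborel" unfolding c_def[abs_def] by (rule B_inv_L2fun[OF Bop])
  have cT: "c t = 0" if "t \<notin> ?T" for t using that by (simp add: c_def)
  have C0_Ft: "C0 = Ft c" unfolding C0_eq c_def[abs_def] by (rule L2_fourier_set)
  have C0_m [measurable]: "C0 \<in> borel_measurable borel"
    unfolding C0_Ft by (rule Ft_measurable[OF cL])
  have h0_m [measurable]: "h0 \<in> borel_measurable borel"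
    unfolding h0_fold by measurable
  have h0L: "h0 \<in> L2fun lborel"
  proof -
    have "integrable lborel (\<lambda>\<omega>. (cmod (h0 \<omega>))\<^sup>2)"
      by (rule integrable_cong_AE_imp[of _ "\<lambda>\<omega>. \<alpha>2 * (g0 \<omega> - g1 \<omega>)"]) (use Q_eq fgi g1i in auto)
    then show ?thesis by (simp add: L2fun_def)
  qed
  have "\<exists>H. H \<in> L2fun lborel \<and> (AE t in lborel. t \<in> ?T \<longrightarrow> H t = 0) \<and> (AE \<omega> in lborel. h0 \<omega> = Ft H \<omega>)"
    by (rule optimal_char_spectrum[OF T(1) bL bi bT f0s g0s B0_inv h0L[unfolded h0_f1]])
       (assumption, intro exI conjI, assumption, assumption, simp only: h0_f1)
  then obtain H where H: "H \<in> L2fun lborel" "AE t in lborel. t \<in> ?T \<longrightarrow> H t = 0" "AE \<omega> in lborel. h0 \<omega> = Ft H \<omega>"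
    by blast
  \<comment> \<open>\<open>H\<close> and the bound \<open>sqrt bh\<close> come from (f0, g0) alone
    and refer to Lebesgue measure, so they serve every pair of the class.\<close>
  have h0_span: "h0 \<in> L2s s N K f g" if "(f, g) \<in> D" for f g
  proof -
    have fs: "spectral_density f" and gs: "spectral_density g"
      using that by (auto simp: D_def D1_class_def D2_class_def)
    have "AE t in lborel. t \<notin> - ?T \<longrightarrow> H t = 0" using H(2) by simp
    then show ?thesis
      unfolding L2s_eq_trig_span[OF fs gs]
      by (intro bounded_Ft_in_trig_span[OF _ H(1) _ h0_m H(3) h0_bd])
         (use T fs gs in \<open>auto simp: spectral_density_def\<close>)
  qed
  have D0: "(f0, g0) \<in> D" using f0 g0 by (simp add: D_def)

  \<comment> \<open>\<open>d\<close> is the part of \<open>pointwise_opt\<close> that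
    \<open>h0\<close> leaves out. In the geometry of \<open>M\<close> it has to be orthogonal to the
    observations, which is a statement about d w, that is, about C0.\<close>
  define d where "d \<omega> = C0 \<omega> / complex_of_real (w \<omega>)" for \<omega>
  have d_m [measurable]: "d \<in> borel_measurable borel" unfolding d_def by measurable
  have d_bd: "AE \<omega> in lborel. cmod (d \<omega>) \<le> BA + sqrt bh"
    using h0_bd
  proof eventually_elim
    case (elim \<omega>)
    have "d \<omega> = A \<omega> * complex_of_real (f0 \<omega> / (f0 \<omega> + g0 \<omega>)) - h0 \<omega>"
      by (simp add: d_def h0_fold w_def)
    moreover have "cmod (A \<omega> * complex_of_real (f0 \<omega> / (f0 \<omega> + g0 \<omega>))) \<le> cmod (A \<omega>)"
      unfolding norm_mult norm_of_real by (intro mult_left_le abs_ratio_le_1 fg0) simp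
    ultimately show ?case
      using BA(2)[of \<omega>] elim norm_triangle_ineq4[of "A \<omega> * complex_of_real (f0 \<omega> / (f0 \<omega> + g0 \<omega>))" "h0 \<omega>"] by simp
  qed
  have dL: "d \<in> L2fun M" unfolding M_def by (rule L2fun_weighted_bounded[OF w d_m d_bd])
  have C0_wd: "AE \<omega> in lborel. C0 \<omega> = d \<omega> * w \<omega>"
    using wpos by eventually_elim (simp add: d_def)
  \<comment> \<open>So far C0 is only square integrable. Integrability is what makes its transform
    continuous below.\<close>
  have C0i: "integrable lborel C0"
  proof (rule Bochner_Integration.integrable_bound[OF integrable_mult_right[OF w(2), of "BA + sqrt bh"]])
    show "AE \<omega> in lborel. norm (C0 \<omega>) \<le> norm ((BA + sqrt bh) * w \<omega>)"
      using C0_wd d_bd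
    proof eventually_elim
      case (elim \<omega>)
      have "norm (C0 \<omega>) = cmod (d \<omega>) * w \<omega>" unfolding elim(1) norm_mult using w(1) by simp
      also have "\<dots> \<le> (BA + sqrt bh) * w \<omega>" by (rule mult_right_mono[OF elim(2) w(1)])
      finally show ?case by simp
    qed
  qed simp
  have z0: "fourier1 (\<lambda>\<omega>. cnj (C0 \<omega>)) t = 0" if "t \<in> - ?T" for t
  proof (rule fourier1_zero_on_open[OF _ T(2) _ that])
    show i: "integrable lborel (\<lambda>\<omega>. cnj (C0 \<omega>))" using C0i by simp
    have L: "(\<lambda>\<omega>. cnj (C0 \<omega>)) \<in> L2fun lborel"
      unfolding C0_Ft by (intro L2fun_cnj Ft_L2 cL)
    show "AE t in lborel. t \<in> - ?T \<longrightarrow> fourier1 (\<lambda>\<omega>. cnj (C0 \<omega>)) t = 0"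
      using Ft_eq_fourier1[OF L i] Ft_inversion[OF cL, folded C0_Ft]
      by eventually_elim (use cT in auto)
  qed
  \<comment> \<open>The weight w turns \<open>d\<close> back into C0, so that pairing with an
    exponential evaluates the transform of cnj C0 at t.\<close>
  have e0: "(LINT \<omega>|M. cis (t * \<omega>) * cnj (d \<omega>)) = 0" if "t \<in> - ?T" for t
  proof -
    have "(LINT \<omega>|M. cis (t * \<omega>) * cnj (d \<omega>)) = (LINT \<omega>|lborel. w \<omega> *\<^sub>R (cis (t * \<omega>) * cnj (d \<omega>)))"
      unfolding M_def weighted_def by (rule integral_density) (use w in auto)
    also have "\<dots> = fourier1 (\<lambda>\<omega>. cnj (C0 \<omega>)) t"
      unfolding fourier1_def
    proof (rule integral_cong_AE)
      show "AE \<omega> in lborel. w \<omega> *\<^sub>R (cis (t * \<omega>) * cnj (d \<omega>)) = cnj (C0 \<omega>) * cis (\<omega> * t)"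
        using C0_wd by eventually_elim (simp add: scaleR_conv_of_real mult_ac)
    qed measurable
    finally show ?thesis using z0[OF that] by simp
  qed
  have L2s0: "L2s s N K f0 g0 = trig_span (- ?T) M"
    unfolding M_def w_def[abs_def] by (rule L2s_eq_trig_span[OF f0s g0s])
  have spanL: "h \<in> L2fun M" if "h \<in> L2s s N K f0 g0" for h
    using that by (simp add: L2s0 trig_span_def)
  have orth: "(LINT \<omega>|M. h \<omega> * cnj (d \<omega>)) = 0" if "h \<in> L2s s N K f0 g0" for h
    by (rule trig_span_orthogonal[OF w, folded M_def, OF dL _ that[unfolded L2s0]]) (rule e0)
  let ?p = "pointwise_opt A f0 g0"
  have h0p: "h0 \<omega> - ?p \<omega> = - d \<omega>" for \<omega>
    by (simp add: h0_fold pointwise_opt_def d_def w_def)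
  \<comment> \<open>Pythagoras: h - h0 lies in the space of the observations, and \<open>d\<close>
    is orthogonal to it. As the excess over the error of \<open>h0\<close> is explicit, this yields
    both minimality and uniqueness.\<close>
  have mse_expand: "mse s N K a h f0 g0 = mse s N K a h0 f0 g0 + 1 / (2 * pi) * sqn M (\<lambda>\<omega>. h \<omega> - h0 \<omega>)"
    if h: "h \<in> L2s s N K f0 g0" for h
  proof -
    note hL = spanL[OF h] and h0s = h0_span[OF D0]
    have hdL: "(\<lambda>\<omega>. h \<omega> - h0 \<omega>) \<in> L2fun M" by (rule L2fun_diff[OF hL spanL[OF h0s]])
    have "sqn M (\<lambda>\<omega>. h \<omega> - ?p \<omega>) = sqn M (\<lambda>\<omega>. (h \<omega> - h0 \<omega>) - d \<omega>)"
    proof -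
      have "h \<omega> - ?p \<omega> = (h \<omega> - h0 \<omega>) - d \<omega>" for \<omega>
        using h0p[of \<omega>] by (simp add: algebra_simps)
      then show ?thesis by (simp only:)
    qed
    also have "\<dots> = sqn M (\<lambda>\<omega>. h \<omega> - h0 \<omega>) + sqn M d"
    proof -
      have "(LINT \<omega>|M. (h \<omega> - h0 \<omega>) * cnj (d \<omega>)) = (LINT \<omega>|M. h \<omega> * cnj (d \<omega>)) - (LINT \<omega>|M. h0 \<omega> * cnj (d \<omega>))"
        using L2fun_mult_integrable[OF hL L2fun_cnj[OF dL]] L2fun_mult_integrable[OF spanL[OF h0s] L2fun_cnj[OF dL]]
        by (simp add: left_diff_distrib)
      then show ?thesis using orth[OF h] orth[OF h0s] sqn_diff_expand[OF hdL dL] by simp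
    qed
    also have "sqn M d = sqn M (\<lambda>\<omega>. h0 \<omega> - ?p \<omega>)"
      unfolding h0p by (simp add: sqn_def)
    finally show ?thesis
      using mse_eq_sqn[OF f0s g0s a_L1, folded A_def w_def[abs_def] M_def, OF hL]
        mse_eq_sqn[OF f0s g0s a_L1, folded A_def w_def[abs_def] M_def, OF spanL[OF h0s]]
      by (simp add: algebra_simps)
  qed
  have mse_min: "mse s N K a h0 f0 g0 \<le> mse s N K a h f0 g0" if "h \<in> L2s s N K f0 g0" for h
    unfolding mse_expand[OF that] by simp

  define P where "P \<omega> = (cmod (A \<omega> - h0 \<omega>))\<^sup>2" for \<omega>
  define Q where "Q \<omega> = (cmod (h0 \<omega>))\<^sup>2" for \<omega>
  have [measurable]: "P \<in> borel_measurable borel" "Q \<in> borel_measurable borel"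
    unfolding P_def Q_def by measurable
  have modP: "AE \<omega> in lborel. cmod (A \<omega> - h0 \<omega>) = \<Psi> \<omega> * \<alpha>1"
    using eq_f wpos
  proof eventually_elim
    case (elim \<omega>)
    have "cmod (A \<omega> - h0 \<omega>) = cmod (A \<omega> * g0 \<omega> + C0 \<omega>) / \<bar>f0 \<omega> + g0 \<omega>\<bar>"
      unfolding Ah0[OF elim(2)] norm_divide norm_of_real ..
    also have "\<dots> = \<Psi> \<omega> * \<alpha>1"
      using elim by (simp add: w_def)
    finally show ?case .
  qed
  have saddle: "mse s N K a h0 f g \<le> mse s N K a h0 f0 g0" if "(f, g) \<in> D" for f g
  proof -
    have fi: "integrable lborel f" and gi: "integrable lborel g" "integrable lborel (\<lambda>\<omega>. \<bar>g \<omega> - g1 \<omega>\<bar>\<^sup>2)"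
      and fle: "1 / (2 * pi) * (LINT \<omega>|lborel. \<bar>f \<omega> - f1 \<omega>\<bar>) \<le> \<epsilon>1"
      and gle: "1 / (2 * pi) * (LINT \<omega>|lborel. \<bar>g \<omega> - g1 \<omega>\<bar>\<^sup>2) \<le> \<epsilon>2"
      using that by (auto simp: D_def D1_class_def D2_class_def spectral_density_def)
    have g02: "integrable lborel (\<lambda>\<omega>. \<bar>g0 \<omega> - g1 \<omega>\<bar>\<^sup>2)"
      using g0 by (simp add: D2_class_def)
    have "(LINT \<omega>|lborel. P \<omega> * f \<omega>) \<le> (LINT \<omega>|lborel. P \<omega> * f0 \<omega>)"
    proof (rule L1_ball_saddle[OF f1i fgi(1) fi])
      \<comment> \<open>f0 lies on the sphere of radius \<epsilon>1 about f1 and f in the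
        ball.\<close>
      show "(LINT \<omega>|lborel. \<bar>f \<omega> - f1 \<omega>\<bar>) \<le> (LINT \<omega>|lborel. \<bar>f0 \<omega> - f1 \<omega>\<bar>)"
        using fle unfolding norm_f[symmetric] by (simp add: divide_right_mono field_simps)
      show "AE \<omega> in lborel. 0 \<le> P \<omega> \<and> P \<omega> \<le> \<alpha>1\<^sup>2"
        using modP
      proof eventually_elim
        case (elim \<omega>)
        have "\<bar>\<Psi> \<omega> * \<alpha>1\<bar> \<le> \<bar>\<alpha>1\<bar>"
          unfolding abs_mult using Psi_le[of \<omega>] by (intro mult_left_le_one_le) auto
        then have "(\<Psi> \<omega> * \<alpha>1)\<^sup>2 \<le> \<alpha>1\<^sup>2" by (simp only: abs_le_square_iff)
        then show ?case by (simp add: P_def elim)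
      qed
      show "AE \<omega> in lborel. f1 \<omega> < f0 \<omega> \<longrightarrow> P \<omega> = \<alpha>1\<^sup>2"
        using modP
      proof eventually_elim
        case (elim \<omega>)
        then show ?case using Psi_sgn[of \<omega>] by (auto simp: P_def)
      qed
      \<comment> \<open>Here \<open>\<Psi>\<close> is -1, so that the modulus |A - h0| equals
        -\<alpha>1 and cannot be negative.\<close>
      show "AE \<omega> in lborel. f0 \<omega> < f1 \<omega> \<longrightarrow> \<alpha>1\<^sup>2 = 0"
        using modP
      proof eventually_elim
        case (elim \<omega>)
        show ?case
        proof
          assume "f0 \<omega> < f1 \<omega>"
          then have "\<Psi> \<omega> = -1" using Psi_sgn[of \<omega>] by simp
          then have "0 \<le> - \<alpha>1" using elim norm_ge_zero[of "A \<omega> - h0 \<omega>"] by simp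
          then show "\<alpha>1\<^sup>2 = 0" using alpha(1) by simp
        qed
      qed
    qed measurable
    moreover have "(LINT \<omega>|lborel. Q \<omega> * g \<omega>) \<le> (LINT \<omega>|lborel. Q \<omega> * g0 \<omega>)"
    proof (rule L2_ball_saddle[OF fgi(2) g02 gi _ _ _ _ alpha(2)])
      show "(LINT \<omega>|lborel. \<bar>g \<omega> - g1 \<omega>\<bar>\<^sup>2) \<le> (LINT \<omega>|lborel. \<bar>g0 \<omega> - g1 \<omega>\<bar>\<^sup>2)"
        using gle unfolding norm_g[symmetric] by (simp add: divide_right_mono field_simps)
      show "AE \<omega> in lborel. \<bar>Q \<omega>\<bar> \<le> bh"
        using bh by eventually_elim (simp add: Q_def h0_sq)
      show "AE \<omega> in lborel. Q \<omega> = \<alpha>2 * (g0 \<omega> - g1 \<omega>)"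
        using Q_eq by (simp add: Q_def)
    qed measurable
    ultimately show ?thesis
      unfolding mse_def A_def[symmetric] P_def[symmetric] Q_def[symmetric]
      by (intro add_mono mult_left_mono) auto
  qed

  \<comment> \<open>The minimiser chosen by \<open>opt_char\<close> need not be \<open>h0\<close>,
    but by minimality of \<open>h0\<close> its error is no other.\<close>
  have opt0: "mse s N K a h0 f0 g0 \<le> opt_mse s N K a f0 g0"
    unfolding opt_mse_def opt_char_def
    by (rule arg_minI[of "\<lambda>h. h \<in> L2s s N K f0 g0" h0 "\<lambda>h. mse s N K a h f0 g0"])
       (use h0_span[OF D0] mse_min in \<open>auto simp: not_less\<close>)
  have lf: "least_favorable s N K a D f0 g0"
    unfolding least_favorable_def
  proof (intro conjI D0 ballI, clarify)
    fix f g assume fg: "(f, g) \<in> D"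
    then have "spectral_density f" "spectral_density g"
      by (auto simp: D_def D1_class_def D2_class_def)
    from opt_mse_le[OF this a_L1 h0_span[OF fg]] saddle[OF fg] opt0
    show "opt_mse s N K a f g \<le> opt_mse s N K a f0 g0" by linarith
  qed

  \<comment> \<open>For every admissible h, V h is at least the error of h at (f0, g0), which is at
    least that of \<open>h0\<close> there, which is at least V h0 by the saddle inequality. Equality
    in this chain will give uniqueness.\<close>
  define V where "V h = (SUP (f, g)\<in>D. ereal (mse s N K a h f g))" for h
  have V_ge: "ereal (mse s N K a h f0 g0) \<le> V h" for h
    unfolding V_def by (rule SUP_upper2[OF D0]) simp
  have V0: "V h0 \<le> ereal (mse s N K a h0 f0 g0)"
    unfolding V_def by (rule SUP_least) (use saddle in auto)
  have H_D: "h \<in> H_class s N K D \<Longrightarrow> h \<in> L2s s N K f0 g0" for h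
    using D0 by (auto simp: H_class_def)
  have mr_iff: "minimax_robust s N K a D h \<longleftrightarrow> h \<in> H_class s N K D \<and> (\<forall>k\<in>H_class s N K D. V h \<le> V k)" for h
    unfolding minimax_robust_def is_arg_min_def V_def by (auto simp: not_less)
  have h0_H: "h0 \<in> H_class s N K D"
    using h0_span by (auto simp: H_class_def)
  have mr: "minimax_robust s N K a D h0"
    unfolding mr_iff
  proof (intro conjI ballI h0_H)
    fix k assume "k \<in> H_class s N K D"
    note V0
    also have "ereal (mse s N K a h0 f0 g0) \<le> ereal (mse s N K a k f0 g0)"
      using mse_min[OF H_D[OF \<open>k \<in> H_class s N K D\<close>]] by simp
    also note V_ge
    finally show "V h0 \<le> V k" .
  qed
  have uniq: "AE \<omega> in lborel. h \<omega> = h0 \<omega>" if "minimax_robust s N K a D h" for h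
  proof -
    have hD: "h \<in> L2s s N K f0 g0" and le: "V h \<le> V h0"
      using that h0_H H_D unfolding mr_iff by auto
    have "ereal (mse s N K a h f0 g0) \<le> ereal (mse s N K a h0 f0 g0)"
      using V_ge le V0 by (meson order_trans)
    then have "1 / (2 * pi) * sqn M (\<lambda>\<omega>. h \<omega> - h0 \<omega>) \<le> 0"
      using mse_expand[OF hD] by simp
    then have "sqn M (\<lambda>\<omega>. h \<omega> - h0 \<omega>) = 0"
      using sqn_nonneg[of M "\<lambda>\<omega>. h \<omega> - h0 \<omega>"] pi_gt_zero by (auto simp: divide_le_0_iff)
    then have "AE \<omega> in M. h \<omega> - h0 \<omega> = 0"
      by (intro sqn_eq_0D L2fun_diff spanL hD h0_span[OF D0])
    \<comment> \<open>Null sets of \<open>M\<close> are blind to the zeros of w; positivity of w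
      almost everywhere removes this restriction.\<close>
    then have "AE \<omega> in lborel. 0 < w \<omega> \<longrightarrow> h \<omega> = h0 \<omega>"
      unfolding M_def weighted_def by (subst (asm) AE_density) auto
    then show ?thesis using wpos by eventually_elim simp
  qed
  from lf mr uniq show ?thesis by blast
qed

end
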